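(* Let $\Sigma=(X,\sigma)$ be a topological dynamical system, with $X$ a non-empty compact Hausdorff space and $\sigma$ a homeomorphism of $X$. Let $\mathscr A$ be the set of all closed ideals of $\ell^1(\Sigma)$ and let $\mathscr B=\{\mathcal Z(I): I\in\mathscr A\}$ be the ensuing subset of the set of all $\sigma\times\mathrm{id}_{\mathbb T}$-invariant closed subsets of $X\times\mathbb T$, both ordered by inclusion. Then $\mathcal Z:\mathscr A\to\mathscr B$ and $\mathcal I:\mathscr B\to\mathscr A$ are decreasing, $\mathcal I\circ\mathcal Z(I)\supset I$ for all $I\in\mathscr A$, and $\mathcal Z\circ\mathcal I=\mathrm{id}_{\mathscr B}$. Let $\mathscr A_{\mathrm{invrep}}$ be the set of all kernels of involutive representations of $\ell^1(\Sigma)$. Then: (1) $\mathcal Z:\mathscr A_{\mathrm{invrep}}\to\mathscr B$ and $\mathcal I:\mathscr B\to\mathscr A_{\mathrm{invrep}}$ are mutually inverse bijections. (2) The following are equivalent: (a) $\mathcal Z$ is injective on $\mathscr A$; (b) each closed ideal $I$ of $\ell^1(\Sigma)$ is of the form $\mathcal I(S)$ for some $S\in\mathscr B$; (c) each closed ideal of $\ell^1(\Sigma)$ is the kernel of an involutive representation of $\ell^1(\Sigma)$; (d) for each $S\in\mathscr B$, $\mathcal I(S)$ is the unique closed ideal $I'$ of $\ell^1(\Sigma)$ such that $\mathcal Z(I')=S$. (3) For each ideal $I$ that is the kernel of an involutive representation of $\ell^1(\Sigma)$, $\mathcal Z(I)$ is the unique element $S$ of $\mathscr B$ such that $\mathcal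 I(S)=I$. (4) If $I$ is a closed ideal of $\ell^1(\Sigma)$, then $\mathcal I\mathcal Z(I)$ is the smallest kernel of an involutive representation of $\ell^1(\Sigma)$ that contains $I$, and it is also the largest closed ideal $I'$ of $\ell^1(\Sigma)$ such that $\mathcal Z(I')=\mathcal Z(I)$. It is self-adjoint and, if $S_{\mathrm{ap}}\subset\mathrm{Aper}(\sigma)$, $S_{\mathrm p}\subset\mathrm{Per}(\sigma)$, and, for each $x\in S_{\mathrm{ap}}\cup S_{\mathrm p}$, $\mathbb T_x\subset\mathbb T$, are such that $$\mathcal Z(I)=\bigcup_{x\in S_{\mathrm{ap}}}\bigcup_{\lambda\in\mathbb T_x}(\mathbb Z\cdot x)\times\{\lambda\}\ \cup\ \bigcup_{x\in S_{\mathrm p}}\bigcup_{\mu\in\mathbb T_x}(\mathbb Z\cdot x)\times\{\mu\},$$ then $$\mathcal I\mathcal Z(I)=\bigcap_{x\in S_{\mathrm{ap}}}P_x\,\cap\,\bigcap_{x\in S_{\mathrm p}}\bigcap_{\mu\in\mathbb T_x}P_{x,\mu^{p(x)}},$$ where $p(x)$ denotes the period of $x\in S_{\mathrm p}$.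
   Context: Algebra. $C(X)$ is the algebra of continuous complex functions on $X$ with supremum norm, and $\alpha(f)=f\circ\sigma^{-1}$ for $f\in C(X)$. $\ell^1(\Sigma)$ is the set of maps $a:\mathbb Z\to C(X)$ with $\|a\|=\sum_n\|a(n)\|<\infty$, with product $(aa')(n)=\sum_{k\in\mathbb Z}a(k)\,\alpha^k(a'(n-k))$ and involution $a^*(n)=\overline{\alpha^n(a(-n))}$; it is a unital Banach $*$-algebra with isometric involution. Let $\delta$ be the element with value $1$ at $1$ and $0$ elsewhere, and identify $C(X)$ with the elements supported at $0$. Each $a\in\ell^1(\Sigma)$ is uniquely a norm convergent sum $a=\sum_n a_n\delta^n$ with $a_n=a(n)\in C(X)$. Ideals are two-sided. An intersection over an empty index set is $\ell^1(\Sigma)$. An involutive representation is a $*$-homomorphism into the bounded operators on a Hilbert space; the zero representation (with kernel $\ell^1(\Sigma)$) is allowed. "Decreasing" means inclusion reversing. Transform. For $a=\sum_n a_n\delta^n$ put $\mathfrak F(a)(x,\lambda)=\sum_n\lambda^na_n(x)$, $(x,\lambda)\in X\times\mathbb T$, where $\mathbb T$ is the unit circle in $\mathbb C$. For a linear subspace $L\subset\ell^1(\Sigma)$, $\mathcal Z(L)=\{(x,\lambda)\in X\times\mathbb T:\mathfrak F(a)(x,\lambda)=0\ \forall a\in L\}$. For $S\subset X\times\mathbb T$, $\mathcal I(S)=\{a\in\ell^1(\Sigma):\mathfrak F(a f)(x,\lambda)=0\text{ for all }f\in C(X)\text{ and all }(x,\lambda)\in S\}$. Points and representations. $\mathrm{Aper}(\sigma)$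 and $\mathrm{Per}(\sigma)$ are the sets of aperiodic and periodic points of $\sigma$; $\mathbb Z\cdot x$ is the orbit of $x$. For $x\in\mathrm{Aper}(\sigma)$, $P_x=\ker\pi_x$, where $\pi_x$ is the involutive representation on a Hilbert space with orthonormal basis $(e_k)_{k\in\mathbb Z}$ given by $\pi_x(\delta)e_k=e_{k+1}$, $\pi_x(f)e_k=f(\sigma^kx)e_k$ $(f\in C(X))$. For $x$ of (minimal) period $p$ and $\lambda\in\mathbb T$, $P_{x,\lambda}=\ker\pi_{x,\lambda}$, where $\pi_{x,\lambda}$ is the involutive representation on a Hilbert space with orthonormal basis $e_0,\dots,e_{p-1}$ given by $\pi_{x,\lambda}(\delta)e_k=e_{k+1}$ for $0\le k<p-1$, $\pi_{x,\lambda}(\delta)e_{p-1}=\lambda e_0$, $\pi_{x,\lambda}(f)e_k=f(\sigma^kx)e_k$.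
   Formalization: In the intersection formula of (4), the sets T_x for x in S_ap are additionally assumed non-empty; otherwise it fails, e.g. for I = ℓ¹(Σ), S_ap = {x}, T_x = ∅, S_p = ∅, where Z(I) = ∅ but P_x is a proper ideal. *)

theory Defs
  imports "HOL-Analysis.Analysis"
begin

section \<open>The Banach space of continuous functions\<close>

text \<open>The type \<open>'a \<Rightarrow>\<^sub>C complex\<close> carries the supremum norm; on a compact space it consists of all
  continuous complex functions. The library proves completeness only for metric domains.\<close>

instance bcontfun :: (topological_space, complete_space) complete_space
proof
  fix f :: "nat \<Rightarrow> ('a, 'b) bcontfun"
  assume "Cauchy f"
  then obtain g where "uniform_limit UNIV f g sequentially"
    using uniformly_convergent_eq_cauchy[of "\<lambda>_. True" f]
    unfolding Cauchy_def uniform_limit_sequentially_iff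
    by (metis dist_fun_lt_imp_dist_val_lt)
  from uniform_limit_bcontfunE[OF this sequentially_bot]
  obtain l' where "g = apply_bcontfun l'" "f \<longlonglongrightarrow> l'" by metis
  then show "convergent f"
    by (intro convergentI)
qed

instance bcontfun :: (topological_space, banach) banach ..

lemma apply_Bcontfun: "f \<in> bcontfun \<Longrightarrow> apply_bcontfun (Bcontfun f) = f"
  by (rule Bcontfun_inverse)

lemma continuous_imp_bcontfun:
  fixes f :: "'a::topological_space \<Rightarrow> 'b::metric_space"
  assumes "compact (UNIV :: 'a set)" "continuous_on UNIV f"
  shows "f \<in> bcontfun"
  using assms by (auto simp: bcontfun_def intro: compact_imp_bounded compact_continuous_image)

setup_lifting type_definition_bcontfun

lift_definition cf_times ::
  "('a::topological_space \<Rightarrow>\<^sub>C complex) \<Rightarrow> ('a \<Rightarrow>\<^sub>C complex) \<Rightarrow> ('a \<Rightarrow>\<^sub>C complex)"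
  is "\<lambda>f g x. f x * g x"
proof -
  fix f g :: "'a \<Rightarrow> complex"
  assume fg: "f \<in> bcontfun" "g \<in> bcontfun"
  obtain A where A: "\<And>x. cmod (f x) \<le> A"
    using fg(1) by (fastforce simp: bcontfun_def bounded_iff)
  obtain B where B: "\<And>x. cmod (g x) \<le> B"
    using fg(2) by (fastforce simp: bcontfun_def bounded_iff)
  have "cmod (f x * g x) \<le> A * B" for x
    unfolding norm_mult by (intro mult_mono A B norm_ge_zero order_trans[OF norm_ge_zero A])
  then show "(\<lambda>x. f x * g x) \<in> bcontfun"
    using fg by (intro bcontfun_normI) (auto simp: bcontfun_def intro!: continuous_intros)
qed

lift_definition cf_cnj :: "('a::topological_space \<Rightarrow>\<^sub>C complex) \<Rightarrow> ('a \<Rightarrow>\<^sub>C complex)"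
  is "\<lambda>f x. cnj (f x)"
  by (auto simp: bcontfun_def bounded_iff intro!: continuous_intros)

lemmas [simp] = cf_times.rep_eq cf_cnj.rep_eq

lifting_update bcontfun.lifting
lifting_forget bcontfun.lifting

lemma norm_cf_times: "norm (cf_times f g) \<le> norm f * norm g"
  by (rule norm_bound) (auto simp: norm_mult intro!: mult_mono norm_bounded)

lemma norm_cf_cnj [simp]: "norm (cf_cnj f) = norm f"
proof (rule antisym)
  show "norm (cf_cnj f) \<le> norm f"
    by (rule norm_bound) (simp add: norm_bounded)
  show "norm f \<le> norm (cf_cnj f)"
    by (rule norm_bound) (metis cf_cnj.rep_eq complex_mod_cnj norm_bounded)
qed


section \<open>Dynamics\<close>

text \<open>Integer iterates of a bijection.\<close>

definition int_iter :: "('b \<Rightarrow> 'b) \<Rightarrow> int \<Rightarrow> 'b \<Rightarrow> 'b" where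
  "int_iter g k = (if 0 \<le> k then g ^^ nat k else inv g ^^ nat (- k))"

definition orbit :: "('a \<Rightarrow> 'a) \<Rightarrow> 'a \<Rightarrow> 'a set" where
  "orbit \<sigma> x = range (\<lambda>k. int_iter \<sigma> k x)"

definition Per :: "('a \<Rightarrow> 'a) \<Rightarrow> 'a set" where
  "Per \<sigma> = {x. \<exists>n>0. (\<sigma> ^^ n) x = x}"

definition Aper :: "('a \<Rightarrow> 'a) \<Rightarrow> 'a set" where
  "Aper \<sigma> = {x. \<forall>n>0. (\<sigma> ^^ n) x \<noteq> x}"

definition period :: "('a \<Rightarrow> 'a) \<Rightarrow> 'a \<Rightarrow> nat" where
  "period \<sigma> x = (LEAST n. 0 < n \<and> (\<sigma> ^^ n) x = x)"

definition alpha ::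
  "('a::topological_space \<Rightarrow> 'a) \<Rightarrow> ('a \<Rightarrow>\<^sub>C complex) \<Rightarrow> ('a \<Rightarrow>\<^sub>C complex)" where
  "alpha \<sigma> f = Bcontfun (\<lambda>x. f (inv \<sigma> x))"

lemma homeomorphism_imp:
  assumes "homeomorphism UNIV UNIV \<sigma> (inv \<sigma>)"
  shows "bij \<sigma>" "continuous_on UNIV \<sigma>" "continuous_on UNIV (inv \<sigma>)"
  using assms unfolding homeomorphism_def
  by (auto simp: bij_def intro: inj_on_inverseI[of _ "inv \<sigma>"])

lemma apply_alpha:
  assumes "homeomorphism UNIV UNIV \<sigma> (inv \<sigma>)"
  shows "apply_bcontfun (alpha \<sigma> f) x = f (inv \<sigma> x)"
proof -
  have "continuous_on UNIV (\<lambda>x. f (inv \<sigma> x))"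
    by (rule continuous_on_compose2[OF continuous_on_apply_bcontfun[of UNIV f]])
       (use homeomorphism_imp[OF assms] in auto)
  then have "(\<lambda>x. f (inv \<sigma> x)) \<in> bcontfun"
    by (rule bcontfun_normI) (rule norm_bounded)
  then show ?thesis
    by (simp add: alpha_def apply_Bcontfun)
qed

lemma alpha_inverse:
  assumes "homeomorphism UNIV UNIV \<sigma> (inv \<sigma>)"
  shows "alpha \<sigma> (alpha (inv \<sigma>) f) = f" "alpha (inv \<sigma>) (alpha \<sigma> f) = f"
proof -
  have b: "bij \<sigma>" by (rule homeomorphism_imp[OF assms])
  have ii: "inv (inv \<sigma>) = \<sigma>" by (rule inv_inv_eq[OF b])
  have h': "homeomorphism UNIV UNIV (inv \<sigma>) (inv (inv \<sigma>))"
    using assms by (simp add: ii homeomorphism_symD)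
  show "alpha \<sigma> (alpha (inv \<sigma>) f) = f" "alpha (inv \<sigma>) (alpha \<sigma> f) = f"
    using b by (auto intro!: bcontfun_eqI
        simp: apply_alpha[OF assms] apply_alpha[OF h'] ii bij_is_inj bij_is_surj surj_f_inv_f)
qed

lemma apply_alpha_iter:
  assumes h: "homeomorphism UNIV UNIV \<sigma> (inv \<sigma>)"
  shows "apply_bcontfun (int_iter (alpha \<sigma>) k f) x = f (int_iter \<sigma> (- k) x)"
proof -
  have b: "bij \<sigma>" by (rule homeomorphism_imp[OF h])
  have ii: "inv (inv \<sigma>) = \<sigma>" by (rule inv_inv_eq[OF b])
  have h': "homeomorphism UNIV UNIV (inv \<sigma>) (inv (inv \<sigma>))"
    using h by (simp add: ii homeomorphism_symD)
  have inva: "inv (alpha \<sigma>) = alpha (inv \<sigma>)"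
    using alpha_inverse[OF h] by (intro inv_equality) auto
  have *: "apply_bcontfun ((alpha \<tau> ^^ n) f) x = f ((inv \<tau> ^^ n) x)"
    if "homeomorphism UNIV UNIV \<tau> (inv \<tau>)" for \<tau> :: "'a \<Rightarrow> 'a" and n x
  proof (induction n arbitrary: x)
    case (Suc n)
    have "apply_bcontfun ((alpha \<tau> ^^ Suc n) f) x = f ((inv \<tau> ^^ n) (inv \<tau> x))"
      by (simp add: apply_alpha[OF that] Suc)
    then show ?case
      by (simp only: funpow_Suc_right o_apply)
  qed simp
  show ?thesis
    by (cases "k = 0") (auto simp: int_iter_def inva *[OF h] *[OF h'] ii)
qed

lemma norm_alpha_iter_le:
  assumes "homeomorphism UNIV UNIV \<sigma> (inv \<sigma>)"
  shows "norm (int_iter (alpha \<sigma>) k f) \<le> norm f"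
  by (rule norm_bound) (simp add: apply_alpha_iter[OF assms] norm_bounded)


section \<open>The crossed product algebra\<close>

text \<open>As a Banach space the algebra depends on the space only; product and involution, which
  depend on the homeomorphism, take it as an explicit argument.\<close>

typedef (overloaded) 'a ell1 =
  "{a :: int \<Rightarrow> ('a::topological_space \<Rightarrow>\<^sub>C complex). (\<lambda>n. norm (a n)) summable_on UNIV}"
  morphisms coeff Abs_ell1
  by (rule exI[of _ "\<lambda>_. 0"]) simp

setup_lifting type_definition_ell1

lemma summable_norm_coeff: "(\<lambda>n. norm (coeff a n)) summable_on UNIV"
  using coeff[of a] by simp

lemma ell1_eqI: "(\<And>n. coeff a n = coeff b n) \<Longrightarrow> a = b"
  by (metis coeff_inject ext)

instantiation ell1 :: (topological_space) real_vector
begin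

lift_definition zero_ell1 :: "'a ell1" is "\<lambda>_. 0"
  by simp

lift_definition plus_ell1 :: "'a ell1 \<Rightarrow> 'a ell1 \<Rightarrow> 'a ell1" is "\<lambda>a b n. a n + b n"
  by (rule summable_on_comparison_test[OF summable_on_add]) (assumption | rule norm_triangle_ineq norm_ge_zero)+

lift_definition minus_ell1 :: "'a ell1 \<Rightarrow> 'a ell1 \<Rightarrow> 'a ell1" is "\<lambda>a b n. a n - b n"
  by (rule summable_on_comparison_test[OF summable_on_add]) (assumption | rule norm_triangle_ineq4 norm_ge_zero)+

lift_definition uminus_ell1 :: "'a ell1 \<Rightarrow> 'a ell1" is "\<lambda>a n. - a n"
  by simp

lift_definition scaleR_ell1 :: "real \<Rightarrow> 'a ell1 \<Rightarrow> 'a ell1" is "\<lambda>r a n. r *\<^sub>R a n"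
  by (simp add: summable_on_cmult_right)

lemmas ell1_coeff_simps [simp] =
  zero_ell1.rep_eq plus_ell1.rep_eq minus_ell1.rep_eq uminus_ell1.rep_eq scaleR_ell1.rep_eq

instance
  by standard (auto intro!: ell1_eqI simp: algebra_simps)

end

instantiation ell1 :: (topological_space) real_normed_vector
begin

lift_definition norm_ell1 :: "'a ell1 \<Rightarrow> real" is "\<lambda>a. \<Sum>\<^sub>\<infinity>n. norm (a n)" .

definition "dist_ell1 (a :: 'a ell1) b = norm (a - b)"
definition "sgn_ell1 (a :: 'a ell1) = a /\<^sub>R norm a"
definition "uniformity_ell1 = (INF e\<in>{0<..}. principal {(x :: 'a ell1, y). dist x y < e})"
definition "open_ell1 U = (\<forall>x\<in>U. \<forall>\<^sub>F (x', y :: 'a ell1) in uniformity. x' = x \<longrightarrow> y \<in> U)"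

instance
proof
  fix a b :: "'a ell1" and r :: real
  show "norm a = 0 \<longleftrightarrow> a = 0"
  proof
    assume "norm a = 0"
    then have "norm (coeff a n) = 0" for n
      using summable_norm_coeff[of a]
      by (intro nonneg_infsum_le_0D[of "\<lambda>n. norm (coeff a n)" UNIV]) (auto simp: norm_ell1.rep_eq)
    then show "a = 0"
      by (auto intro: ell1_eqI)
  qed (simp add: norm_ell1.rep_eq)
  show "norm (a + b) \<le> norm a + norm b"
  proof -
    have "norm (a + b) \<le> (\<Sum>\<^sub>\<infinity>n. norm (coeff a n) + norm (coeff b n))"
      unfolding norm_ell1.rep_eq
      by (rule infsum_mono)
         (auto intro!: summable_norm_coeff summable_on_add norm_triangle_ineq
               simp del: plus_ell1.rep_eq, simp add: norm_triangle_ineq)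
    then show ?thesis
      by (simp add: norm_ell1.rep_eq infsum_add summable_norm_coeff)
  qed
  show "norm (r *\<^sub>R a) = \<bar>r\<bar> * norm a"
    by (simp add: norm_ell1.rep_eq infsum_cmult_right summable_norm_coeff)
qed (simp_all add: dist_ell1_def sgn_ell1_def uniformity_ell1_def open_ell1_def)

end

lift_definition ell1_scale :: "complex \<Rightarrow> 'a::topological_space ell1 \<Rightarrow> 'a ell1"
  is "\<lambda>c a n. cf_times (const_bcontfun c) (a n)"
proof -
  fix c and a :: "int \<Rightarrow> ('a \<Rightarrow>\<^sub>C complex)"
  assume "(\<lambda>n. norm (a n)) summable_on UNIV"
  then have "(\<lambda>n. norm (const_bcontfun c :: 'a \<Rightarrow>\<^sub>C complex) * norm (a n)) summable_on UNIV"
    by (rule summable_on_cmult_right)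
  then show "(\<lambda>n. norm (cf_times (const_bcontfun c) (a n))) summable_on UNIV"
    by (rule summable_on_comparison_test) (auto intro: norm_cf_times)
qed

lift_definition ell1_of_cf :: "('a::topological_space \<Rightarrow>\<^sub>C complex) \<Rightarrow> 'a ell1"
  is "\<lambda>f n. if n = 0 then f else 0"
  by (rule finite_nonzero_values_imp_summable_on, rule finite_subset[of _ "{0}"]) (auto split: if_splits)

lift_definition delta :: "'a::topological_space ell1"
  is "\<lambda>n. if n = 1 then const_bcontfun 1 else 0"
  by (rule finite_nonzero_values_imp_summable_on, rule finite_subset[of _ "{1}"]) (auto split: if_splits)

text \<open>For a homeomorphism the two functions below are again summable, see the two lemmas
  following them.\<close>

definition ell1_times ::
  "('a::topological_space \<Rightarrow> 'a) \<Rightarrow> 'a ell1 \<Rightarrow> 'a ell1 \<Rightarrow> 'a ell1" where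
  "ell1_times \<sigma> a b =
    Abs_ell1 (\<lambda>n. \<Sum>\<^sub>\<infinity>k. cf_times (coeff a k) (int_iter (alpha \<sigma>) k (coeff b (n - k))))"

definition ell1_star :: "('a::topological_space \<Rightarrow> 'a) \<Rightarrow> 'a ell1 \<Rightarrow> 'a ell1" where
  "ell1_star \<sigma> a = Abs_ell1 (\<lambda>n. cf_cnj (int_iter (alpha \<sigma>) n (coeff a (- n))))"

lemma ell1_times_summable:
  assumes h: "homeomorphism UNIV UNIV \<sigma> (inv \<sigma>)"
  defines "t \<equiv> \<lambda>a b n k. cf_times (coeff a k) (int_iter (alpha \<sigma>) k (coeff b (n - k)))"
  shows "(\<lambda>k. norm (t a b n k)) summable_on UNIV"
    and "coeff (ell1_times \<sigma> a b) n = (\<Sum>\<^sub>\<infinity>k. t a b n k)"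
proof -
  have le: "norm (t a b n k) \<le> norm (coeff a k) * norm (coeff b (n - k))" for n k
    unfolding t_def
    by (rule order_trans[OF norm_cf_times]) (auto intro!: mult_left_mono norm_alpha_iter_le[OF h])
  have "(\<lambda>(k, m). norm (coeff a k) * norm (coeff b m)) summable_on UNIV \<times> UNIV"
    using summable_norm_coeff[of a] summable_norm_coeff[of b]
    by (intro summable_on_SigmaI[where g = "\<lambda>k. norm (coeff a k) * norm b"])
       (auto simp: norm_ell1.rep_eq intro!: has_sum_cmult_right summable_on_cmult_left has_sum_infsum)
  note prod_summable = this
  have bij: "bij_betw (\<lambda>p :: int \<times> int. (snd p, fst p - snd p)) (UNIV \<times> UNIV) (UNIV \<times> UNIV)"
    by (rule bij_betw_byWitness[where f' = "\<lambda>p. (snd p + fst p, fst p)"]) auto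
  have "(\<lambda>p. (\<lambda>(k, m). norm (coeff a k) * norm (coeff b m)) (snd p, fst p - snd p))
      summable_on UNIV \<times> UNIV"
    by (rule iffD2[OF summable_on_reindex_bij_betw[OF bij] prod_summable])
  then have s: "(\<lambda>(n, k). norm (t a b n k)) summable_on UNIV \<times> UNIV"
    by (rule summable_on_comparison_test) (auto simp: le)
  have s1: "(\<lambda>k. norm (t a b n k)) summable_on UNIV" for n
    using summable_on_SigmaD1[OF s, of n] by simp
  then show "(\<lambda>k. norm (t a b n k)) summable_on UNIV" .
  have "(\<lambda>n. \<Sum>\<^sub>\<infinity>k. norm (t a b n k)) summable_on UNIV"
    using summable_on_Sigma_banach[of "\<lambda>n k. norm (t a b n k)" UNIV "\<lambda>_. UNIV"] s by simp
  then have "(\<lambda>n. norm (\<Sum>\<^sub>\<infinity>k. t a b n k)) summable_on UNIV"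
    by (rule summable_on_comparison_test) (rule norm_infsum_bound[OF s1] norm_ge_zero)+
  then show "coeff (ell1_times \<sigma> a b) n = (\<Sum>\<^sub>\<infinity>k. t a b n k)"
    by (simp add: ell1_times_def t_def Abs_ell1_inverse)
qed

lemma coeff_ell1_star:
  assumes h: "homeomorphism UNIV UNIV \<sigma> (inv \<sigma>)"
  shows "coeff (ell1_star \<sigma> a) n = cf_cnj (int_iter (alpha \<sigma>) n (coeff a (- n)))"
proof -
  have bij: "bij_betw (uminus :: int \<Rightarrow> int) UNIV UNIV"
    by (rule bij_betw_byWitness[where f' = uminus]) auto
  have "(\<lambda>n. norm (coeff a (- n))) summable_on UNIV"
    by (rule iffD2[OF summable_on_reindex_bij_betw[OF bij, of "\<lambda>n. norm (coeff a n)"]])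
       (rule summable_norm_coeff)
  then have "(\<lambda>n. norm (cf_cnj (int_iter (alpha \<sigma>) n (coeff a (- n))))) summable_on UNIV"
    by (rule summable_on_comparison_test) (auto intro: norm_alpha_iter_le[OF h])
  then show ?thesis
    by (simp add: ell1_star_def Abs_ell1_inverse)
qed

definition closed_ideals :: "('a::topological_space \<Rightarrow> 'a) \<Rightarrow> 'a ell1 set set" where
  "closed_ideals \<sigma> = {I. closed I \<and> 0 \<in> I \<and> (\<forall>a\<in>I. \<forall>b\<in>I. a + b \<in> I) \<and>
     (\<forall>c. \<forall>a\<in>I. ell1_scale c a \<in> I) \<and>
     (\<forall>a\<in>I. \<forall>b. ell1_times \<sigma> a b \<in> I \<and> ell1_times \<sigma> b a \<in> I)}"


section \<open>The transform, zero sets and vanishing ideals\<close>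

definition transform :: "'a::topological_space ell1 \<Rightarrow> 'a \<times> complex \<Rightarrow> complex" where
  "transform a = (\<lambda>(x, l). \<Sum>\<^sub>\<infinity>n. l powi n * coeff a n x)"

definition zero_set :: "'a::topological_space ell1 set \<Rightarrow> ('a \<times> complex) set" where
  "zero_set L = {z \<in> UNIV \<times> sphere 0 1. \<forall>a\<in>L. transform a z = 0}"

definition vanishing_ideal ::
  "('a::topological_space \<Rightarrow> 'a) \<Rightarrow> ('a \<times> complex) set \<Rightarrow> 'a ell1 set" where
  "vanishing_ideal \<sigma> S =
    {a. \<forall>f. \<forall>z\<in>S. transform (ell1_times \<sigma> a (ell1_of_cf f)) z = 0}"

definition zero_sets :: "('a::topological_space \<Rightarrow> 'a) \<Rightarrow> ('a \<times> complex) set set" where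
  "zero_sets \<sigma> = zero_set ` closed_ideals \<sigma>"


section \<open>Hilbert spaces and involutive representations\<close>

record 'h cspace =
  hcarrier :: "'h set"
  hzero :: 'h
  hadd :: "'h \<Rightarrow> 'h \<Rightarrow> 'h"
  hscale :: "complex \<Rightarrow> 'h \<Rightarrow> 'h"
  hinner :: "'h \<Rightarrow> 'h \<Rightarrow> complex"

definition hnorm :: "'h cspace \<Rightarrow> 'h \<Rightarrow> real" where
  "hnorm H u = sqrt (Re (hinner H u u))"

definition hdist :: "'h cspace \<Rightarrow> 'h \<Rightarrow> 'h \<Rightarrow> real" where
  "hdist H u v = hnorm H (hadd H u (hscale H (- 1) v))"

locale complex_hilbert_space =
  fixes H :: "'h cspace"
  assumes zero_closed: "hzero H \<in> hcarrier H"
    and add_closed: "\<lbrakk>u \<in> hcarrier H; v \<in> hcarrier H\<rbrakk> \<Longrightarrow> hadd H u v \<in> hcarrier H"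
    and scale_closed: "u \<in> hcarrier H \<Longrightarrow> hscale H c u \<in> hcarrier H"
    and add_assoc: "\<lbrakk>u \<in> hcarrier H; v \<in> hcarrier H; w \<in> hcarrier H\<rbrakk> \<Longrightarrow>
      hadd H (hadd H u v) w = hadd H u (hadd H v w)"
    and add_commute: "\<lbrakk>u \<in> hcarrier H; v \<in> hcarrier H\<rbrakk> \<Longrightarrow> hadd H u v = hadd H v u"
    and add_zero: "u \<in> hcarrier H \<Longrightarrow> hadd H u (hzero H) = u"
    and add_inverse: "u \<in> hcarrier H \<Longrightarrow> hadd H u (hscale H (- 1) u) = hzero H"
    and scale_add_right: "\<lbrakk>u \<in> hcarrier H; v \<in> hcarrier H\<rbrakk> \<Longrightarrow>
      hscale H c (hadd H u v) = hadd H (hscale H c u) (hscale H c v)"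
    and scale_add_left: "u \<in> hcarrier H \<Longrightarrow>
      hscale H (c + d) u = hadd H (hscale H c u) (hscale H d u)"
    and scale_scale: "u \<in> hcarrier H \<Longrightarrow> hscale H c (hscale H d u) = hscale H (c * d) u"
    and scale_one: "u \<in> hcarrier H \<Longrightarrow> hscale H 1 u = u"
    and inner_add_left: "\<lbrakk>u \<in> hcarrier H; v \<in> hcarrier H; w \<in> hcarrier H\<rbrakk> \<Longrightarrow>
      hinner H (hadd H u v) w = hinner H u w + hinner H v w"
    and inner_scale_left: "\<lbrakk>u \<in> hcarrier H; v \<in> hcarrier H\<rbrakk> \<Longrightarrow>
      hinner H (hscale H c u) v = c * hinner H u v"
    and inner_commute: "\<lbrakk>u \<in> hcarrier H; v \<in> hcarrier H\<rbrakk> \<Longrightarrow>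
      hinner H u v = cnj (hinner H v u)"
    and inner_nonneg: "u \<in> hcarrier H \<Longrightarrow> 0 \<le> Re (hinner H u u)"
    and inner_definite: "\<lbrakk>u \<in> hcarrier H; hinner H u u = 0\<rbrakk> \<Longrightarrow> u = hzero H"
    and complete: "Metric_space.mcomplete (hcarrier H) (hdist H)"

definition bounded_operator :: "'h cspace \<Rightarrow> ('h \<Rightarrow> 'h) \<Rightarrow> bool" where
  "bounded_operator H T \<longleftrightarrow>
    (\<forall>u\<in>hcarrier H. T u \<in> hcarrier H) \<and>
    (\<forall>u\<in>hcarrier H. \<forall>v\<in>hcarrier H. T (hadd H u v) = hadd H (T u) (T v)) \<and>
    (\<forall>c. \<forall>u\<in>hcarrier H. T (hscale H c u) = hscale H c (T u)) \<and>
    (\<exists>K. \<forall>u\<in>hcarrier H. hnorm H (T u) \<le> K * hnorm H u)"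

text \<open>Operators are identified when they agree on the carrier. The last clause says that the
  image of \<open>a\<^sup>*\<close> is the adjoint of the image of \<open>a\<close>. Representations may be degenerate.\<close>

definition involutive_rep ::
  "('a::topological_space \<Rightarrow> 'a) \<Rightarrow> 'h cspace \<Rightarrow> ('a ell1 \<Rightarrow> 'h \<Rightarrow> 'h) \<Rightarrow> bool" where
  "involutive_rep \<sigma> H \<pi> \<longleftrightarrow>
    (\<forall>a. bounded_operator H (\<pi> a)) \<and>
    (\<forall>a b. \<forall>u\<in>hcarrier H. \<pi> (a + b) u = hadd H (\<pi> a u) (\<pi> b u)) \<and>
    (\<forall>c a. \<forall>u\<in>hcarrier H. \<pi> (ell1_scale c a) u = hscale H c (\<pi> a u)) \<and>
    (\<forall>a b. \<forall>u\<in>hcarrier H. \<pi> (ell1_times \<sigma> a b) u = \<pi> a (\<pi> b u)) \<and>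
    (\<forall>a. \<forall>u\<in>hcarrier H. \<forall>v\<in>hcarrier H. hinner H (\<pi> (ell1_star \<sigma> a) u) v = hinner H u (\<pi> a v))"

definition rep_kernel :: "'h cspace \<Rightarrow> ('a::topological_space ell1 \<Rightarrow> 'h \<Rightarrow> 'h) \<Rightarrow> 'a ell1 set" where
  "rep_kernel H \<pi> = {a. \<forall>u\<in>hcarrier H. \<pi> a u = hzero H}"

text \<open>One cannot quantify over all Hilbert spaces inside a formula, so the kernels are collected
  over Hilbert spaces whose carrier is a set in a type that contains a copy of an arbitrary type
  \<open>'h\<close>. Leaving \<open>'h\<close> free covers Hilbert spaces of every size. The second summand guarantees room
  for the square-summable functions on \<open>X \<times> \<int> \<times> \<complex>\<close>, also when \<open>'h\<close> is small.\<close>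

definition invrep_kernels ::
  "'h itself \<Rightarrow> ('a::topological_space \<Rightarrow> 'a) \<Rightarrow> 'a ell1 set set" where
  "invrep_kernels _ \<sigma> =
    {rep_kernel H \<pi> | (H :: ('h + ('a \<times> int \<times> complex \<Rightarrow> complex)) cspace) \<pi>.
       complex_hilbert_space H \<and> involutive_rep \<sigma> H \<pi>}"

definition ell2 :: "'j set \<Rightarrow> ('j \<Rightarrow> complex) cspace" where
  "ell2 J = \<lparr>
     hcarrier = {u. (\<forall>j. j \<notin> J \<longrightarrow> u j = 0) \<and> (\<lambda>j. (cmod (u j))\<^sup>2) summable_on J},
     hzero = (\<lambda>_. 0),
     hadd = (\<lambda>u v j. u j + v j),
     hscale = (\<lambda>c u j. c * u j),
     hinner = (\<lambda>u v. \<Sum>\<^sub>\<infinity>j\<in>J. u j * cnj (v j))\<rparr>"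

definition ket :: "'j \<Rightarrow> 'j \<Rightarrow> complex" where
  "ket k = (\<lambda>j. if j = k then 1 else 0)"

text \<open>For a homeomorphism of a compact Hausdorff space the conditions under the two choice
  operators have a solution, and it is unique on the Hilbert space.\<close>

definition rep_aper ::
  "('a::topological_space \<Rightarrow> 'a) \<Rightarrow> 'a \<Rightarrow> 'a ell1 \<Rightarrow> (int \<Rightarrow> complex) \<Rightarrow> (int \<Rightarrow> complex)" where
  "rep_aper \<sigma> x = (SOME \<pi>. involutive_rep \<sigma> (ell2 UNIV) \<pi> \<and>
     (\<forall>k. \<pi> delta (ket k) = ket (k + 1)) \<and>
     (\<forall>f k. \<pi> (ell1_of_cf f) (ket k) = hscale (ell2 UNIV) (f (int_iter \<sigma> k x)) (ket k)))"

definition rep_per ::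
  "('a::topological_space \<Rightarrow> 'a) \<Rightarrow> 'a \<Rightarrow> complex \<Rightarrow> 'a ell1 \<Rightarrow> (nat \<Rightarrow> complex) \<Rightarrow> (nat \<Rightarrow> complex)"
  where
  "rep_per \<sigma> x l = (let p = period \<sigma> x; H = ell2 {..<p} in
     SOME \<pi>. involutive_rep \<sigma> H \<pi> \<and>
       (\<forall>k < p - 1. \<pi> delta (ket k) = ket (k + 1)) \<and>
       \<pi> delta (ket (p - 1)) = hscale H l (ket 0) \<and>
       (\<forall>f. \<forall>k<p. \<pi> (ell1_of_cf f) (ket k) = hscale H (f ((\<sigma> ^^ k) x)) (ket k)))"

definition P_aper :: "('a::topological_space \<Rightarrow> 'a) \<Rightarrow> 'a \<Rightarrow> 'a ell1 set" where
  "P_aper \<sigma> x = rep_kernel (ell2 UNIV) (rep_aper \<sigma> x)"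

definition P_per :: "('a::topological_space \<Rightarrow> 'a) \<Rightarrow> 'a \<Rightarrow> complex \<Rightarrow> 'a ell1 set" where
  "P_per \<sigma> x l = rep_kernel (ell2 {..<period \<sigma> x}) (rep_per \<sigma> x l)"

end

theory Submission
  imports Defs
begin

text \<open>
  Apart from the Galois connection between closed ideals and zero sets, everything rests on the
  inclusion \<open>\<I>(\<Z>(K)) \<subseteq> K\<close> for the kernel \<open>K\<close> of an involutive representation \<open>\<pi>\<close>. Conversely,
  \<open>\<I>(S)\<close> for an invariant \<open>S\<close> is the kernel of the representation on the square-summable functions
  on \<open>S\<close> given by \<open>(\<pi>(a)u)(y,\<lambda>) = \<Sum>\<^sub>n \<lambda>\<^sup>n a\<^sub>n(y) u(\<sigma>\<^sup>-\<^sup>n y, \<lambda>)\<close>, because both say that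
  \<open>\<Sum> \<lambda>\<^sup>n a\<^sub>n(y) = 0\<close>, the sum over the \<open>n\<close> with \<open>\<sigma>\<^sup>-\<^sup>n y = z\<close>, for all \<open>(y,\<lambda>) \<in> S\<close> and all \<open>z\<close>.

  For the inclusion let \<open>R\<close> be the orthogonal complement of the vectors killed by \<open>\<I>(\<Z>(K))\<close>; a
  vector of \<open>R\<close> that is killed by \<open>\<I>(\<Z>(K))\<close> is zero, and the claim is \<open>R = 0\<close>. First, \<open>R\<close> contains
  no nonzero vector supported on the points of period at most \<open>p\<close>. By induction on \<open>p\<close> it suffices to
  look near a point of exact period \<open>p\<close>. There \<open>\<delta>\<^sup>p\<close> commutes with functions, so the compression of
  the algebra is commutative with spectrum in \<open>X \<times> \<T>\<close>. Polynomial growth of the powers of a finitely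
  supported element bounds its norm in the representation by the supremum of its transform, and
  elements of \<open>K\<close> then allow one to cut the transform down to \<open>\<Z>(K)\<close>. Second, every point \<open>y\<close> in the
  support of \<open>C(X)\<close> acting on \<open>R\<close> is therefore a limit of points of arbitrarily large period in that
  support. Near such points a compression of \<open>b\<close> reduces to its zeroth coefficient, up to a tail, so
  the coefficients of elements of \<open>K\<close> vanish at \<open>y\<close> and \<open>{y} \<times> \<T> \<subseteq> \<Z>(K)\<close>. Hence the coefficients of
  elements of \<open>\<I>(\<Z>(K))\<close> vanish on the support, and \<open>R = 0\<close>.
\<close>

section \<open>Iterates of a homeomorphism\<close>

text \<open>That \<open>R = 0\<close> suffices rests on self-adjointness: \<I>(\<Z>(K)) is itself a
  kernel, hence closed under the involution, so its operators map every vector into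
  \<open>R\<close>. The obstacle is that the transform is multiplicative only for the trivial
  system. It therefore enters where the given product can be exchanged for the commutative one: on
  vectors living on points of period at most \<open>p\<close>, for elements whose exponents are
  multiples of \<open>p\<close> and whose coefficients live near a point of exact period
  \<open>p\<close>. Elsewhere no symbol is available, and the second step uses instead that low
  periods are already excluded from \<open>R\<close>. The bound by the supremum of the transform is
  a spectral radius estimate: if \<open>b\<close> has exponents up to \<open>N\<close>, the power of
  exponent \<open>m\<close> of \<open>b\<^sup>* b\<close> has at most \<open>4 m N + 1\<close>
  coefficients, each bounded by the supremum of its transform, and the linear factor disappears
  under the \<open>m\<close>-th root. The principle \<open>localization\<close> is used twice, once
  for functions and once for transforms.\<close>

lemma bounded_linear_apply_bcontfun:
  "bounded_linear (\<lambda>f :: 'a::topological_space \<Rightarrow>\<^sub>C 'b::real_normed_vector. apply_bcontfun f x)"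
  by (rule bounded_linear_intro[where K = 1]) (auto simp: norm_bounded)

lemma int_iter_0 [simp]: "int_iter g 0 x = x"
  by (simp add: int_iter_def)

lemma int_iter_of_nat: "int_iter g (int n) = g ^^ n"
  by (simp add: int_iter_def)

lemma int_iter_plus_1:
  assumes "bij g"
  shows "int_iter g (k + 1) x = g (int_iter g k x)"
proof (cases "0 \<le> k")
  case True
  then have "nat (k + 1) = Suc (nat k)" by simp
  with True show ?thesis by (simp add: int_iter_def)
next
  case False
  then have *: "nat (- k) = Suc (nat (- (k + 1)))" by simp
  have "int_iter g (k + 1) x = (inv g ^^ nat (- (k + 1))) x"
    using False by (auto simp: int_iter_def)
  also have "\<dots> = g ((inv g ^^ nat (- k)) x)"
    unfolding * using assms by (simp add: bij_is_surj surj_f_inv_f)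
  finally show ?thesis using False by (simp add: int_iter_def)
qed

lemma int_iter_add:
  assumes "bij g"
  shows "int_iter g (m + n) x = int_iter g m (int_iter g n x)"
proof (induction m rule: int_induct[where k = 0])
  case (step1 i)
  have "i + 1 + n = (i + n) + 1" by simp
  then show ?case using step1 by (simp only: int_iter_plus_1[OF assms])
next
  case (step2 i)
  have "g (int_iter g (i - 1 + n) x) = g (int_iter g (i - 1) (int_iter g n x))"
    using step2 int_iter_plus_1[OF assms, of "i - 1 + n" x]
      int_iter_plus_1[OF assms, of "i - 1" "int_iter g n x"]
    by (simp add: algebra_simps)
  then show ?case using assms by (meson bij_is_inj injD)
qed simp

lemma int_iter_minus_cancel:
  assumes "bij g"
  shows "int_iter g (- n) (int_iter g n x) = x" "int_iter g n (int_iter g (- n) x) = x"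
  using int_iter_add[OF assms, of "- n" n x] int_iter_add[OF assms, of n "- n" x] by simp_all

lemma int_iter_id [simp]: "int_iter id n x = x"
  by (simp add: int_iter_def)

lemma int_iter_mult:
  assumes "bij g"
  shows "int_iter (int_iter g p) n x = int_iter g (p * n) x"
proof -
  have b: "bij (int_iter g p)"
    by (rule bij_betw_byWitness[where f' = "int_iter g (- p)"])
       (auto simp: int_iter_minus_cancel[OF assms])
  show ?thesis
  proof (induction n rule: int_induct[where k = 0])
    case (step1 i)
    then show ?case
      using int_iter_add[OF assms, of p "p * i" x]
      by (simp only: int_iter_plus_1[OF b] distrib_left mult_1_right add.commute[of "p * i"])
  next
    case (step2 i)
    have "int_iter g p (int_iter (int_iter g p) (i - 1) x) = int_iter g p (int_iter g (p * (i - 1)) x)"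
      using step2 int_iter_plus_1[OF b, of "i - 1" x] int_iter_add[OF assms, of p "p * (i - 1)" x]
      by (simp add: algebra_simps)
    then show ?case using b by (meson bij_is_inj injD)
  qed simp
qed

lemma int_iter_fixed:
  assumes "bij g" "g x = x"
  shows "int_iter g n x = x"
proof -
  have "(g ^^ k) x = x" for k using assms(2) by (induction k) auto
  moreover have "(inv g ^^ k) x = x" for k
    using assms by (induction k) (auto simp: bij_is_inj inv_f_eq)
  ultimately show ?thesis by (simp add: int_iter_def)
qed

lemma continuous_on_int_iter:
  fixes g :: "'a::topological_space \<Rightarrow> 'a"
  assumes "homeomorphism UNIV UNIV g (inv g)"
  shows "continuous_on UNIV (int_iter g n)"
proof -
  have "continuous_on UNIV (f ^^ k)" if "continuous_on UNIV f" for f :: "'a \<Rightarrow> 'a" and k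
  proof (induction k)
    case (Suc k)
    then show ?case
      using continuous_on_compose[of UNIV "f ^^ k" f] that by (auto intro: continuous_on_subset)
  qed (simp add: id_def)
  then show ?thesis
    using homeomorphism_imp[OF assms] by (simp add: int_iter_def)
qed

text \<open>For the identity the product of the algebra is the commutative convolution; it serves
  below as the product of comparison.\<close>

lemma homeomorphism_id: "homeomorphism UNIV UNIV id (inv id)"
  by (simp add: homeomorphism_def id_def[symmetric])

lemma has_sum_singleI:
  assumes "\<And>j. j \<noteq> i \<Longrightarrow> f j = 0"
  shows "(f has_sum f i) UNIV"
  using has_sum_cong_neutral[of "{i}" UNIV f f "f i"] assms by (auto intro: has_sum_finiteI)

lemma infsum_singleI:
  assumes "\<And>j. j \<noteq> i \<Longrightarrow> f j = 0"
  shows "infsum f UNIV = f i"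
  using has_sum_singleI[of i f, OF assms] by (rule infsumI)

section \<open>Elements of the algebra\<close>

lemma norm_coeff_le: "norm (coeff a n) \<le> norm a"
  unfolding norm_ell1.rep_eq
  using finite_sum_le_infsum[OF summable_norm_coeff[of a], of "{n}"] by simp

lemma coeff_sum: "coeff (sum f A) n = (\<Sum>i\<in>A. coeff (f i) n)"
  by (induction A rule: infinite_finite_induct) auto

lift_definition ell1_single :: "('a::topological_space \<Rightarrow>\<^sub>C complex) \<Rightarrow> int \<Rightarrow> 'a ell1"
  is "\<lambda>f m n. if n = m then f else 0"
proof -
  fix f :: "'a \<Rightarrow>\<^sub>C complex" and m :: int
  show "(\<lambda>n. norm (if n = m then f else 0)) summable_on UNIV"
    by (rule finite_nonzero_values_imp_summable_on, rule finite_subset[of _ "{m}"])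
       (auto split: if_splits)
qed

text \<open>Used both to truncate to finitely many exponents and to keep only the multiples of a
  period.\<close>

lift_definition ell1_restrict :: "int set \<Rightarrow> 'a::topological_space ell1 \<Rightarrow> 'a ell1"
  is "\<lambda>S a n. if n \<in> S then a n else 0"
  by (erule summable_on_comparison_test) auto

lemmas [simp] = ell1_single.rep_eq ell1_restrict.rep_eq ell1_of_cf.rep_eq delta.rep_eq
  ell1_scale.rep_eq

lemma ell1_of_cf_eq_single: "ell1_of_cf f = ell1_single f 0"
  by (rule ell1_eqI) simp

lemma delta_eq_single: "delta = ell1_single (const_bcontfun 1) 1"
  by (rule ell1_eqI) simp

lemma norm_ell1_single [simp]: "norm (ell1_single f m) = norm f"
  unfolding norm_ell1.rep_eq by (subst infsum_singleI[of m]) auto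

lemma norm_ell1_restrict: "norm (ell1_restrict S a) = (\<Sum>\<^sub>\<infinity>n\<in>S. norm (coeff a n))"
  unfolding norm_ell1.rep_eq by (rule infsum_cong_neutral) auto

lemma norm_ell1_restrict_mono: "S \<subseteq> T \<Longrightarrow> norm (ell1_restrict S a) \<le> norm (ell1_restrict T a)"
  unfolding norm_ell1_restrict
  by (rule infsum_mono2) (auto intro: summable_on_subset_banach[OF summable_norm_coeff])

text \<open>The estimate for all \<open>G\<close> containing \<open>F\<close> allows passing to a
  symmetric interval of exponents.\<close>

lemma ell1_restrict_tail:
  assumes "0 < e"
  obtains F where "finite F" "\<And>G. F \<subseteq> G \<Longrightarrow> norm (a - ell1_restrict G a) < e"
proof -
  obtain F where F: "finite F"
    "dist (\<Sum>n\<in>F. norm (coeff a n)) (\<Sum>\<^sub>\<infinity>n. norm (coeff a n)) \<le> e / 2"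
    using infsum_finite_approximation[OF summable_norm_coeff[of a], of "e / 2"] assms by auto
  have "norm a = (\<Sum>\<^sub>\<infinity>n\<in>F \<union> - F. norm (coeff a n))"
    by (simp add: norm_ell1.rep_eq)
  also have "\<dots> = (\<Sum>\<^sub>\<infinity>n\<in>F. norm (coeff a n)) + (\<Sum>\<^sub>\<infinity>n\<in>- F. norm (coeff a n))"
    by (rule infsum_Un_disjoint) (auto intro: summable_on_subset_banach[OF summable_norm_coeff])
  finally have "norm (ell1_restrict (- F) a) \<le> e / 2"
    using F unfolding norm_ell1_restrict by (simp add: dist_real_def norm_ell1.rep_eq[symmetric])
  then have "norm (a - ell1_restrict G a) < e" if "F \<subseteq> G" for G
  proof -
    have "a - ell1_restrict G a = ell1_restrict (- G) a"
      by (rule ell1_eqI) auto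
    moreover have "norm (ell1_restrict (- G) a) \<le> norm (ell1_restrict (- F) a)"
      by (rule norm_ell1_restrict_mono) (use that in auto)
    ultimately show ?thesis
      using \<open>norm (ell1_restrict (- F) a) \<le> e / 2\<close> assms by simp
  qed
  with F(1) show thesis by (rule that)
qed

lemma ell1_restrict_finite:
  assumes "finite F"
  shows "ell1_restrict F a = (\<Sum>n\<in>F. ell1_single (coeff a n) n)"
proof (rule ell1_eqI)
  fix n
  have "coeff (\<Sum>k\<in>F. ell1_single (coeff a k) k) n = (\<Sum>k\<in>F. if n = k then coeff a k else 0)"
    by (simp add: coeff_sum)
  also have "\<dots> = coeff (ell1_restrict F a) n"
    using assms by simp
  finally show "coeff (ell1_restrict F a) n = coeff (\<Sum>k\<in>F. ell1_single (coeff a k) k) n" ..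
qed

text \<open>Finitely supported elements are dense, so a closed additive property need only be
  checked on the monomials of \<open>a\<close>.\<close>

lemma ell1_closed_induct:
  assumes "closed P" "0 \<in> P" "\<And>x y. x \<in> P \<Longrightarrow> y \<in> P \<Longrightarrow> x + y \<in> P"
    "\<And>n. ell1_single (coeff a n) n \<in> P"
  shows "a \<in> P"
proof -
  have sum: "(\<Sum>n\<in>F. ell1_single (coeff a n) n) \<in> P" for F
    by (induction F rule: infinite_finite_induct) (auto intro: assms)
  have "a \<in> closure P"
    unfolding closure_approachable
  proof (intro allI impI)
    fix e :: real assume "0 < e"
    then obtain F where F: "finite F" "\<And>G. F \<subseteq> G \<Longrightarrow> norm (a - ell1_restrict G a) < e"
      by (rule ell1_restrict_tail[of e a]) blast
    have "dist (ell1_restrict F a) a < e"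
      using F(2)[of F] by (simp add: dist_norm norm_minus_commute)
    moreover have "ell1_restrict F a \<in> P"
      using sum by (simp add: ell1_restrict_finite[OF F(1)])
    ultimately show "\<exists>y\<in>P. dist y a < e" by blast
  qed
  with assms(1) show ?thesis by simp
qed

text \<open>Completeness gives a sum to the Neumann series behind \<open>contractive\<close>. The
  limit is taken coefficientwise, and the Cauchy estimate survives it on finite sets of
  exponents.\<close>

instance ell1 :: (topological_space) banach
proof
  fix X :: "nat \<Rightarrow> 'a ell1"
  assume X: "Cauchy X"
  have "Cauchy (\<lambda>i. coeff (X i) n)" for n
    unfolding Cauchy_def
  proof (intro allI impI)
    fix e :: real assume "0 < e"
    then obtain M where M: "\<And>i j. i \<ge> M \<Longrightarrow> j \<ge> M \<Longrightarrow> dist (X i) (X j) < e"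
      using X unfolding Cauchy_def by blast
    have "dist (coeff (X i) n) (coeff (X j) n) \<le> dist (X i) (X j)" for i j
      using norm_coeff_le[of "X i - X j" n] by (simp add: dist_norm)
    with M show "\<exists>M. \<forall>i\<ge>M. \<forall>j\<ge>M. dist (coeff (X i) n) (coeff (X j) n) < e"
      by (meson le_less_trans)
  qed
  then have "\<forall>n. \<exists>l. (\<lambda>i. coeff (X i) n) \<longlonglongrightarrow> l"
    unfolding convergent_def[symmetric] by (blast intro: Cauchy_convergent)
  then obtain c where c: "\<And>n. (\<lambda>i. coeff (X i) n) \<longlonglongrightarrow> c n"
    by moura
  have bound: "(\<Sum>n\<in>F. norm (coeff (X i) n - c n)) \<le> e"
    if "\<And>j. j \<ge> M \<Longrightarrow> dist (X i) (X j) \<le> e" "finite F" for i M e F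
  proof (rule tendsto_upperbound)
    show "(\<lambda>j. \<Sum>n\<in>F. norm (coeff (X i) n - coeff (X j) n)) \<longlonglongrightarrow>
        (\<Sum>n\<in>F. norm (coeff (X i) n - c n))"
      by (intro tendsto_intros c)
    have "(\<Sum>n\<in>F. norm (coeff (X i) n - coeff (X j) n)) \<le> dist (X i) (X j)" for j
      using finite_sum_le_infsum[OF summable_norm_coeff[of "X i - X j"], of F] that(2)
      by (simp add: dist_norm norm_ell1.rep_eq)
    with that(1) show "\<forall>\<^sub>F j in sequentially. (\<Sum>n\<in>F. norm (coeff (X i) n - coeff (X j) n)) \<le> e"
      by (intro eventually_sequentiallyI[of M]) (meson order_trans)
  qed simp
  have tail: "\<exists>M. \<forall>i\<ge>M. \<forall>F. finite F \<longrightarrow> (\<Sum>n\<in>F. norm (coeff (X i) n - c n)) \<le> e" if e: "0 < e" for e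
  proof -
    obtain M where "\<And>i j. i \<ge> M \<Longrightarrow> j \<ge> M \<Longrightarrow> dist (X i) (X j) < e"
      using X e unfolding Cauchy_def by blast
    then show ?thesis by (intro exI[of _ M] allI impI bound[of M] less_imp_le)
  qed
  have summ: "(\<lambda>n. norm (coeff (X i) n - c n)) summable_on UNIV"
    if "\<And>F. finite F \<Longrightarrow> (\<Sum>n\<in>F. norm (coeff (X i) n - c n)) \<le> e" for i e
    using that by (intro nonneg_bdd_above_summable_on) (auto simp: bdd_above_def)
  obtain M where M: "\<And>F. finite F \<Longrightarrow> (\<Sum>n\<in>F. norm (coeff (X M) n - c n)) \<le> 1"
    using tail[of 1] by auto
  have "(\<lambda>n. norm (coeff (X M) n) + norm (coeff (X M) n - c n)) summable_on UNIV"
    by (intro summable_on_add summable_norm_coeff summ[OF M])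
  then have "(\<lambda>n. norm (c n)) summable_on UNIV"
  proof (rule summable_on_comparison_test)
    show "norm (c n) \<le> norm (coeff (X M) n) + norm (coeff (X M) n - c n)" for n
      using norm_triangle_ineq4[of "coeff (X M) n" "coeff (X M) n - c n"] by simp
  qed auto
  then have cc: "coeff (Abs_ell1 c) = c" by (simp add: Abs_ell1_inverse)
  have "X \<longlonglongrightarrow> Abs_ell1 c"
  proof (rule metric_LIMSEQ_I)
    fix r :: real assume "0 < r"
    then obtain M where M: "\<And>i F. i \<ge> M \<Longrightarrow> finite F \<Longrightarrow> (\<Sum>n\<in>F. norm (coeff (X i) n - c n)) \<le> r / 2"
      using tail[of "r / 2"] by auto
    have "dist (X i) (Abs_ell1 c) < r" if "i \<ge> M" for i
    proof -
      have "dist (X i) (Abs_ell1 c) = (\<Sum>\<^sub>\<infinity>n. norm (coeff (X i) n - c n))"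
        by (simp add: dist_norm norm_ell1.rep_eq cc)
      also have "\<dots> \<le> r / 2"
        by (intro infsum_le_finite_sums summ[OF M[OF that]] M[OF that])
      finally show ?thesis using \<open>0 < r\<close> by simp
    qed
    then show "\<exists>M. \<forall>i\<ge>M. dist (X i) (Abs_ell1 c) < r" by blast
  qed
  then show "convergent X" by (rule convergentI)
qed

text \<open>Fubini for the substitution \<open>m = n - k\<close> under a product majorant. It yields
  submultiplicativity of the norm and multiplicativity of the induced representations and, for the
  identity, of the transform.\<close>

lemma infsum_convolution:
  fixes F :: "int \<Rightarrow> int \<Rightarrow> 'b::banach"
  assumes le: "\<And>k m. norm (F k m) \<le> A k * B m"
    and A: "A summable_on UNIV" and B: "B summable_on UNIV"
    and nonneg: "\<And>k. 0 \<le> A k" "\<And>k. 0 \<le> B k"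
  shows "(\<Sum>\<^sub>\<infinity>n. \<Sum>\<^sub>\<infinity>k. F k (n - k)) = (\<Sum>\<^sub>\<infinity>k. \<Sum>\<^sub>\<infinity>m. F k m)"
    and "(\<lambda>n. \<Sum>\<^sub>\<infinity>k. F k (n - k)) summable_on UNIV"
    and "(\<lambda>k. F k (n - k)) summable_on UNIV"
proof -
  have AB: "(\<lambda>(k, m). A k * B m) summable_on UNIV \<times> UNIV"
    using A B nonneg
    by (intro summable_on_SigmaI[where g = "\<lambda>k. A k * infsum B UNIV"])
       (auto intro!: has_sum_cmult_right summable_on_cmult_left has_sum_infsum)
  from AB have "(\<lambda>p. norm (case p of (k, m) \<Rightarrow> F k m)) summable_on UNIV \<times> UNIV"
    by (rule summable_on_comparison_test) (auto simp: le)
  then have s: "(\<lambda>(k, m). F k m) summable_on UNIV \<times> UNIV"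
    by (rule abs_summable_summable)
  have bij: "bij_betw (\<lambda>p :: int \<times> int. (snd p, fst p - snd p)) (UNIV \<times> UNIV) (UNIV \<times> UNIV)"
    by (rule bij_betw_byWitness[where f' = "\<lambda>p. (snd p + fst p, fst p)"]) auto
  have eq: "(\<lambda>(n, k). F k (n - k)) = (\<lambda>p. (\<lambda>(k, m). F k m) (snd p, fst p - snd p))"
    by auto
  have s': "(\<lambda>(n, k). F k (n - k)) summable_on UNIV \<times> UNIV"
    unfolding eq by (rule iffD2[OF summable_on_reindex_bij_betw[OF bij] s])
  show "(\<Sum>\<^sub>\<infinity>n. \<Sum>\<^sub>\<infinity>k. F k (n - k)) = (\<Sum>\<^sub>\<infinity>k. \<Sum>\<^sub>\<infinity>m. F k m)"
    unfolding infsum_Sigma'_banach[OF s] infsum_Sigma'_banach[OF s'] eq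
    by (rule infsum_reindex_bij_betw[OF bij])
  show "(\<lambda>n. \<Sum>\<^sub>\<infinity>k. F k (n - k)) summable_on UNIV"
    using summable_on_Sigma_banach[OF s'] by simp
  show "(\<lambda>k. F k (n - k)) summable_on UNIV"
  proof -
    have "(\<lambda>p. (\<lambda>(k, m). A k * B m) (snd p, fst p - snd p)) summable_on UNIV \<times> UNIV"
      by (rule iffD2[OF summable_on_reindex_bij_betw[OF bij] AB])
    then have "(\<lambda>(n, k). norm (F k (n - k))) summable_on UNIV \<times> UNIV"
      by (rule summable_on_comparison_test) (auto simp: le)
    from summable_on_SigmaD1[OF this, of n] show ?thesis
      by (auto intro: abs_summable_summable)
  qed
qed

lemma coeff_times_has_sum:
  assumes "homeomorphism UNIV UNIV \<sigma> (inv \<sigma>)"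
  shows "((\<lambda>k. coeff a k x * coeff b (n - k) (int_iter \<sigma> (- k) x)) has_sum
    coeff (ell1_times \<sigma> a b) n x) UNIV"
proof -
  have "((\<lambda>k. cf_times (coeff a k) (int_iter (alpha \<sigma>) k (coeff b (n - k)))) has_sum
      coeff (ell1_times \<sigma> a b) n) UNIV"
    unfolding ell1_times_summable(2)[OF assms]
    by (rule has_sum_infsum[OF abs_summable_summable[OF ell1_times_summable(1)[OF assms]]])
  from has_sum_bounded_linear[OF bounded_linear_apply_bcontfun[of x] this]
  show ?thesis by (simp add: apply_alpha_iter[OF assms])
qed

lemma coeff_times_single_right:
  assumes "homeomorphism UNIV UNIV \<sigma> (inv \<sigma>)"
  shows "coeff (ell1_times \<sigma> a (ell1_single f m)) n x =
    coeff a (n - m) x * f (int_iter \<sigma> (m - n) x)"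
  using has_sum_unique[OF coeff_times_has_sum[OF assms, of a x "ell1_single f m" n]
      has_sum_singleI[of "n - m"]]
  by simp

lemma coeff_times_single_left:
  assumes "homeomorphism UNIV UNIV \<sigma> (inv \<sigma>)"
  shows "coeff (ell1_times \<sigma> (ell1_single f m) a) n x =
    f x * coeff a (n - m) (int_iter \<sigma> (- m) x)"
  using has_sum_unique[OF coeff_times_has_sum[OF assms, of "ell1_single f m" x a n]
      has_sum_singleI[of m]]
  by simp

lemma norm_ell1_times:
  assumes "homeomorphism UNIV UNIV \<sigma> (inv \<sigma>)"
  shows "norm (ell1_times \<sigma> a b) \<le> norm a * norm b"
proof -
  define F where "F k m = norm (coeff a k) * norm (coeff b m)" for k m
  note c = infsum_convolution[of F "\<lambda>k. norm (coeff a k)" "\<lambda>k. norm (coeff b k)",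
      OF _ summable_norm_coeff summable_norm_coeff]
  have le: "norm (coeff (ell1_times \<sigma> a b) n) \<le> (\<Sum>\<^sub>\<infinity>k. F k (n - k))" for n
  proof -
    have "norm (coeff (ell1_times \<sigma> a b) n) \<le>
        (\<Sum>\<^sub>\<infinity>k. norm (cf_times (coeff a k) (int_iter (alpha \<sigma>) k (coeff b (n - k)))))"
      unfolding ell1_times_summable(2)[OF assms]
      by (rule norm_infsum_bound) (rule ell1_times_summable[OF assms])
    also have "\<dots> \<le> (\<Sum>\<^sub>\<infinity>k. F k (n - k))"
      unfolding F_def
      by (rule infsum_mono[OF ell1_times_summable(1)[OF assms] c(3)[unfolded F_def]])
         (auto intro!: order_trans[OF norm_cf_times] mult_left_mono norm_alpha_iter_le[OF assms])
    finally show ?thesis .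
  qed
  have "norm (ell1_times \<sigma> a b) \<le> (\<Sum>\<^sub>\<infinity>n. \<Sum>\<^sub>\<infinity>k. F k (n - k))"
    unfolding norm_ell1.rep_eq
    by (rule infsum_mono[OF summable_norm_coeff c(2)]) (auto simp: F_def le[unfolded F_def])
  also have "\<dots> = (\<Sum>\<^sub>\<infinity>k. \<Sum>\<^sub>\<infinity>m. F k m)"
    by (rule c(1)) (auto simp: F_def)
  also have "\<dots> = norm a * norm b"
    by (simp add: F_def norm_ell1.rep_eq infsum_cmult_right' infsum_cmult_left')
  finally show ?thesis .
qed

lemma coeff_ell1_star_apply:
  assumes "homeomorphism UNIV UNIV \<sigma> (inv \<sigma>)"
  shows "coeff (ell1_star \<sigma> a) n x = cnj (coeff a (- n) (int_iter \<sigma> (- n) x))"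
  by (simp add: coeff_ell1_star[OF assms] apply_alpha_iter[OF assms])

lemma ell1_star_star:
  assumes "homeomorphism UNIV UNIV \<sigma> (inv \<sigma>)"
  shows "ell1_star \<sigma> (ell1_star \<sigma> a) = a"
  using int_iter_minus_cancel[OF homeomorphism_imp(1)[OF assms]]
  by (intro ell1_eqI bcontfun_eqI) (simp add: coeff_ell1_star_apply[OF assms])

lemma norm_ell1_star:
  assumes "homeomorphism UNIV UNIV \<sigma> (inv \<sigma>)"
  shows "norm (ell1_star \<sigma> a) \<le> norm a"
proof -
  have bij: "bij_betw (uminus :: int \<Rightarrow> int) UNIV UNIV"
    by (rule bij_betw_byWitness[where f' = uminus]) auto
  have "norm (ell1_star \<sigma> a) \<le> (\<Sum>\<^sub>\<infinity>n. norm (coeff a (- n)))"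
    unfolding norm_ell1.rep_eq
  proof (rule infsum_mono[OF summable_norm_coeff])
    show "(\<lambda>n. norm (coeff a (- n))) summable_on UNIV"
      by (rule iffD2[OF summable_on_reindex_bij_betw[OF bij, of "\<lambda>n. norm (coeff a n)"]])
         (rule summable_norm_coeff)
    show "norm (coeff (ell1_star \<sigma> a) n) \<le> norm (coeff a (- n))" for n
      by (simp add: coeff_ell1_star[OF assms] norm_alpha_iter_le[OF assms])
  qed
  also have "\<dots> = norm a"
    unfolding norm_ell1.rep_eq by (rule infsum_reindex_bij_betw[OF bij])
  finally show ?thesis .
qed

lemma bounded_linear_ell1_times_left:
  assumes "homeomorphism UNIV UNIV \<sigma> (inv \<sigma>)"
  shows "bounded_linear (\<lambda>a. ell1_times \<sigma> a b)"
proof (rule bounded_linear_intro[where K = "norm b"])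
  fix x y :: "'a ell1" and r :: real
  show "ell1_times \<sigma> (x + y) b = ell1_times \<sigma> x b + ell1_times \<sigma> y b"
  proof (intro ell1_eqI bcontfun_eqI)
    fix n z
    show "coeff (ell1_times \<sigma> (x + y) b) n z = coeff (ell1_times \<sigma> x b + ell1_times \<sigma> y b) n z"
      using has_sum_unique[OF coeff_times_has_sum[OF assms, of "x + y" z b n]]
        has_sum_add[OF coeff_times_has_sum[OF assms, of x z b n] coeff_times_has_sum[OF assms, of y z b n]]
      by (simp add: algebra_simps)
  qed
  show "ell1_times \<sigma> (r *\<^sub>R x) b = r *\<^sub>R ell1_times \<sigma> x b"
  proof (intro ell1_eqI bcontfun_eqI)
    fix n z
    show "coeff (ell1_times \<sigma> (r *\<^sub>R x) b) n z = coeff (r *\<^sub>R ell1_times \<sigma> x b) n z"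
      using has_sum_unique[OF coeff_times_has_sum[OF assms, of "r *\<^sub>R x" z b n]]
        has_sum_scaleR[OF coeff_times_has_sum[OF assms, of x z b n], of r]
      by simp
  qed
qed (rule norm_ell1_times[OF assms])

lemma ell1_scale_of_real: "ell1_scale (of_real r) a = r *\<^sub>R a"
  by (intro ell1_eqI bcontfun_eqI) (simp add: scaleR_conv_of_real const_bcontfun.rep_eq)

lemma ell1_scale_minus_1: "ell1_scale (- 1) a = - a"
  by (intro ell1_eqI bcontfun_eqI) (simp add: const_bcontfun.rep_eq)

section \<open>The transform\<close>

lemma transform_has_sum:
  assumes "cmod l = 1"
  shows "((\<lambda>n. l powi n * coeff a n x) has_sum transform a (x, l)) UNIV"
proof -
  have "(\<lambda>n. norm (l powi n * coeff a n x)) summable_on UNIV"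
    using summable_norm_coeff[of a]
    by (rule summable_on_comparison_test) (auto simp: norm_mult norm_power_int assms norm_bounded)
  from abs_summable_summable[OF this] show ?thesis
    by (simp add: transform_def)
qed

lemma norm_transform_le:
  assumes "cmod l = 1"
  shows "cmod (transform a (x, l)) \<le> norm a"
proof -
  have s: "(\<lambda>n. norm (l powi n * coeff a n x)) summable_on UNIV"
    using summable_norm_coeff[of a]
    by (rule summable_on_comparison_test) (auto simp: norm_mult norm_power_int assms norm_bounded)
  have "cmod (transform a (x, l)) \<le> (\<Sum>\<^sub>\<infinity>n. norm (l powi n * coeff a n x))"
    by (simp add: transform_def norm_infsum_bound[OF s])
  also have "\<dots> \<le> norm a"
    unfolding norm_ell1.rep_eq
    by (rule infsum_mono[OF s summable_norm_coeff])
       (auto simp: norm_mult norm_power_int assms norm_bounded)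
  finally show ?thesis .
qed

lemma transform_add:
  assumes "cmod l = 1"
  shows "transform (a + b) (x, l) = transform a (x, l) + transform b (x, l)"
  using has_sum_unique[OF transform_has_sum[OF assms, of "a + b" x]]
    has_sum_add[OF transform_has_sum[OF assms, of a x] transform_has_sum[OF assms, of b x]]
  by (simp add: algebra_simps)

lemma transform_diff:
  assumes "cmod l = 1"
  shows "transform (a - b) (x, l) = transform a (x, l) - transform b (x, l)"
  using transform_add[OF assms, of "a - b" b x] by simp

lemma transform_scaleR:
  assumes "cmod l = 1"
  shows "transform (r *\<^sub>R a) (x, l) = r *\<^sub>R transform a (x, l)"
  using has_sum_unique[OF transform_has_sum[OF assms, of "r *\<^sub>R a" x]]
    has_sum_scaleR[OF transform_has_sum[OF assms, of a x], of r]
  by simp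

lemma transform_single: "transform (ell1_single f m) (x, l) = l powi m * f x"
  by (simp add: transform_def) (subst infsum_singleI[of m], auto)

text \<open>On the circle the transform is contractive, so norm limits turn into uniform limits and
  continuity passes from monomials to all elements.\<close>

lemma continuous_on_transform:
  "continuous_on (UNIV \<times> sphere 0 1) (transform (a :: 'a::topological_space ell1))"
proof -
  let ?T = "UNIV \<times> sphere 0 1 :: ('a \<times> complex) set"
  let ?P = "{a :: 'a ell1. continuous_on ?T (transform a)}"
  have cong: "continuous_on ?T (transform a)" if "continuous_on ?T g"
    "\<And>x l. cmod l = 1 \<Longrightarrow> transform a (x, l) = g (x, l)" for a :: "'a ell1" and g
    using that(1) by (rule continuous_on_eq) (auto simp: that(2))
  have "a \<in> ?P"
  proof (rule ell1_closed_induct)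
    show "closed ?P"
    proof (unfold closed_sequential_limits, intro allI impI)
      fix X :: "nat \<Rightarrow> 'a ell1" and b
      assume *: "(\<forall>n. X n \<in> ?P) \<and> X \<longlonglongrightarrow> b"
      have "uniform_limit ?T (\<lambda>n. transform (X n)) (transform b) sequentially"
        unfolding uniform_limit_iff
      proof (intro allI impI)
        fix e :: real assume "0 < e"
        then have "\<forall>\<^sub>F n in sequentially. dist (X n) b < e"
          using * by (auto simp: tendsto_iff)
        then show "\<forall>\<^sub>F n in sequentially. \<forall>z\<in>?T. dist (transform (X n) z) (transform b z) < e"
        proof eventually_elim
          case (elim n)
          have "dist (transform (X n) (x, l)) (transform b (x, l)) < e" if "cmod l = 1" for x l
            using elim norm_transform_le[OF that, of "X n - b" x]
            by (simp add: dist_norm transform_diff[OF that])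
          then show ?case by auto
        qed
      qed
      then show "b \<in> ?P"
        using * by (auto intro: uniform_limit_theorem[rotated])
    qed
    show "0 \<in> ?P"
      by (auto intro!: cong[of "\<lambda>_. 0"] simp: transform_def)
    show "x + y \<in> ?P" if "x \<in> ?P" "y \<in> ?P" for x y
      using that by (auto intro!: cong[of "\<lambda>z. transform x z + transform y z"] continuous_intros
          simp: transform_add)
    show "ell1_single (coeff a n) n \<in> ?P" for n
    proof -
      have "continuous_on ?T (\<lambda>z. coeff a n (fst z))"
        by (rule continuous_on_compose2[OF continuous_on_apply_bcontfun[of UNIV]])
           (auto intro!: continuous_intros)
      moreover have "continuous_on ?T (\<lambda>z. snd z powi n)"
        by (intro continuous_on_power_int continuous_intros) auto
      ultimately show ?thesis
        by (auto intro!: cong[of "\<lambda>z. snd z powi n * coeff a n (fst z)"] continuous_intros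
            simp: transform_single)
    qed
  qed
  then show ?thesis by simp
qed

section \<open>Fourier coefficients\<close>

text \<open>Averages over the \<open>L\<close>-th roots of unity replace integration over the circle
  in the extraction of Fourier coefficients.\<close>

lemma sum_roots_of_unity_powi:
  assumes "0 < L"
  shows "(\<Sum>r<L. cis (2 * pi * real r / real L) powi k) = (if int L dvd k then of_nat L else 0)"
proof -
  define z where "z = cis (2 * pi * (of_int k / real L))"
  have *: "cis (2 * pi * real r / real L) powi k = z ^ r" for r
    by (simp add: z_def cis_power_int Complex.DeMoivre field_simps)
  have z1: "z = 1 \<longleftrightarrow> int L dvd k"
  proof
    assume "z = 1"
    then have "cos (2 * pi * (of_int k / real L)) = 1"
      by (simp add: z_def complex_eq_iff)
    then obtain n :: int where "2 * pi * (of_int k / real L) = n * 2 * pi"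
      by (auto simp: cos_one_2pi_int)
    then have "of_int k = real_of_int (n * int L)"
      using assms by (simp add: field_simps)
    then have "k = n * int L" by linarith
    then show "int L dvd k" by simp
  next
    assume "int L dvd k"
    then obtain n where "k = int L * n" ..
    then have "of_int k / real L = real_of_int n" using assms by simp
    then show "z = 1" by (simp add: z_def)
  qed
  have zL: "z ^ L = 1"
    using assms by (simp add: z_def Complex.DeMoivre)
  show ?thesis
  proof (cases "z = 1")
    case True
    then show ?thesis using z1 by (simp add: *)
  next
    case False
    then show ?thesis using z1 zL geometric_sum[of z L] by (simp add: *)
  qed
qed

text \<open>The average against the \<open>j\<close>-th character gives \<open>c j\<close> plus the
  aliased terms whose exponents are congruent to \<open>j\<close> modulo \<open>L\<close>; a large
  \<open>L\<close> pushes these into the tail of the series.\<close>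

lemma norm_fourier_coeff_le:
  fixes c :: "int \<Rightarrow> complex"
  assumes c: "(\<lambda>n. norm (c n)) summable_on UNIV"
    and M: "\<And>l. cmod l = 1 \<Longrightarrow> cmod (\<Sum>\<^sub>\<infinity>n. l powi n * c n) \<le> M"
  shows "cmod (c j) \<le> M"
proof (rule field_le_epsilon)
  fix e :: real assume "0 < e"
  obtain F where F: "finite F"
    "dist (\<Sum>n\<in>F. norm (c n)) (\<Sum>\<^sub>\<infinity>n. norm (c n)) \<le> e"
    using infsum_finite_approximation[OF c \<open>0 < e\<close>] by auto
  have "(\<Sum>\<^sub>\<infinity>n\<in>F \<union> - F. norm (c n)) = (\<Sum>\<^sub>\<infinity>n\<in>F. norm (c n)) + (\<Sum>\<^sub>\<infinity>n\<in>- F. norm (c n))"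
    by (rule infsum_Un_disjoint) (auto intro: summable_on_subset_banach[OF c])
  then have tail: "(\<Sum>\<^sub>\<infinity>n\<in>- F. norm (c n)) \<le> e"
    using F by (simp add: dist_real_def)
  \<comment> \<open>Larger than every \<open>\<bar>n - j\<bar>\<close> with
    \<open>n \<in> F\<close>, so that no exponent of \<open>F\<close> other than \<open>j\<close>
    lies in the class of \<open>j\<close> modulo \<open>L\<close>.\<close>
  define L where "L = Suc (nat (\<Sum>n\<in>F. \<bar>n - j\<bar>))"
  have L: "n = j \<or> n \<notin> F" if "int L dvd n - j" for n
  proof (rule ccontr)
    assume n: "\<not> (n = j \<or> n \<notin> F)"
    then have "\<bar>n - j\<bar> \<le> (\<Sum>n\<in>F. \<bar>n - j\<bar>)"
      using F(1) by (intro member_le_sum) auto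
    then have "\<bar>n - j\<bar> < int L" unfolding L_def by linarith
    then show False using n that zdvd_not_zless[of "\<bar>n - j\<bar>" "int L"] by auto
  qed
  define w where "w r = cis (2 * pi * real r / real L)" for r
  have s: "((\<lambda>n. w r powi (n - j) * c n) has_sum w r powi (- j) * (\<Sum>\<^sub>\<infinity>n. w r powi n * c n)) UNIV" for r
  proof -
    have "(\<lambda>n. norm (w r powi n * c n)) summable_on UNIV"
      using c by (rule summable_on_comparison_test) (auto simp: norm_mult norm_power_int w_def)
    from has_sum_cmult_right[OF has_sum_infsum[OF abs_summable_summable[OF this]], of "w r powi (- j)"]
    show ?thesis by (simp add: w_def power_int_diff power_int_minus field_simps)
  qed
  have "((\<lambda>n. \<Sum>r<L. w r powi (n - j) * c n) has_sum
      (\<Sum>r<L. w r powi (- j) * (\<Sum>\<^sub>\<infinity>n. w r powi n * c n))) UNIV"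
  proof -
    have "((\<lambda>n. \<Sum>r\<in>R. w r powi (n - j) * c n) has_sum
      (\<Sum>r\<in>R. w r powi (- j) * (\<Sum>\<^sub>\<infinity>n. w r powi n * c n))) UNIV" if "finite R" for R
      using that by (induction R) (auto intro: has_sum_add s)
    then show ?thesis by simp
  qed
  moreover have "(\<Sum>r<L. w r powi (n - j) * c n) = (if int L dvd n - j then of_nat L * c n else 0)" for n
    using sum_roots_of_unity_powi[of L "n - j"]
    by (simp add: w_def L_def sum_distrib_right[symmetric] del: of_nat_Suc)
  ultimately have *: "((\<lambda>n. if int L dvd n - j then of_nat L * c n else 0) has_sum
      (\<Sum>r<L. w r powi (- j) * (\<Sum>\<^sub>\<infinity>n. w r powi n * c n))) UNIV"
    by simp
  have c': "(\<lambda>n. norm (if int L dvd n - j \<and> n \<noteq> j then of_nat L * c n else 0)) summable_on UNIV"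
    by (rule summable_on_comparison_test[OF summable_on_cmult_right[OF c, of "real L"]])
       (auto simp: norm_mult)
  have "((\<lambda>n. (if n = j then of_nat L * c n else 0) + (if int L dvd n - j \<and> n \<noteq> j then of_nat L * c n else 0))
      has_sum (of_nat L * c j + (\<Sum>\<^sub>\<infinity>n. if int L dvd n - j \<and> n \<noteq> j then of_nat L * c n else 0))) UNIV"
    using has_sum_singleI[of j "\<lambda>n. if n = j then of_nat L * c n else 0"]
    by (intro has_sum_add has_sum_infsum[OF abs_summable_summable[OF c']]) auto
  moreover have "(\<lambda>n. (if n = j then of_nat L * c n else 0) + (if int L dvd n - j \<and> n \<noteq> j then of_nat L * c n else 0))
      = (\<lambda>n. if int L dvd n - j then of_nat L * c n else 0)"
    by auto
  ultimately have eq: "of_nat L * c j = (\<Sum>r<L. w r powi (- j) * (\<Sum>\<^sub>\<infinity>n. w r powi n * c n)) -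
      (\<Sum>\<^sub>\<infinity>n. if int L dvd n - j \<and> n \<noteq> j then of_nat L * c n else 0)"
    using has_sum_unique[OF *] by (simp add: algebra_simps)
  have "cmod (\<Sum>r<L. w r powi (- j) * (\<Sum>\<^sub>\<infinity>n. w r powi n * c n)) \<le> (\<Sum>r<L. M)"
    by (rule sum_norm_le) (use M[of "w _"] in \<open>auto simp: norm_mult norm_power_int w_def\<close>)
  moreover have "cmod (\<Sum>\<^sub>\<infinity>n. if int L dvd n - j \<and> n \<noteq> j then of_nat L * c n else 0) \<le> real L * e"
  proof -
    have "cmod (\<Sum>\<^sub>\<infinity>n. if int L dvd n - j \<and> n \<noteq> j then of_nat L * c n else 0) \<le>
        (\<Sum>\<^sub>\<infinity>n. norm (if int L dvd n - j \<and> n \<noteq> j then of_nat L * c n else 0))"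
      by (rule norm_infsum_bound[OF c'])
    also have "\<dots> \<le> (\<Sum>\<^sub>\<infinity>n\<in>- F. real L * norm (c n))"
      by (rule infsum_mono_neutral[OF c' summable_on_cmult_right[OF summable_on_subset_banach[OF c]]])
         (use L in \<open>auto simp: norm_mult\<close>)
    also have "\<dots> \<le> real L * e"
      using tail by (simp add: infsum_cmult_right' mult_left_mono)
    finally show ?thesis .
  qed
  ultimately have "cmod (of_nat L * c j) \<le> real L * M + real L * e"
    unfolding eq by (intro order_trans[OF norm_triangle_ineq4]) (auto intro: add_mono)
  then have "real L * cmod (c j) \<le> real L * (M + e)"
    by (simp add: norm_mult distrib_left)
  then show "cmod (c j) \<le> M + e"
    by (rule mult_left_le_imp_le) (simp add: L_def del: of_nat_Suc of_nat_nat)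
qed

lemma norm_coeff_le_transform:
  assumes "\<And>x l. cmod l = 1 \<Longrightarrow> cmod (transform a (x, l)) \<le> M"
  shows "norm (coeff a n) \<le> M"
proof (rule norm_bound)
  fix x
  have "(\<lambda>n. norm (coeff a n x)) summable_on UNIV"
    using summable_norm_coeff[of a] by (rule summable_on_comparison_test) (auto simp: norm_bounded)
  then show "cmod (coeff a n x) \<le> M"
    by (rule norm_fourier_coeff_le) (use assms in \<open>simp add: transform_def\<close>)
qed

lemma coeff_eq_0_transform:
  assumes "\<And>l. cmod l = 1 \<Longrightarrow> transform a (x, l) = 0"
  shows "coeff a n x = 0"
proof -
  have "(\<lambda>n. norm (coeff a n x)) summable_on UNIV"
    using summable_norm_coeff[of a] by (rule summable_on_comparison_test) (auto simp: norm_bounded)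
  then have "cmod (coeff a n x) \<le> 0"
    by (rule norm_fourier_coeff_le) (use assms in \<open>simp add: transform_def\<close>)
  then show ?thesis by simp
qed

section \<open>Continuous functions on a compact Hausdorff space\<close>

lemma Hausdorff_space_euclidean_t2: "Hausdorff_space (euclidean :: 'a::t2_space topology)"
  unfolding Hausdorff_space_def disjnt_def using hausdorff by fastforce

lemma Urysohn_bcontfun:
  fixes S T :: "'a::t2_space set"
  assumes "compact (UNIV :: 'a set)" "closed S" "closed T" "S \<inter> T = {}"
  obtains f :: "'a \<Rightarrow>\<^sub>C complex"
  where "\<And>x. x \<in> S \<Longrightarrow> f x = 0" "\<And>x. x \<in> T \<Longrightarrow> f x = 1" "\<And>x. cmod (f x) \<le> 1"
proof -
  have "normal_space (euclidean :: 'a topology)"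
    using assms(1) Hausdorff_space_euclidean_t2
    by (intro compact_Hausdorff_or_regular_imp_normal_space) (auto simp: compact_space_def)
  from Urysohn_lemma[OF this, of S T 0 1] assms
  obtain g where "continuous_map euclidean (top_of_set {0..1::real}) g"
    and gST: "g ` S \<subseteq> {0}" "g ` T \<subseteq> {1}"
    by (auto simp: disjnt_def)
  then have g: "continuous_map euclidean euclideanreal g" "\<And>x. \<bar>g x\<bar> \<le> 1"
    by (auto simp: continuous_map_in_subtopology Pi_iff abs_of_nonneg)
  have "(\<lambda>x. complex_of_real (g x)) \<in> bcontfun"
    using g(1) assms(1) by (intro continuous_imp_bcontfun continuous_intros) auto
  then have "Bcontfun (\<lambda>x. complex_of_real (g x)) x = g x" for x
    by (simp add: apply_Bcontfun)
  then show thesis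
    using g(2) gST by (intro that[of "Bcontfun (\<lambda>x. complex_of_real (g x))"]) auto
qed

lemma bump_bcontfun:
  fixes x :: "'a::t2_space"
  assumes "compact (UNIV :: 'a set)" "open U" "x \<in> U"
  obtains f :: "'a \<Rightarrow>\<^sub>C complex"
  where "f x = 1" "\<And>y. y \<notin> U \<Longrightarrow> f y = 0" "\<And>y. cmod (f y) \<le> 1"
proof -
  obtain f :: "'a \<Rightarrow>\<^sub>C complex" where "\<And>y. y \<in> - U \<Longrightarrow> f y = 0"
      "\<And>y. y \<in> {x} \<Longrightarrow> f y = 1" "\<And>y. cmod (f y) \<le> 1"
    by (rule Urysohn_bcontfun[OF assms(1), of "- U" "{x}"]) (use assms in auto)
  then show thesis by (intro that[of f]) auto
qed

text \<open>Kernel elements act as \<open>1 - q\<close> on the symbol without changing the seminorm; iterating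
  \<open>1 - q\<close> makes the symbol small wherever \<open>q\<close> does not vanish.\<close>

lemma localization:
  fixes F :: "'b \<Rightarrow> 'z::topological_space \<Rightarrow> complex" and s :: "'b \<Rightarrow> real"
    and Q :: "('z \<Rightarrow> real) set"
  assumes \<Omega>: "compact \<Omega>"
    and cont: "\<And>b. b \<in> A \<Longrightarrow> continuous_on \<Omega> (F b)"
    and bound: "\<And>b M. b \<in> A \<Longrightarrow> 0 < M \<Longrightarrow> (\<And>z. z \<in> \<Omega> \<Longrightarrow> cmod (F b z) \<le> M) \<Longrightarrow> s b \<le> C * M"
    and C: "0 \<le> C"
    and Q: "\<And>q. q \<in> Q \<Longrightarrow> continuous_on \<Omega> q" "\<And>q z. q \<in> Q \<Longrightarrow> z \<in> \<Omega> \<Longrightarrow> 0 \<le> q z"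
    and Q0: "(\<lambda>_. 0) \<in> Q"
    and Qadd: "\<And>q q'. q \<in> Q \<Longrightarrow> q' \<in> Q \<Longrightarrow> (\<lambda>z. q z + q' z) \<in> Q"
    and Qscale: "\<And>q r. q \<in> Q \<Longrightarrow> 0 \<le> r \<Longrightarrow> (\<lambda>z. r * q z) \<in> Q"
    and act: "\<And>q b. q \<in> Q \<Longrightarrow> b \<in> A \<Longrightarrow>
      \<exists>b'\<in>A. (\<forall>z\<in>\<Omega>. F b' z = (1 - of_real (q z)) * F b z) \<and> s b' = s b"
    and b: "b \<in> A"
    and hull: "\<And>z. z \<in> \<Omega> \<Longrightarrow> F b z \<noteq> 0 \<Longrightarrow> \<exists>q\<in>Q. q z \<noteq> 0"
  shows "s b \<le> 0"
proof (rule field_le_epsilon)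
  fix e' :: real assume "0 < e'"
  define e where "e = e' / (C + 1)"
  have e: "0 < e" "C * e \<le> e'"
    using \<open>0 < e'\<close> C by (auto simp: e_def field_simps)
  \<comment> \<open>On the compact set where the symbol is at least \<open>e\<close>, finitely many
    members of \<open>Q\<close> suffice; their sum \<open>q\<close> has a positive lower bound
    \<open>m\<close> there.\<close>
  define K where "K = {z \<in> \<Omega>. e \<le> cmod (F b z)}"
  have "closedin (top_of_set \<Omega>) (\<Omega> \<inter> (\<lambda>z. cmod (F b z)) -` {e..})"
    using cont[OF b] by (intro continuous_closedin_preimage continuous_intros) auto
  moreover have "\<Omega> \<inter> (\<lambda>z. cmod (F b z)) -` {e..} = K" by (auto simp: K_def)
  ultimately have K: "compact K" using closedin_compact[OF \<Omega>] by simp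
  have sub: "K \<subseteq> \<Omega>" by (auto simp: K_def)
  let ?pos = "\<lambda>q. K \<inter> q -` {0::real<..}"
  have "\<forall>c\<in>?pos ` Q. openin (top_of_set K) c"
    by (auto intro!: continuous_openin_preimage_gen continuous_on_subset[OF Q(1) sub])
  moreover have "K \<subseteq> \<Union> (?pos ` Q)"
  proof
    fix z assume z: "z \<in> K"
    then have "z \<in> \<Omega>" "F b z \<noteq> 0" using e(1) by (auto simp: K_def)
    then obtain q where "q \<in> Q" "q z \<noteq> 0" using hull by blast
    then have "z \<in> ?pos q" using z Q(2)[of q z] \<open>z \<in> \<Omega>\<close> by simp
    with \<open>q \<in> Q\<close> show "z \<in> \<Union> (?pos ` Q)" by blast
  qed
  ultimately obtain D where D: "D \<subseteq> ?pos ` Q" "finite D" "K \<subseteq> \<Union> D"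
    using K unfolding compact_eq_openin_cover by meson
  then obtain R where R: "R \<subseteq> Q" "finite R" "D = ?pos ` R"
    by (meson finite_subset_image)
  define q where "q = (\<lambda>z. \<Sum>q\<in>R. q z)"
  have qQ: "q \<in> Q"
    unfolding q_def using R(2,1) by (induction R) (auto intro: Q0 Qadd)
  have qpos: "0 < q z" if z: "z \<in> K" for z
  proof -
    obtain q' where "q' \<in> R" "0 < q' z" using D(3) R(3) z by auto
    then show ?thesis
      unfolding q_def using R(1,2) sub z Q(2) by (intro sum_pos2[of R q']) auto
  qed
  obtain B where B: "\<And>z. z \<in> \<Omega> \<Longrightarrow> q z \<le> B" "0 < B"
  proof -
    have "bounded (q ` \<Omega>)"
      using \<Omega> Q(1)[OF qQ] by (intro compact_imp_bounded compact_continuous_image)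
    then obtain B where "\<And>z. z \<in> \<Omega> \<Longrightarrow> norm (q z) \<le> B" by (auto simp: bounded_iff)
    then show thesis by (intro that[of "max 1 B"]) (auto simp: le_max_iff_disj abs_le_iff)
  qed
  obtain m where m: "\<And>z. z \<in> K \<Longrightarrow> m \<le> q z" "0 < m" "m \<le> B"
  proof (cases "K = {}")
    case False
    obtain z where z: "z \<in> K" "\<And>z'. z' \<in> K \<Longrightarrow> q z \<le> q z'"
      using continuous_attains_inf[OF K False continuous_on_subset[OF Q(1)[OF qQ] sub]] by auto
    show thesis by (rule that[of "q z"]) (use z qpos B sub in auto)
  qed (use that[of B] B in auto)
  obtain M where M: "\<And>z. z \<in> \<Omega> \<Longrightarrow> cmod (F b z) \<le> M" "0 < M"
  proof -
    have "bounded (F b ` \<Omega>)"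
      using \<Omega> cont[OF b] by (intro compact_imp_bounded compact_continuous_image)
    then obtain M where "\<And>z. z \<in> \<Omega> \<Longrightarrow> norm (F b z) \<le> M" by (auto simp: bounded_iff)
    then show thesis by (intro that[of "max 1 M"]) (auto simp: le_max_iff_disj)
  qed
  \<comment> \<open>Division by the upper bound \<open>B\<close> keeps \<open>r\<close> between 0
    and 1, so \<open>1 - r\<close> never enlarges the symbol, and on \<open>K\<close> it is at most
    \<open>1 - m / B\<close>.\<close>
  define r where "r z = (1 / B) * q z" for z
  have rQ: "r \<in> Q"
    unfolding r_def using B by (intro Qscale[OF qQ]) auto
  have iter: "\<exists>b'\<in>A. (\<forall>z\<in>\<Omega>. F b' z = (1 - of_real (r z)) ^ k * F b z) \<and> s b' = s b" for k
  proof (induction k)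
    case (Suc k)
    then obtain b' where b': "b' \<in> A" "\<forall>z\<in>\<Omega>. F b' z = (1 - of_real (r z)) ^ k * F b z" "s b' = s b"
      by auto
    from act[OF rQ b'(1)] show ?case using b'(2,3) by (auto simp: mult.assoc)
  qed (use b in auto)
  have "0 \<le> 1 - m / B" "1 - m / B < 1" using m B by (auto simp: field_simps)
  then have "(\<lambda>k. M * (1 - m / B) ^ k) \<longlonglongrightarrow> M * 0"
    by (intro tendsto_intros LIMSEQ_power_zero) auto
  then have "\<forall>\<^sub>F k in sequentially. M * (1 - m / B) ^ k < e"
    using e(1) by (intro order_tendstoD) auto
  then obtain k where k: "M * (1 - m / B) ^ k < e"
    by (auto simp: eventually_sequentially)
  obtain b' where b': "b' \<in> A" "\<forall>z\<in>\<Omega>. F b' z = (1 - of_real (r z)) ^ k * F b z" "s b' = s b"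
    using iter[of k] by auto
  have "cmod (F b' z) \<le> e" if z: "z \<in> \<Omega>" for z
  proof -
    have r01: "0 \<le> r z" "r z \<le> 1"
      using B Q(2)[OF qQ z] z by (auto simp: r_def field_simps)
    have "1 - complex_of_real (r z) = complex_of_real (1 - r z)" by simp
    then have eq: "cmod (F b' z) = (1 - r z) ^ k * cmod (F b z)"
      using b'(2) z r01 by (simp only: norm_mult norm_power norm_of_real)
    show ?thesis
    proof (cases "z \<in> K")
      case True
      have "(1 - r z) ^ k \<le> (1 - m / B) ^ k"
        using m(1)[OF True] B r01 by (intro power_mono) (auto simp: r_def field_simps)
      then have "cmod (F b' z) \<le> (1 - m / B) ^ k * M"
        unfolding eq using M(1)[OF z] r01 \<open>0 \<le> 1 - m / B\<close> by (intro mult_mono) auto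
      then show ?thesis using k by (simp add: mult.commute)
    next
      case False
      then have "cmod (F b z) \<le> e" using z by (auto simp: K_def)
      moreover have "(1 - r z) ^ k \<le> 1" using r01 by (intro power_le_one) auto
      ultimately show ?thesis
        unfolding eq using mult_mono[of "(1 - r z) ^ k" 1 "cmod (F b z)" e] by auto
    qed
  qed
  with bound[OF b'(1) e(1)] have "s b' \<le> C * e" by blast
  with e(2) b'(3) show "s b \<le> 0 + e'" by simp
qed

section \<open>Inner product spaces with an explicit carrier\<close>

locale complex_inner_space =
  fixes H :: "'h cspace"
  assumes zero_closed: "hzero H \<in> hcarrier H"
    and add_closed: "\<lbrakk>u \<in> hcarrier H; v \<in> hcarrier H\<rbrakk> \<Longrightarrow> hadd H u v \<in> hcarrier H"
    and scale_closed: "u \<in> hcarrier H \<Longrightarrow> hscale H c u \<in> hcarrier H"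
    and add_assoc: "\<lbrakk>u \<in> hcarrier H; v \<in> hcarrier H; w \<in> hcarrier H\<rbrakk> \<Longrightarrow>
      hadd H (hadd H u v) w = hadd H u (hadd H v w)"
    and add_commute: "\<lbrakk>u \<in> hcarrier H; v \<in> hcarrier H\<rbrakk> \<Longrightarrow> hadd H u v = hadd H v u"
    and add_zero: "u \<in> hcarrier H \<Longrightarrow> hadd H u (hzero H) = u"
    and add_inverse: "u \<in> hcarrier H \<Longrightarrow> hadd H u (hscale H (- 1) u) = hzero H"
    and inner_add_left: "\<lbrakk>u \<in> hcarrier H; v \<in> hcarrier H; w \<in> hcarrier H\<rbrakk> \<Longrightarrow>
      hinner H (hadd H u v) w = hinner H u w + hinner H v w"
    and inner_scale_left: "\<lbrakk>u \<in> hcarrier H; v \<in> hcarrier H\<rbrakk> \<Longrightarrow>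
      hinner H (hscale H c u) v = c * hinner H u v"
    and inner_commute: "\<lbrakk>u \<in> hcarrier H; v \<in> hcarrier H\<rbrakk> \<Longrightarrow>
      hinner H u v = cnj (hinner H v u)"
    and inner_nonneg: "u \<in> hcarrier H \<Longrightarrow> 0 \<le> Re (hinner H u u)"
    and inner_definite: "\<lbrakk>u \<in> hcarrier H; hinner H u u = 0\<rbrakk> \<Longrightarrow> u = hzero H"

lemma complex_hilbert_imp_inner_space: "complex_hilbert_space H \<Longrightarrow> complex_inner_space H"
  unfolding complex_hilbert_space_def complex_inner_space_def by (elim conjE, intro conjI) assumption+

context complex_inner_space
begin

lemmas closed = zero_closed add_closed scale_closed

lemma inner_add_right:
  assumes "u \<in> hcarrier H" "v \<in> hcarrier H" "w \<in> hcarrier H"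
  shows "hinner H w (hadd H u v) = hinner H w u + hinner H w v"
  using assms inner_commute[of w "hadd H u v"] inner_commute[of w u] inner_commute[of w v]
  by (simp add: inner_add_left closed)

lemma inner_scale_right:
  assumes "u \<in> hcarrier H" "v \<in> hcarrier H"
  shows "hinner H v (hscale H c u) = cnj c * hinner H v u"
  using assms inner_commute[of v "hscale H c u"] inner_commute[of v u]
  by (simp add: inner_scale_left closed)

lemma inner_zero_left: "v \<in> hcarrier H \<Longrightarrow> hinner H (hzero H) v = 0"
  using inner_add_left[of "hzero H" "hzero H" v] add_zero[of "hzero H"] by (simp add: closed)

lemma inner_zero_right: "v \<in> hcarrier H \<Longrightarrow> hinner H v (hzero H) = 0"
  using inner_commute[of v "hzero H"] by (simp add: inner_zero_left closed)

lemmas inner_simps = inner_add_left inner_add_right inner_scale_left inner_scale_right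
  inner_zero_left inner_zero_right closed

text \<open>Vectors live in a carrier set without type class arithmetic; this rule turns vector
  identities into identities of complex numbers.\<close>

lemma eqI_inner:
  assumes "u \<in> hcarrier H" "v \<in> hcarrier H"
    and "\<And>w. w \<in> hcarrier H \<Longrightarrow> hinner H u w = hinner H v w"
  shows "u = v"
proof -
  let ?d = "hadd H u (hscale H (- 1) v)"
  have "hinner H ?d ?d = 0"
    using assms by (simp add: inner_simps)
  then have d: "?d = hzero H"
    using assms by (intro inner_definite) (auto simp: closed)
  have "u = hadd H u (hadd H v (hscale H (- 1) v))"
    using assms by (simp add: add_inverse add_zero)
  also have "\<dots> = hadd H ?d v"
    using assms by (simp add: add_assoc add_commute[of v] closed)
  also have "\<dots> = v"
    using assms by (simp add: d add_commute[of "hzero H"] add_zero closed)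
  finally show ?thesis .
qed

lemma inner_self: "u \<in> hcarrier H \<Longrightarrow> hinner H u u = (complex_of_real (hnorm H u))\<^sup>2"
  using inner_commute[of u u] inner_nonneg[of u]
  unfolding of_real_power[symmetric] by (simp add: hnorm_def complex_eq_iff del: of_real_power)

lemma hnorm_power2: "u \<in> hcarrier H \<Longrightarrow> (hnorm H u)\<^sup>2 = Re (hinner H u u)"
  using inner_nonneg[of u] by (simp add: hnorm_def)

lemma hnorm_nonneg [simp]: "u \<in> hcarrier H \<Longrightarrow> 0 \<le> hnorm H u"
  using inner_nonneg[of u] by (simp add: hnorm_def)

lemma hnorm_eq_0_iff: "u \<in> hcarrier H \<Longrightarrow> hnorm H u = 0 \<longleftrightarrow> u = hzero H"
  using inner_definite[of u] inner_self[of u] inner_zero_left[of "hzero H"] by (auto simp: closed)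

lemma hnorm_zero [simp]: "hnorm H (hzero H) = 0"
  by (simp add: hnorm_eq_0_iff closed)

lemma hnorm_scale:
  assumes "u \<in> hcarrier H"
  shows "hnorm H (hscale H c u) = cmod c * hnorm H u"
proof -
  have "hinner H (hscale H c u) (hscale H c u) = complex_of_real ((cmod c * hnorm H u)\<^sup>2)"
    using assms complex_norm_square[of c]
    by (simp add: inner_simps inner_self[OF assms] power_mult_distrib mult_ac)
  then have "(hnorm H (hscale H c u))\<^sup>2 = (cmod c * hnorm H u)\<^sup>2"
    using assms by (simp add: hnorm_power2 closed del: of_real_power)
  then show ?thesis
    by (rule power2_eq_imp_eq) (use assms in \<open>auto simp: closed\<close>)
qed

lemma Cauchy_Schwarz:
  assumes "u \<in> hcarrier H" "v \<in> hcarrier H"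
  shows "cmod (hinner H u v) \<le> hnorm H u * hnorm H v"
proof (cases "hnorm H v = 0")
  case True
  then show ?thesis using assms by (simp add: hnorm_eq_0_iff inner_simps)
next
  case False
  define t where "t = (hnorm H v)\<^sup>2"
  define z where "z = hinner H u v"
  have t: "0 < t" using False by (simp add: t_def)
  \<comment> \<open>The usual component of \<open>u\<close> orthogonal to \<open>v\<close>,
    multiplied by \<open>t\<close> to avoid a division.\<close>
  let ?w = "hadd H (hscale H t u) (hscale H (- z) v)"
  have "hinner H ?w ?w = complex_of_real (t * (t * (hnorm H u)\<^sup>2 - (cmod z)\<^sup>2))"
    using assms inner_commute[of v u] complex_norm_square[of z]
    by (simp add: inner_simps inner_self[OF assms(1)] inner_self[OF assms(2)] z_def[symmetric])
       (simp add: t_def algebra_simps power2_eq_square)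
  then have "0 \<le> t * (t * (hnorm H u)\<^sup>2 - (cmod z)\<^sup>2)"
    using inner_nonneg[of ?w] assms by (simp add: closed)
  then have "(cmod z)\<^sup>2 \<le> (hnorm H u * hnorm H v)\<^sup>2"
    using t by (simp add: zero_le_mult_iff t_def power_mult_distrib mult.commute)
  then show ?thesis
    unfolding z_def by (rule power2_le_imp_le) (use assms in auto)
qed

lemma hnorm_triangle:
  assumes "u \<in> hcarrier H" "v \<in> hcarrier H"
  shows "hnorm H (hadd H u v) \<le> hnorm H u + hnorm H v"
proof (rule power2_le_imp_le)
  have "(hnorm H (hadd H u v))\<^sup>2 = (hnorm H u)\<^sup>2 + 2 * Re (hinner H u v) + (hnorm H v)\<^sup>2"
    using assms inner_commute[of v u] by (simp add: hnorm_power2 inner_simps)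
  also have "Re (hinner H u v) \<le> hnorm H u * hnorm H v"
    using Cauchy_Schwarz[OF assms] complex_Re_le_cmod[of "hinner H u v"] by linarith
  finally show "(hnorm H (hadd H u v))\<^sup>2 \<le> (hnorm H u + hnorm H v)\<^sup>2"
    by (simp add: power2_sum)
qed (use assms in auto)

lemma scale_zero: "u \<in> hcarrier H \<Longrightarrow> hscale H 0 u = hzero H"
  by (rule eqI_inner) (auto simp: inner_simps)

lemma zero_add: "u \<in> hcarrier H \<Longrightarrow> hadd H (hzero H) u = u"
  by (rule eqI_inner) (auto simp: inner_simps)

lemma scale_of_zero: "hscale H c (hzero H) = hzero H"
  using hnorm_scale[OF zero_closed, of c] by (simp add: hnorm_eq_0_iff closed)

end

section \<open>Involutive representations are contractive\<close>

definition ell1_one :: "'a::topological_space ell1" where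
  "ell1_one = ell1_single (const_bcontfun 1) 0"

lemma ell1_one_times:
  assumes "homeomorphism UNIV UNIV \<sigma> (inv \<sigma>)"
  shows "ell1_times \<sigma> ell1_one a = a" "ell1_times \<sigma> a ell1_one = a"
  by (auto intro!: ell1_eqI bcontfun_eqI simp: ell1_one_def coeff_times_single_left[OF assms]
      coeff_times_single_right[OF assms] const_bcontfun.rep_eq)

lemma ell1_star_one:
  assumes "homeomorphism UNIV UNIV \<sigma> (inv \<sigma>)"
  shows "ell1_star \<sigma> ell1_one = ell1_one"
  by (auto intro!: ell1_eqI bcontfun_eqI simp: ell1_one_def coeff_ell1_star_apply[OF assms]
      const_bcontfun.rep_eq)

lemma norm_ell1_one: "norm (ell1_one :: 'a::topological_space ell1) \<le> 1"
  unfolding ell1_one_def by (simp, rule norm_bound) (simp add: const_bcontfun.rep_eq)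

text \<open>\<open>c\<close> is the Neumann series for the inverse of \<open>M - a\<close>, and the
  equation is \<open>c (M - a) = 1\<close> multiplied out.\<close>

lemma ell1_neumann:
  assumes h: "homeomorphism UNIV UNIV \<sigma> (inv \<sigma>)" and M: "norm a < M"
  obtains c where "ell1_times \<sigma> c a = M *\<^sub>R c - ell1_one"
proof -
  define P where "P n = ((\<lambda>b. ell1_times \<sigma> b a) ^^ n) ell1_one" for n
  have M0: "0 < M" using M norm_ge_zero[of a] by linarith
  have P: "norm (P n) \<le> norm a ^ n" for n
  proof (induction n)
    case (Suc n)
    have "norm (P (Suc n)) \<le> norm (P n) * norm a"
      by (simp add: P_def norm_ell1_times[OF h])
    also have "\<dots> \<le> norm a ^ n * norm a" by (intro mult_right_mono Suc) auto
    finally show ?case by (simp add: mult.commute)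
  qed (simp add: P_def norm_ell1_one)
  define f where "f n = (1 / M ^ Suc n) *\<^sub>R P n" for n
  have "summable (\<lambda>n. norm (f n))"
  proof (rule summable_comparison_test')
    show "summable (\<lambda>n. (1 / M) * (norm a / M) ^ n)"
      using M M0 by (intro summable_mult summable_geometric) simp
    show "norm (norm (f n)) \<le> (1 / M) * (norm a / M) ^ n" for n
      using P[of n] M0 by (simp add: f_def power_divide field_simps)
  qed
  then have s: "f sums suminf f" by (rule summable_sums[OF summable_norm_cancel])
  have "ell1_times \<sigma> (f n) a = M *\<^sub>R f (Suc n)" for n
    using M0 linear_scale[OF bounded_linear.linear[OF bounded_linear_ell1_times_left[OF h]]]
    by (simp add: f_def P_def field_simps)
  then have "(\<lambda>n. M *\<^sub>R f (Suc n)) sums ell1_times \<sigma> (suminf f) a"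
    using bounded_linear.sums[OF bounded_linear_ell1_times_left[OF h, of a] s] by simp
  moreover have "(\<lambda>n. M *\<^sub>R f (Suc n)) sums (M *\<^sub>R (suminf f - f 0))"
    using s by (intro sums_scaleR_right) (simp add: sums_Suc_iff)
  ultimately have "ell1_times \<sigma> (suminf f) a = M *\<^sub>R (suminf f - f 0)"
    by (rule sums_unique2)
  also have "\<dots> = M *\<^sub>R suminf f - ell1_one"
    using M0 by (simp add: f_def P_def scaleR_diff_right)
  finally show thesis by (rule that)
qed

locale inv_rep = complex_inner_space H
  for H :: "'h cspace" and \<sigma> :: "'a::topological_space \<Rightarrow> 'a" and \<pi> :: "'a ell1 \<Rightarrow> 'h \<Rightarrow> 'h" +
  assumes homeo: "homeomorphism UNIV UNIV \<sigma> (inv \<sigma>)"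
    and rep: "involutive_rep \<sigma> H \<pi>"
begin

lemma rep_closed [simp]: "u \<in> hcarrier H \<Longrightarrow> \<pi> a u \<in> hcarrier H"
  using rep unfolding involutive_rep_def bounded_operator_def by blast

lemma rep_hadd: "u \<in> hcarrier H \<Longrightarrow> v \<in> hcarrier H \<Longrightarrow> \<pi> a (hadd H u v) = hadd H (\<pi> a u) (\<pi> a v)"
  using rep unfolding involutive_rep_def bounded_operator_def by blast

lemma rep_hscale: "u \<in> hcarrier H \<Longrightarrow> \<pi> a (hscale H c u) = hscale H c (\<pi> a u)"
  using rep unfolding involutive_rep_def bounded_operator_def by blast

lemma rep_bounded: "\<exists>K. \<forall>u\<in>hcarrier H. hnorm H (\<pi> a u) \<le> K * hnorm H u"
  using rep unfolding involutive_rep_def bounded_operator_def by blast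

lemma rep_add: "u \<in> hcarrier H \<Longrightarrow> \<pi> (a + b) u = hadd H (\<pi> a u) (\<pi> b u)"
  using rep unfolding involutive_rep_def by blast

lemma rep_scale: "u \<in> hcarrier H \<Longrightarrow> \<pi> (ell1_scale c a) u = hscale H c (\<pi> a u)"
  using rep unfolding involutive_rep_def by blast

lemma rep_times: "u \<in> hcarrier H \<Longrightarrow> \<pi> (ell1_times \<sigma> a b) u = \<pi> a (\<pi> b u)"
  using rep unfolding involutive_rep_def by blast

lemma rep_star: "u \<in> hcarrier H \<Longrightarrow> v \<in> hcarrier H \<Longrightarrow>
    hinner H (\<pi> (ell1_star \<sigma> a) u) v = hinner H u (\<pi> a v)"
  using rep unfolding involutive_rep_def by blast

lemma rep_star': "u \<in> hcarrier H \<Longrightarrow> v \<in> hcarrier H \<Longrightarrow>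
    hinner H (\<pi> a u) v = hinner H u (\<pi> (ell1_star \<sigma> a) v)"
  using rep_star[of v u a] inner_commute[of "\<pi> a u" v] inner_commute[of u "\<pi> (ell1_star \<sigma> a) v"]
  by simp

lemma rep_scaleR: "u \<in> hcarrier H \<Longrightarrow> \<pi> (r *\<^sub>R a) u = hscale H (of_real r) (\<pi> a u)"
  using rep_scale[of u "of_real r" a] by (simp add: ell1_scale_of_real)

lemma rep_minus: "u \<in> hcarrier H \<Longrightarrow> \<pi> (- a) u = hscale H (- 1) (\<pi> a u)"
  using rep_scale[of u "- 1" a] by (simp add: ell1_scale_minus_1)

lemma rep_diff: "u \<in> hcarrier H \<Longrightarrow> \<pi> (a - b) u = hadd H (\<pi> a u) (hscale H (- 1) (\<pi> b u))"
  using rep_add[of u a "- b"] by (simp add: rep_minus)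

lemma rep_0: "u \<in> hcarrier H \<Longrightarrow> \<pi> 0 u = hzero H"
  using rep_scaleR[of u 0 0] by (simp add: scale_zero)

lemma rep_hzero: "\<pi> a (hzero H) = hzero H"
  using rep_hscale[of "hzero H" a 0] by (simp add: scale_zero closed)

lemma hnorm_rep_sq:
  "u \<in> hcarrier H \<Longrightarrow> (hnorm H (\<pi> a u))\<^sup>2 = Re (hinner H (\<pi> (ell1_times \<sigma> (ell1_star \<sigma> a) a) u) u)"
  by (simp add: hnorm_power2 rep_times rep_star)

text \<open>If the norm \<open>M\<close> of \<open>\<pi>(b\<^sup>*b)\<close> exceeded the norm of \<open>b\<^sup>*b\<close>, then \<open>M - b\<^sup>*b\<close> would be invertible
  by a Neumann series, although \<open>\<pi>(b\<^sup>*b)\<close> has approximate eigenvectors for \<open>M\<close>.\<close>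

theorem contractive:
  assumes u: "u \<in> hcarrier H"
  shows "hnorm H (\<pi> b u) \<le> norm b * hnorm H u"
proof -
  \<comment> \<open>The infimum \<open>M\<close> of these bounds is the square of the operator norm
    of \<open>\<pi> b\<close>.\<close>
  define R where "R = {r. 0 \<le> r \<and> (\<forall>u\<in>hcarrier H. (hnorm H (\<pi> b u))\<^sup>2 \<le> r * (hnorm H u)\<^sup>2)}"
  define M where "M = Inf R"
  obtain K where K: "\<And>u. u \<in> hcarrier H \<Longrightarrow> hnorm H (\<pi> b u) \<le> K * hnorm H u"
    using rep_bounded[of b] by blast
  have "K\<^sup>2 \<in> R"
    unfolding R_def
    by (auto simp: power_mult_distrib[symmetric] intro!: power_mono K)
  then have ne: "R \<noteq> {}" by blast
  have bdd: "bdd_below R" by (auto simp: R_def bdd_below_def)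
  have M0: "0 \<le> M" unfolding M_def by (rule cInf_greatest[OF ne]) (auto simp: R_def)
  have M: "(hnorm H (\<pi> b u))\<^sup>2 \<le> M * (hnorm H u)\<^sup>2" if u: "u \<in> hcarrier H" for u
  proof (cases "hnorm H u = 0")
    case True
    then show ?thesis using K[OF u] u by (simp add: antisym)
  next
    case False
    have "(hnorm H (\<pi> b u))\<^sup>2 / (hnorm H u)\<^sup>2 \<le> M"
      unfolding M_def by (rule cInf_greatest[OF ne]) (use False u in \<open>auto simp: R_def field_simps\<close>)
    then show ?thesis using False by (simp add: field_simps)
  qed
  let ?h = "ell1_times \<sigma> (ell1_star \<sigma> b) b"
  have "M \<le> (norm b)\<^sup>2"
  proof (rule ccontr)
    assume "\<not> ?thesis"
    moreover have "norm ?h \<le> norm b * norm b"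
      by (rule order_trans[OF norm_ell1_times[OF homeo]]) (intro mult_right_mono norm_ell1_star[OF homeo] norm_ge_zero)
    ultimately have hM: "norm ?h < M" and Mpos: "0 < M"
      using zero_le_power2[of "norm b"] unfolding power2_eq_square by linarith+
    obtain c where c: "ell1_times \<sigma> c ?h = M *\<^sub>R c - ell1_one"
      using ell1_neumann[OF homeo hM] by blast
    obtain L where L: "\<And>u. u \<in> hcarrier H \<Longrightarrow> hnorm H (\<pi> c u) \<le> L * hnorm H u"
      using rep_bounded[of c] by blast
    \<comment> \<open>\<open>L\<close> bounds the image of the inverse \<open>c\<close>. The
      estimate \<open>key\<close> makes \<open>C * M / (1 + C)\<close> a member of \<open>R\<close>,
      although it is smaller than the infimum \<open>M\<close>.\<close>
    define C where "C = L\<^sup>2 * M\<^sup>2"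
    have key: "(1 + C) * (hnorm H (\<pi> b u))\<^sup>2 \<le> C * M * (hnorm H u)\<^sup>2" if u: "u \<in> hcarrier H" for u
    proof -
      \<comment> \<open>In a degenerate representation \<open>\<pi> ell1_one\<close> is only a
        projection; the image \<open>?e\<close> takes the place of \<open>u\<close>.\<close>
      let ?e = "\<pi> ell1_one u"
      let ?w = "hadd H (hscale H (of_real M) ?e) (hscale H (- 1) (\<pi> ?h u))"
      have w: "?w \<in> hcarrier H" using u by (simp add: closed)
      have ee: "\<pi> ell1_one (\<pi> a v) = \<pi> a v" "\<pi> a (\<pi> ell1_one v) = \<pi> a v" if "v \<in> hcarrier H" for a v
        using that by (simp_all add: rep_times[symmetric] ell1_one_times[OF homeo])
      have "\<pi> c ?w = hadd H (hscale H (of_real M) (\<pi> c u)) (hscale H (- 1) (\<pi> (ell1_times \<sigma> c ?h) u))"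
        using u by (simp add: rep_hadd rep_hscale ee rep_times closed)
      also have "\<dots> = ?e"
        unfolding c using u
        by (intro eqI_inner) (auto simp: rep_diff rep_scaleR inner_simps)
      finally have ce: "\<pi> c ?w = ?e" .
      have n1: "(hnorm H ?e)\<^sup>2 \<le> (hnorm H u)\<^sup>2"
      proof -
        have "(hnorm H ?e)\<^sup>2 = Re (hinner H ?e u)"
          unfolding hnorm_rep_sq[OF u] by (simp add: ell1_star_one[OF homeo] ell1_one_times[OF homeo])
        then have "(hnorm H ?e)\<^sup>2 \<le> hnorm H ?e * hnorm H u"
          using Cauchy_Schwarz[of ?e u] complex_Re_le_cmod[of "hinner H ?e u"] u by simp
        then show ?thesis
          using u hnorm_nonneg[OF rep_closed[OF u], of ell1_one]
          by (cases "hnorm H ?e = 0") (auto simp: power2_eq_square intro!: mult_mono)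
      qed
      \<comment> \<open>The adjoint of \<open>\<pi> b\<close> obeys the same bound \<open>M\<close>:
        pair \<open>?y\<close> with itself, move the adjoint over, and cancel a factor
        \<open>(hnorm H ?y)\<^sup>2\<close>.\<close>
      have n2: "(hnorm H (\<pi> ?h u))\<^sup>2 \<le> M * (hnorm H (\<pi> b u))\<^sup>2"
      proof -
        let ?v = "\<pi> b u" and ?y = "\<pi> (ell1_star \<sigma> b) (\<pi> b u)"
        have "(hnorm H ?y)\<^sup>2 = Re (hinner H ?v (\<pi> b ?y))"
          using u by (simp add: hnorm_power2 rep_star)
        then have "(hnorm H ?y)\<^sup>2 \<le> hnorm H ?v * hnorm H (\<pi> b ?y)"
          using Cauchy_Schwarz[of ?v "\<pi> b ?y"] complex_Re_le_cmod[of "hinner H ?v (\<pi> b ?y)"] u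
          by simp
        then have "((hnorm H ?y)\<^sup>2)\<^sup>2 \<le> (hnorm H ?v * hnorm H (\<pi> b ?y))\<^sup>2"
          by (intro power_mono) auto
        also have "\<dots> \<le> (hnorm H ?v)\<^sup>2 * (M * (hnorm H ?y)\<^sup>2)"
          unfolding power_mult_distrib using M[of ?y] u by (intro mult_left_mono) auto
        finally have *: "(hnorm H ?y)\<^sup>2 * (hnorm H ?y)\<^sup>2 \<le> (M * (hnorm H ?v)\<^sup>2) * (hnorm H ?y)\<^sup>2"
          by (simp add: power2_eq_square algebra_simps)
        have "(hnorm H ?y)\<^sup>2 \<le> M * (hnorm H ?v)\<^sup>2"
        proof (cases "hnorm H ?y = 0")
          case True then show ?thesis using M0 by simp
        next
          case False
          then show ?thesis using * by (intro mult_right_le_imp_le[OF *]) auto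
        qed
        then show ?thesis using u by (simp add: rep_times)
      qed
      have cross: "Re (hinner H ?e (\<pi> ?h u)) = (hnorm H (\<pi> b u))\<^sup>2"
        "Re (hinner H (\<pi> ?h u) ?e) = (hnorm H (\<pi> b u))\<^sup>2"
      proof -
        have "hinner H (\<pi> ?h u) ?e = hinner H (\<pi> ?h u) u"
          using u rep_star[of "\<pi> ?h u" u ell1_one] by (simp add: ell1_star_one[OF homeo] ee)
        then show "Re (hinner H (\<pi> ?h u) ?e) = (hnorm H (\<pi> b u))\<^sup>2"
          using hnorm_rep_sq[OF u, of b] by simp
        then show "Re (hinner H ?e (\<pi> ?h u)) = (hnorm H (\<pi> b u))\<^sup>2"
          using inner_commute[of ?e "\<pi> ?h u"] u by simp
      qed
      have "(hnorm H ?w)\<^sup>2 = M\<^sup>2 * (hnorm H ?e)\<^sup>2 -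
          2 * M * (hnorm H (\<pi> b u))\<^sup>2 + (hnorm H (\<pi> ?h u))\<^sup>2"
        unfolding hnorm_power2[OF w] hnorm_power2[OF rep_closed[OF u], of ell1_one]
          hnorm_power2[OF rep_closed[OF u], of ?h]
        using u cross by (simp add: inner_simps algebra_simps power2_eq_square)
      also have "\<dots> \<le> M\<^sup>2 * (hnorm H u)\<^sup>2 - M * (hnorm H (\<pi> b u))\<^sup>2"
        using n2 mult_left_mono[OF n1, of "M\<^sup>2"] by simp
      finally have wle: "(hnorm H ?w)\<^sup>2 \<le> M\<^sup>2 * (hnorm H u)\<^sup>2 - M * (hnorm H (\<pi> b u))\<^sup>2" .
      have "(hnorm H (\<pi> b u))\<^sup>2 = (hnorm H (\<pi> b ?e))\<^sup>2"
        using u by (simp add: ee)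
      also have "\<dots> \<le> M * (hnorm H (\<pi> c ?w))\<^sup>2"
        using M[of ?e] u by (simp add: ce)
      also have "\<dots> \<le> M * (L * hnorm H ?w)\<^sup>2"
        using L[OF w] w M0 by (intro mult_left_mono power_mono) auto
      also have "\<dots> = M * L\<^sup>2 * (hnorm H ?w)\<^sup>2" by (simp add: power_mult_distrib)
      also have "\<dots> \<le> M * L\<^sup>2 * (M\<^sup>2 * (hnorm H u)\<^sup>2 - M * (hnorm H (\<pi> b u))\<^sup>2)"
        using wle M0 by (intro mult_left_mono) auto
      finally show ?thesis
        by (simp add: C_def algebra_simps power2_eq_square)
    qed
    have C0: "0 \<le> C" by (simp add: C_def)
    have "C * M / (1 + C) \<in> R"
      using key C0 M0 by (auto simp: R_def field_simps)
    then have "M \<le> C * M / (1 + C)"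
      unfolding M_def using bdd by (intro cInf_lower)
    then show False using C0 Mpos by (simp add: field_simps)
  qed
  then have "M * (hnorm H u)\<^sup>2 \<le> (norm b * hnorm H u)\<^sup>2"
    unfolding power_mult_distrib by (rule mult_right_mono) simp
  with M[OF u] have "(hnorm H (\<pi> b u))\<^sup>2 \<le> (norm b * hnorm H u)\<^sup>2"
    by (rule order_trans)
  then show ?thesis by (rule power2_le_imp_le) (use u in auto)
qed

end

section \<open>Square-summable functions\<close>

lemma ell2_sel [simp]:
  "hcarrier (ell2 J) = {u. (\<forall>j. j \<notin> J \<longrightarrow> u j = 0) \<and> (\<lambda>j. (cmod (u j))\<^sup>2) summable_on J}"
  "hzero (ell2 J) = (\<lambda>_. 0)"
  "hadd (ell2 J) u v = (\<lambda>j. u j + v j)"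
  "hscale (ell2 J) c u = (\<lambda>j. c * u j)"
  "hinner (ell2 J) u v = (\<Sum>\<^sub>\<infinity>j\<in>J. u j * cnj (v j))"
  by (simp_all add: ell2_def)

lemma ell2_inner_self: "hinner (ell2 J) u u = complex_of_real (\<Sum>\<^sub>\<infinity>j\<in>J. (cmod (u j))\<^sup>2)"
proof -
  have eq: "(\<lambda>j. u j * cnj (u j)) = (\<lambda>j. complex_of_real ((cmod (u j))\<^sup>2))"
    by (simp only: complex_norm_square[symmetric] of_real_power)
  show ?thesis
  proof (cases "(\<lambda>j. (cmod (u j))\<^sup>2) summable_on J")
    case True
    then show ?thesis
      unfolding ell2_sel eq by (intro infsumI iffD2[OF has_sum_of_real_iff] has_sum_infsum)
  next
    case False
    have "\<not> (\<lambda>j. complex_of_real ((cmod (u j))\<^sup>2)) summable_on J"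
    proof
      assume "(\<lambda>j. complex_of_real ((cmod (u j))\<^sup>2)) summable_on J"
      from summable_on_Re[OF this] False show False by simp
    qed
    then show ?thesis
      using False unfolding ell2_sel eq by (simp add: infsum_not_exists)
  qed
qed

lemma ell2_hnorm_sq: "(hnorm (ell2 J) u)\<^sup>2 = (\<Sum>\<^sub>\<infinity>j\<in>J. (cmod (u j))\<^sup>2)"
  unfolding hnorm_def ell2_inner_self by (simp add: infsum_nonneg)

lemma ell2_hnorm_eq: "hnorm (ell2 J) u = sqrt (\<Sum>\<^sub>\<infinity>j\<in>J. (cmod (u j))\<^sup>2)"
  unfolding hnorm_def ell2_inner_self by simp

lemma ell2_coord_le:
  assumes "u \<in> hcarrier (ell2 J)"
  shows "cmod (u j) \<le> hnorm (ell2 J) u"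
proof (cases "j \<in> J")
  case True
  have "(cmod (u j))\<^sup>2 \<le> (\<Sum>\<^sub>\<infinity>j\<in>J. (cmod (u j))\<^sup>2)"
    using finite_sum_le_infsum[of "\<lambda>j. (cmod (u j))\<^sup>2" J "{j}"] assms True by simp
  then show ?thesis unfolding ell2_hnorm_eq by (rule real_le_rsqrt)
next
  case False
  then show ?thesis using assms by (simp add: ell2_hnorm_eq infsum_nonneg)
qed

lemma cmod_mult_le_squares: "cmod (a * b) \<le> (cmod a)\<^sup>2 + (cmod b)\<^sup>2"
proof -
  have "0 \<le> (cmod a - cmod b)\<^sup>2 + (cmod a)\<^sup>2 + (cmod b)\<^sup>2" by simp
  then show ?thesis by (simp add: norm_mult power2_diff)
qed

lemma cmod_add_le_squares: "(cmod (a + b))\<^sup>2 \<le> 2 * (cmod a)\<^sup>2 + 2 * (cmod b)\<^sup>2"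
proof -
  have "(cmod (a + b))\<^sup>2 \<le> (cmod a + cmod b)\<^sup>2"
    by (intro power_mono norm_triangle_ineq) auto
  also have "\<dots> \<le> 2 * (cmod a)\<^sup>2 + 2 * (cmod b)\<^sup>2"
    using zero_le_power2[of "cmod a - cmod b"] by (simp add: power2_diff power2_sum)
  finally show ?thesis .
qed

lemma ell2_add_closed:
  "u \<in> hcarrier (ell2 J) \<Longrightarrow> v \<in> hcarrier (ell2 J) \<Longrightarrow> (\<lambda>j. u j + v j) \<in> hcarrier (ell2 J)"
  by (auto intro: summable_on_comparison_test[OF summable_on_add[OF summable_on_cmult_right[of _ J 2]
        summable_on_cmult_right[of _ J 2]]] cmod_add_le_squares)

lemma ell2_scale_closed: "u \<in> hcarrier (ell2 J) \<Longrightarrow> (\<lambda>j. c * u j) \<in> hcarrier (ell2 J)"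
  by (auto simp: norm_mult power_mult_distrib intro: summable_on_cmult_right)

lemma ell2_inner_summable:
  assumes "u \<in> hcarrier (ell2 J)" "v \<in> hcarrier (ell2 J)"
  shows "(\<lambda>j. norm (u j * cnj (v j))) summable_on J" "(\<lambda>j. u j * cnj (v j)) summable_on J"
proof -
  have le: "norm (u j * cnj (v j)) \<le> (cmod (u j))\<^sup>2 + (cmod (v j))\<^sup>2" for j
    using cmod_mult_le_squares[of "u j" "cnj (v j)"] by simp
  have "(\<lambda>j. (cmod (u j))\<^sup>2 + (cmod (v j))\<^sup>2) summable_on J"
    using assms by (intro summable_on_add) auto
  then show "(\<lambda>j. norm (u j * cnj (v j))) summable_on J"
    by (rule summable_on_comparison_test) (auto simp only: le norm_ge_zero)
  then show "(\<lambda>j. u j * cnj (v j)) summable_on J" by (rule abs_summable_summable)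
qed

lemma ell2_inner_space: "complex_inner_space (ell2 J)"
proof
  fix u v w :: "'a \<Rightarrow> complex" and c
  let ?H = "ell2 J"
  show "hzero ?H \<in> hcarrier ?H" by simp
  show "hadd ?H u v \<in> hcarrier ?H" if "u \<in> hcarrier ?H" "v \<in> hcarrier ?H"
    using ell2_add_closed[OF that] by (simp only: ell2_sel(3))
  show "hscale ?H c u \<in> hcarrier ?H" if "u \<in> hcarrier ?H"
    using ell2_scale_closed[OF that] by (simp only: ell2_sel(4))
  show "hinner ?H (hadd ?H u v) w = hinner ?H u w + hinner ?H v w"
    if "u \<in> hcarrier ?H" "v \<in> hcarrier ?H" "w \<in> hcarrier ?H"
    using infsum_add[OF ell2_inner_summable(2)[OF that(1,3)] ell2_inner_summable(2)[OF that(2,3)]]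
    by (simp add: distrib_right)
  show "hinner ?H (hscale ?H c u) v = c * hinner ?H u v"
    by (simp add: infsum_cmult_right'[symmetric] mult.assoc)
  show "hinner ?H u v = cnj (hinner ?H v u)"
    by (simp add: mult.commute flip: infsum_cnj)
  show "0 \<le> Re (hinner ?H u u)"
    unfolding ell2_inner_self by (simp add: infsum_nonneg)
  show "u = hzero ?H" if "u \<in> hcarrier ?H" "hinner ?H u u = 0"
  proof -
    have "hnorm ?H u = 0" using that(2) by (simp only: hnorm_def) simp
    then have "cmod (u j) \<le> 0" for j using ell2_coord_le[OF that(1), of j] by simp
    then show ?thesis by auto
  qed
qed (auto simp: algebra_simps)

lemma ell2_hdist: "hdist (ell2 J) u v = sqrt (\<Sum>\<^sub>\<infinity>j\<in>J. (cmod (u j - v j))\<^sup>2)"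
  by (simp add: hdist_def ell2_hnorm_eq)

lemma ell2_Metric_space: "Metric_space (hcarrier (ell2 J)) (hdist (ell2 J))"
proof
  interpret complex_inner_space "ell2 J" by (rule ell2_inner_space)
  fix x y z :: "'a \<Rightarrow> complex"
  show "0 \<le> hdist (ell2 J) x y" by (simp add: ell2_hdist infsum_nonneg)
  show "hdist (ell2 J) x y = hdist (ell2 J) y x" by (simp add: ell2_hdist norm_minus_commute)
  {
    assume xy: "x \<in> hcarrier (ell2 J)" "y \<in> hcarrier (ell2 J)"
    have d: "(\<lambda>j. x j - y j) \<in> hcarrier (ell2 J)"
      using add_closed[OF xy(1) scale_closed[OF xy(2), of "- 1"]] by simp
    show "hdist (ell2 J) x y = 0 \<longleftrightarrow> x = y"
      using hnorm_eq_0_iff[OF d] by (auto simp: hdist_def fun_eq_iff)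
  }
  note d = this
  assume xyz: "x \<in> hcarrier (ell2 J)" "y \<in> hcarrier (ell2 J)" "z \<in> hcarrier (ell2 J)"
  have "hdist (ell2 J) x z = hnorm (ell2 J) (hadd (ell2 J) (\<lambda>j. x j - y j) (\<lambda>j. y j - z j))"
    by (simp add: hdist_def)
  also have "\<dots> \<le> hdist (ell2 J) x y + hdist (ell2 J) y z"
    using hnorm_triangle[OF add_closed[OF xyz(1) scale_closed[OF xyz(2), of "- 1"]]
        add_closed[OF xyz(2) scale_closed[OF xyz(3), of "- 1"]]]
    by (simp add: hdist_def)
  finally show "hdist (ell2 J) x z \<le> hdist (ell2 J) x y + hdist (ell2 J) y z" .
qed

lemma ell2_complete: "Metric_space.mcomplete (hcarrier (ell2 J)) (hdist (ell2 J))"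
proof -
  let ?H = "ell2 J"
  interpret complex_inner_space ?H by (rule ell2_inner_space)
  interpret M: Metric_space "hcarrier ?H" "hdist ?H" by (rule ell2_Metric_space)
  have "\<exists>x. limitin M.mtopology X x sequentially" if X: "M.MCauchy X" for X
  proof -
    note XM = X[unfolded M.MCauchy_def]
    have Xc: "X i \<in> hcarrier ?H" for i using conjunct1[OF XM] by (rule subsetD) simp
    have diff: "(\<lambda>j. u j - v j) \<in> hcarrier ?H" if "u \<in> hcarrier ?H" "v \<in> hcarrier ?H" for u v
      using add_closed[OF that(1) scale_closed[OF that(2), of "- 1"]] by simp
    have d: "hdist ?H u v = hnorm ?H (\<lambda>j. u j - v j)" for u v
      by (simp add: hdist_def)
    have cau: "\<exists>N. \<forall>i\<ge>N. \<forall>k\<ge>N. hdist ?H (X i) (X k) < e" if "0 < e" for e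
      using conjunct2[OF XM, rule_format, OF that] by metis
    have "Cauchy (\<lambda>i. X i j)" for j
      unfolding Cauchy_def
    proof (intro allI impI)
      fix e :: real assume "0 < e"
      then obtain N where N: "\<forall>i\<ge>N. \<forall>k\<ge>N. hdist ?H (X i) (X k) < e" using cau by blast
      have "dist (X i j) (X k j) \<le> hdist ?H (X i) (X k)" for i k
        unfolding d dist_norm using ell2_coord_le[OF diff[OF Xc[of i] Xc[of k]], of j] by simp
      with N show "\<exists>M. \<forall>m\<ge>M. \<forall>n\<ge>M. dist (X m j) (X n j) < e"
        by (meson le_less_trans)
    qed
    then have "\<forall>j. \<exists>l. (\<lambda>i. X i j) \<longlonglongrightarrow> l"
      unfolding convergent_def[symmetric] by (blast intro: Cauchy_convergent)
    then obtain L where L: "\<And>j. (\<lambda>i. X i j) \<longlonglongrightarrow> L j" by moura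
    have L0: "L j = 0" if "j \<notin> J" for j
      using L[of j] Xc that by (simp add: LIMSEQ_const_iff)
    have bound: "(\<Sum>j\<in>F. (cmod (X i j - L j))\<^sup>2) \<le> e\<^sup>2"
      if N: "\<And>k. k \<ge> N \<Longrightarrow> hdist ?H (X i) (X k) \<le> e" and F: "finite F" "F \<subseteq> J" for i N e F
    proof (rule tendsto_upperbound)
      show "(\<lambda>k. \<Sum>j\<in>F. (cmod (X i j - X k j))\<^sup>2) \<longlonglongrightarrow> (\<Sum>j\<in>F. (cmod (X i j - L j))\<^sup>2)"
        by (intro tendsto_intros L)
      have "(\<Sum>j\<in>F. (cmod (X i j - X k j))\<^sup>2) \<le> e\<^sup>2" if "k \<ge> N" for k
      proof -
        have "(\<Sum>j\<in>F. (cmod (X i j - X k j))\<^sup>2) \<le> (\<Sum>\<^sub>\<infinity>j\<in>J. (cmod (X i j - X k j))\<^sup>2)"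
          using F diff[OF Xc[of i] Xc[of k]] by (intro finite_sum_le_infsum) auto
        also have "\<dots> = (hdist ?H (X i) (X k))\<^sup>2"
          by (simp add: d ell2_hnorm_sq)
        also have "\<dots> \<le> e\<^sup>2" using N[OF that] by (intro power_mono) auto
        finally show ?thesis .
      qed
      then show "\<forall>\<^sub>F k in sequentially. (\<Sum>j\<in>F. (cmod (X i j - X k j))\<^sup>2) \<le> e\<^sup>2"
        by (intro eventually_sequentiallyI[of N])
    qed simp
    have lim: "(\<lambda>j. X i j - L j) \<in> hcarrier ?H \<and> hnorm ?H (\<lambda>j. X i j - L j) \<le> e"
      if N: "\<And>k. k \<ge> N \<Longrightarrow> hdist ?H (X i) (X k) \<le> e" and e: "0 \<le> e" for i N e
    proof
      have s: "(\<lambda>j. (cmod (X i j - L j))\<^sup>2) summable_on J"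
        using bound[of N i e, OF N] by (intro nonneg_bdd_above_summable_on) (auto simp: bdd_above_def)
      then show "(\<lambda>j. X i j - L j) \<in> hcarrier ?H" using L0 Xc[of i] by simp
      have "(hnorm ?H (\<lambda>j. X i j - L j))\<^sup>2 \<le> e\<^sup>2"
        unfolding ell2_hnorm_sq by (rule infsum_le_finite_sums[OF s]) (rule bound[of N i e, OF N])
      then show "hnorm ?H (\<lambda>j. X i j - L j) \<le> e" by (rule power2_le_imp_le) (rule e)
    qed
    obtain N1 where N1: "\<forall>i\<ge>N1. \<forall>k\<ge>N1. hdist ?H (X i) (X k) < 1" using cau[of 1] by auto
    have "(\<lambda>j. X N1 j - L j) \<in> hcarrier ?H"
      using lim[of N1 N1 1] N1 by (auto intro: less_imp_le)
    from diff[OF Xc[of N1] this] have Lc: "L \<in> hcarrier ?H" by simp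
    have "\<forall>\<^sub>F i in sequentially. X i \<in> hcarrier ?H \<and> hdist ?H (X i) L < e" if e: "0 < e" for e
    proof -
      obtain N where N: "\<forall>i\<ge>N. \<forall>k\<ge>N. hdist ?H (X i) (X k) < e / 2" using cau[of "e / 2"] e by auto
      have "hdist ?H (X i) L < e" if "i \<ge> N" for i
        using lim[of N i "e / 2"] N that e unfolding d by (fastforce intro: less_imp_le)
      then show ?thesis using Xc by (intro eventually_sequentiallyI[of N]) auto
    qed
    then show ?thesis using Lc by (intro exI[of _ L]) (simp only: M.limitin_metric, blast)
  qed
  then show ?thesis by (simp only: M.mcomplete_def) blast
qed

lemma ell2_hilbert_space: "complex_hilbert_space (ell2 J)"
proof -
  interpret complex_inner_space "ell2 J" by (rule ell2_inner_space)
  show ?thesis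
    by (rule complex_hilbert_space.intro)
       (rule zero_closed add_closed scale_closed add_assoc add_commute add_zero add_inverse
         inner_add_left inner_scale_left inner_commute inner_nonneg inner_definite ell2_complete;
         assumption?
       | simp add: algebra_simps)+
qed

lemma ket_carrier: "k \<in> J \<Longrightarrow> ket k \<in> hcarrier (ell2 J)"
proof -
  assume "k \<in> J"
  have "(\<lambda>j. (cmod (ket k j))\<^sup>2) summable_on J"
    by (rule finite_nonzero_values_imp_summable_on, rule finite_subset[of _ "{k}"])
       (auto simp: ket_def split: if_splits)
  then show ?thesis using \<open>k \<in> J\<close> by (auto simp: ket_def)
qed

lemma ell2_inner_ket:
  assumes "k \<in> J"
  shows "hinner (ell2 J) u (ket k) = u k"
proof -
  have "(\<Sum>\<^sub>\<infinity>j\<in>J. u j * cnj (ket k j)) = (\<Sum>\<^sub>\<infinity>j\<in>{k}. u j * cnj (ket k j))"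
    by (rule infsum_cong_neutral) (use assms in \<open>auto simp: ket_def\<close>)
  then show ?thesis by (simp add: ket_def)
qed

section \<open>Representations induced by an action on an index set\<close>

text \<open>The weighted sum of the squares of \<open>t n - s\<close> is a nonnegative quadratic
  polynomial in \<open>s\<close>; its value at \<open>s = P / W\<close> gives the
  inequality.\<close>

lemma weighted_Cauchy_Schwarz:
  fixes w t :: "'b \<Rightarrow> real"
  assumes w: "w summable_on A" "\<And>n. n \<in> A \<Longrightarrow> 0 \<le> w n"
    and wt: "(\<lambda>n. w n * t n) summable_on A" "(\<lambda>n. w n * (t n)\<^sup>2) summable_on A"
  shows "(\<Sum>\<^sub>\<infinity>n\<in>A. w n * t n)\<^sup>2 \<le> (\<Sum>\<^sub>\<infinity>n\<in>A. w n) * (\<Sum>\<^sub>\<infinity>n\<in>A. w n * (t n)\<^sup>2)"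
proof -
  define W where "W = (\<Sum>\<^sub>\<infinity>n\<in>A. w n)"
  define P where "P = (\<Sum>\<^sub>\<infinity>n\<in>A. w n * t n)"
  define S where "S = (\<Sum>\<^sub>\<infinity>n\<in>A. w n * (t n)\<^sup>2)"
  have hs: "((\<lambda>n. w n * (t n)\<^sup>2 + (- 2 * s) * (w n * t n) + s\<^sup>2 * w n) has_sum
      S + (- 2 * s) * P + s\<^sup>2 * W) A" for s
    unfolding S_def P_def W_def
    by (intro has_sum_add has_sum_cmult_right has_sum_infsum wt w)
  have "(\<lambda>n. w n * (t n)\<^sup>2 + (- 2 * s) * (w n * t n) + s\<^sup>2 * w n) = (\<lambda>n. w n * (t n - s)\<^sup>2)" for s
    by (auto simp: fun_eq_iff power2_diff algebra_simps)
  then have q: "0 \<le> S + (- 2 * s) * P + s\<^sup>2 * W" for s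
    using has_sum_nonneg[OF hs[of s]] w(2) by (metis mult_nonneg_nonneg zero_le_power2)
  have W0: "0 \<le> W" unfolding W_def by (rule infsum_nonneg) (rule w)
  show ?thesis
  proof (cases "W = 0")
    case True
    have "P = 0"
    proof (rule ccontr)
      assume "P \<noteq> 0"
      \<comment> \<open>For \<open>W = 0\<close> the quadratic is affine in \<open>s\<close>; this
        \<open>s\<close> is chosen to give it the value \<open>- 1\<close>.\<close>
      then have "S + (- 2 * ((S + 1) / (2 * P))) * P = - 1" by (simp add: field_simps)
      then show False using q[of "(S + 1) / (2 * P)"] True by simp
    qed
    then show ?thesis using True by (simp add: W_def P_def)
  next
    case False
    then have "0 \<le> W * (S + (- 2 * (P / W)) * P + (P / W)\<^sup>2 * W)"
      using q[of "P / W"] W0 by (intro mult_nonneg_nonneg) auto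
    also have "\<dots> = W * S - P\<^sup>2"
      using False by (simp add: field_simps power2_eq_square)
    finally show ?thesis by (simp add: W_def P_def S_def)
  qed
qed

text \<open>One construction for all representations in play: on functions on an invariant set of
  pairs of a point and a unit scalar, on an aperiodic orbit indexed by the integers, and on a
  periodic orbit indexed by the numbers below the period. \<open>\<rho>\<close> moves indices,
  \<open>q\<close> gives the point under an index, and \<open>c\<close> is a cocycle of unit scalars
  that carries the circle parameter.\<close>

locale orbit_action =
  fixes \<sigma> :: "'a::topological_space \<Rightarrow> 'a" and J :: "'j set" and \<rho> :: "int \<Rightarrow> 'j \<Rightarrow> 'j"
    and q :: "'j \<Rightarrow> 'a" and c :: "int \<Rightarrow> 'j \<Rightarrow> complex"
  assumes homeo: "homeomorphism UNIV UNIV \<sigma> (inv \<sigma>)"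
    and \<rho>_closed: "j \<in> J \<Longrightarrow> \<rho> n j \<in> J"
    and \<rho>_0: "j \<in> J \<Longrightarrow> \<rho> 0 j = j"
    and \<rho>_add: "j \<in> J \<Longrightarrow> \<rho> (m + n) j = \<rho> m (\<rho> n j)"
    and q_\<rho>: "j \<in> J \<Longrightarrow> q (\<rho> n j) = int_iter \<sigma> n (q j)"
    and c_norm: "j \<in> J \<Longrightarrow> cmod (c n j) = 1"
    and c_add: "j \<in> J \<Longrightarrow> c (m + n) j = c m j * c n (\<rho> (- m) j)"
begin

definition act :: "'a ell1 \<Rightarrow> ('j \<Rightarrow> complex) \<Rightarrow> 'j \<Rightarrow> complex" where
  "act a u j = (if j \<in> J then \<Sum>\<^sub>\<infinity>n. c n j * coeff a n (q j) * u (\<rho> (- n) j) else 0)"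

lemma \<rho>_inverse: "j \<in> J \<Longrightarrow> \<rho> n (\<rho> (- n) j) = j" "j \<in> J \<Longrightarrow> \<rho> (- n) (\<rho> n j) = j"
  using \<rho>_add[of j n "- n"] \<rho>_add[of j "- n" n] \<rho>_0[of j] by auto

lemma c_0: "j \<in> J \<Longrightarrow> c 0 j = 1"
  using c_add[of j 0 0] c_norm[of j 0] \<rho>_0[of j] by (auto simp: norm_eq_zero)

lemma cnj_c: "j \<in> J \<Longrightarrow> cnj (c (- n) (\<rho> (- n) j)) = c n j"
proof -
  assume j: "j \<in> J"
  let ?d = "c (- n) (\<rho> (- n) j)"
  have "c n j * ?d = 1" using c_add[OF j, of n "- n"] c_0[OF j] by simp
  moreover have "?d * cnj ?d = 1"
    using c_norm[OF \<rho>_closed[OF j], of "- n" "- n"] complex_norm_square[of ?d] by simp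
  ultimately show ?thesis by (metis mult.assoc mult.commute mult.right_neutral)
qed

lemma bij_\<rho>: "bij_betw (\<rho> n) J J"
  by (rule bij_betw_byWitness[where f' = "\<rho> (- n)"]) (auto simp: \<rho>_inverse \<rho>_closed)

lemma act_terms:
  assumes "\<forall>j\<in>J. cmod (u j) \<le> B" "j \<in> J"
  shows "cmod (c n j * coeff a n (q j) * u (\<rho> (- n) j)) \<le> norm (coeff a n) * B"
  using assms by (auto simp: norm_mult c_norm \<rho>_closed norm_bounded intro!: mult_mono)

lemma act_summable:
  assumes "\<forall>j\<in>J. cmod (u j) \<le> B" "j \<in> J"
  shows "(\<lambda>n. norm (c n j * coeff a n (q j) * u (\<rho> (- n) j))) summable_on UNIV"
  using summable_on_cmult_left[OF summable_norm_coeff[of a], of B]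
  by (rule summable_on_comparison_test) (use act_terms[OF assms] in auto)

lemma act_has_sum:
  assumes "\<forall>j\<in>J. cmod (u j) \<le> B" "j \<in> J"
  shows "((\<lambda>n. c n j * coeff a n (q j) * u (\<rho> (- n) j)) has_sum act a u j) UNIV"
  using has_sum_infsum[OF abs_summable_summable[OF act_summable[OF assms]]] assms(2)
  by (simp add: act_def)

lemma act_add_left:
  assumes "\<forall>j\<in>J. cmod (u j) \<le> B"
  shows "act (a + b) u j = act a u j + act b u j"
proof (cases "j \<in> J")
  case True
  from has_sum_unique[OF act_has_sum[OF assms True, of "a + b"]]
    has_sum_add[OF act_has_sum[OF assms True, of a] act_has_sum[OF assms True, of b]]
  show ?thesis by (simp add: algebra_simps)
qed (simp add: act_def)

lemma act_scale_left: "act (ell1_scale s a) u j = s * act a u j"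
  by (simp add: act_def const_bcontfun.rep_eq infsum_cmult_right'[symmetric] mult_ac)

lemma act_scaleR_left: "act (r *\<^sub>R a) u j = r *\<^sub>R act a u j"
  using act_scale_left[of "of_real r" a u j] by (simp add: ell1_scale_of_real scaleR_conv_of_real)

lemma act_add_right:
  assumes "\<forall>j\<in>J. cmod (u j) \<le> B" "\<forall>j\<in>J. cmod (v j) \<le> B'"
  shows "act a (\<lambda>j. u j + v j) j = act a u j + act a v j"
proof (cases "j \<in> J")
  case True
  have "\<forall>j\<in>J. cmod (u j + v j) \<le> B + B'"
    using norm_triangle_ineq[of "u _" "v _"] assms by (meson add_mono order_trans)
  from has_sum_unique[OF act_has_sum[OF this True, of a]]
    has_sum_add[OF act_has_sum[OF assms(1) True, of a] act_has_sum[OF assms(2) True, of a]]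
  show ?thesis by (simp add: algebra_simps)
qed (simp add: act_def)

lemma act_scale_right: "act a (\<lambda>j. s * u j) j = s * act a u j"
  by (simp add: act_def infsum_cmult_right'[symmetric] mult_ac)

lemma act_bound:
  assumes "\<forall>j\<in>J. cmod (u j) \<le> B" "j \<in> J"
  shows "cmod (act a u j) \<le> norm a * B"
proof -
  have "cmod (act a u j) \<le> (\<Sum>\<^sub>\<infinity>n. norm (c n j * coeff a n (q j) * u (\<rho> (- n) j)))"
    using norm_infsum_bound[OF act_summable[OF assms]] assms(2) by (simp add: act_def)
  also have "\<dots> \<le> (\<Sum>\<^sub>\<infinity>n. norm (coeff a n) * B)"
    by (rule infsum_mono[OF act_summable[OF assms] summable_on_cmult_left[OF summable_norm_coeff]])
       (rule act_terms[OF assms])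
  finally show ?thesis by (simp add: infsum_cmult_left' norm_ell1.rep_eq)
qed

lemma act_times:
  assumes u: "\<forall>j\<in>J. cmod (u j) \<le> B"
  shows "act (ell1_times \<sigma> a b) u j = act a (act b u) j"
proof (cases "j \<in> J")
  case j: True
  define F where "F k m = c k j * coeff a k (q j) *
    (c m (\<rho> (- k) j) * coeff b m (q (\<rho> (- k) j)) * u (\<rho> (- m) (\<rho> (- k) j)))" for k m
  have B: "0 \<le> B" using u j norm_ge_zero order_trans by blast
  have "norm (F k m) \<le> norm (coeff a k) * (norm (coeff b m) * B)" for k m
    unfolding F_def using act_terms[OF u \<rho>_closed[OF j], of m "- k" b] B
    by (simp add: norm_mult c_norm j \<rho>_closed mult_mono norm_bounded)
  note conv = infsum_convolution[of F, OF this summable_norm_coeff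
      summable_on_cmult_left[OF summable_norm_coeff]]
  have "c n j * coeff (ell1_times \<sigma> a b) n (q j) * u (\<rho> (- n) j) = (\<Sum>\<^sub>\<infinity>k. F k (n - k))" for n
  proof -
    have "((\<lambda>k. c n j * (coeff a k (q j) * coeff b (n - k) (int_iter \<sigma> (- k) (q j))) * u (\<rho> (- n) j))
        has_sum c n j * coeff (ell1_times \<sigma> a b) n (q j) * u (\<rho> (- n) j)) UNIV"
      by (intro has_sum_cmult_left has_sum_cmult_right coeff_times_has_sum homeo)
    moreover have "c n j * (coeff a k (q j) * coeff b (n - k) (int_iter \<sigma> (- k) (q j))) * u (\<rho> (- n) j)
        = F k (n - k)" for k
      using c_add[OF j, of k "n - k"] \<rho>_add[OF j, of "- (n - k)" "- k"]
      by (simp add: F_def q_\<rho>[OF j] algebra_simps)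
    ultimately show ?thesis by (simp add: infsumI)
  qed
  then have "act (ell1_times \<sigma> a b) u j = (\<Sum>\<^sub>\<infinity>n. \<Sum>\<^sub>\<infinity>k. F k (n - k))"
    using j by (simp add: act_def)
  also have "\<dots> = (\<Sum>\<^sub>\<infinity>k. \<Sum>\<^sub>\<infinity>m. F k m)"
    using B by (intro conv) auto
  also have "\<dots> = act a (act b u) j"
    using j by (simp add: act_def F_def infsum_cmult_right' \<rho>_closed)
  finally show ?thesis .
qed (simp add: act_def)

lemma act_single: "j \<in> J \<Longrightarrow> act (ell1_single f m) u j = c m j * f (q j) * u (\<rho> (- m) j)"
  unfolding act_def by (simp, subst infsum_singleI[of m]) auto

text \<open>Each bijection \<open>\<tau> n\<close> preserves the square sum of \<open>u\<close>, so
  the exponent \<open>n\<close> contributes \<open>norm (coeff a n)\<close> times that sum. Taken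
  with \<open>\<rho> (- n)\<close> this is the norm bound; taken also with the identity it makes the
  double series for the adjoint absolutely convergent.\<close>

lemma weighted_square_has_sum:
  assumes u: "u \<in> hcarrier (ell2 J)" and bij: "\<And>n. bij_betw (\<tau> n) J J"
  shows "((\<lambda>(j, n). norm (coeff a n) * (cmod (u (\<tau> n j)))\<^sup>2) has_sum
    norm a * (hnorm (ell2 J) u)\<^sup>2) (J \<times> UNIV)"
proof -
  let ?N = "hnorm (ell2 J) u"
  define G where "G = (\<lambda>(n, j). norm (coeff a n) * (cmod (u (\<tau> n j)))\<^sup>2)"
  have us: "(\<lambda>j. (cmod (u j))\<^sup>2) summable_on J" using u by simp
  have inner: "((\<lambda>j. G (n, j)) has_sum norm (coeff a n) * ?N\<^sup>2) J" for n
  proof -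
    have "((\<lambda>j. (cmod (u (\<tau> n j)))\<^sup>2) has_sum ?N\<^sup>2) J"
      using iffD2[OF has_sum_reindex_bij_betw[OF bij[of n]], of "\<lambda>j. (cmod (u j))\<^sup>2"]
        has_sum_infsum[OF us] by (simp add: ell2_hnorm_sq)
    then show ?thesis unfolding G_def by (simp add: has_sum_cmult_right)
  qed
  have outer: "((\<lambda>n. norm (coeff a n) * ?N\<^sup>2) has_sum norm a * ?N\<^sup>2) UNIV"
    by (intro has_sum_cmult_left) (simp add: norm_ell1.rep_eq summable_norm_coeff)
  have "G summable_on UNIV \<times> J"
    by (rule summable_on_SigmaI[OF inner has_sum_imp_summable[OF outer]]) (auto simp: G_def)
  from has_sum_SigmaI[OF inner outer this]
  have "((\<lambda>(j, n). G (n, j)) has_sum norm a * ?N\<^sup>2) (J \<times> UNIV)"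
    by (subst has_sum_swap) simp
  then show ?thesis by (simp add: G_def)
qed

text \<open>Schur's test: Cauchy-Schwarz in \<open>n\<close> with weights
  \<open>norm (coeff a n)\<close>, followed by summation over the indices.\<close>

lemma act_ell2_bound:
  assumes u: "u \<in> hcarrier (ell2 J)"
  shows "act a u \<in> hcarrier (ell2 J)" "hnorm (ell2 J) (act a u) \<le> norm a * hnorm (ell2 J) u"
proof -
  let ?N = "hnorm (ell2 J) u"
  have uN: "cmod (u j) \<le> ?N" for j by (rule ell2_coord_le[OF u])
  then have uB: "\<forall>j\<in>J. cmod (u j) \<le> ?N" by blast
  define G where "G = (\<lambda>(n, j). norm (coeff a n) * (cmod (u (\<rho> (- n) j)))\<^sup>2)"
  have G: "((\<lambda>(j, n). G (n, j)) has_sum norm a * ?N\<^sup>2) (J \<times> UNIV)"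
    using weighted_square_has_sum[OF u, of "\<lambda>n. \<rho> (- n)" a, OF bij_\<rho>] by (simp add: G_def)
  define g where "g j = (\<Sum>\<^sub>\<infinity>n. G (n, j))" for j
  have gs: "(\<lambda>n. G (n, j)) summable_on UNIV" for j
    unfolding G_def
    by (simp, rule summable_on_comparison_test[OF summable_on_cmult_left[OF summable_norm_coeff[of a], of "?N\<^sup>2"]])
       (auto intro!: mult_left_mono power_mono uN)
  have g: "(g has_sum norm a * ?N\<^sup>2) J"
    by (rule has_sum_SigmaD[OF G]) (simp add: g_def gs)
  have le: "(cmod (act a u j))\<^sup>2 \<le> norm a * g j" if j: "j \<in> J" for j
  proof -
    have ws: "(\<lambda>n. norm (coeff a n) * cmod (u (\<rho> (- n) j))) summable_on UNIV"
      by (rule summable_on_comparison_test[OF summable_on_cmult_left[OF summable_norm_coeff[of a], of ?N]])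
         (auto intro!: mult_left_mono uN)
    have "cmod (act a u j) \<le> (\<Sum>\<^sub>\<infinity>n. norm (c n j * coeff a n (q j) * u (\<rho> (- n) j)))"
      using norm_infsum_bound[OF act_summable[OF uB j]] j by (simp add: act_def)
    also have "\<dots> \<le> (\<Sum>\<^sub>\<infinity>n. norm (coeff a n) * cmod (u (\<rho> (- n) j)))"
      by (rule infsum_mono[OF act_summable[OF uB j] ws])
         (auto simp: norm_mult c_norm j norm_bounded intro!: mult_right_mono)
    finally have "(cmod (act a u j))\<^sup>2 \<le> (\<Sum>\<^sub>\<infinity>n. norm (coeff a n) * cmod (u (\<rho> (- n) j)))\<^sup>2"
      by (intro power_mono) auto
    also have "\<dots> \<le> norm a * g j"
      using weighted_Cauchy_Schwarz[OF summable_norm_coeff[of a] _ ws] gs[of j]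
      by (simp add: g_def G_def norm_ell1.rep_eq)
    finally show ?thesis .
  qed
  have gsum: "((\<lambda>j. norm a * g j) has_sum (norm a * ?N)\<^sup>2) J"
    using has_sum_cmult_right[OF g, of "norm a"] by (simp add: power2_eq_square mult_ac)
  have s: "(\<lambda>j. (cmod (act a u j))\<^sup>2) summable_on J"
    by (rule summable_on_comparison_test[OF has_sum_imp_summable[OF gsum]]) (auto simp: le)
  then show cl: "act a u \<in> hcarrier (ell2 J)" by (simp add: act_def)
  have "(hnorm (ell2 J) (act a u))\<^sup>2 \<le> (norm a * ?N)\<^sup>2"
    unfolding ell2_hnorm_sq[of J "act a u"]
    by (rule has_sum_mono[OF has_sum_infsum[OF s] gsum]) (rule le)
  then show "hnorm (ell2 J) (act a u) \<le> norm a * ?N"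
    by (rule power2_le_imp_le) (simp add: ell2_hnorm_eq infsum_nonneg)
qed

lemma act_star:
  assumes u: "u \<in> hcarrier (ell2 J)" and v: "v \<in> hcarrier (ell2 J)"
  shows "hinner (ell2 J) (act (ell1_star \<sigma> a) u) v = hinner (ell2 J) u (act a v)"
proof -
  define F where "F = (\<lambda>(j, n). c n j * coeff (ell1_star \<sigma> a) n (q j) * u (\<rho> (- n) j) * cnj (v j))"
  define G where "G = (\<lambda>(j, n). u j * cnj (c n j * coeff a n (q j) * v (\<rho> (- n) j)))"
  \<comment> \<open>This map is its own inverse and carries the terms of the series for the adjoint
    to those of the series for \<open>a\<close>.\<close>
  have bij: "bij_betw (\<lambda>(j, n). (\<rho> (- n) j, - n)) (J \<times> UNIV) (J \<times> UNIV)"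
    by (rule bij_betw_byWitness[where f' = "\<lambda>(j, n). (\<rho> (- n) j, - n)"])
       (auto simp: \<rho>_inverse \<rho>_closed image_subset_iff)
  have FG: "G (case p of (j, n) \<Rightarrow> (\<rho> (- n) j, - n)) = F p" if "p \<in> J \<times> UNIV" for p
    using that cnj_c \<rho>_inverse
    by (auto simp: F_def G_def coeff_ell1_star_apply[OF homeo] q_\<rho>)
  have "(\<lambda>p. (case p of (j, n) \<Rightarrow> norm (coeff a n) * (cmod (u j))\<^sup>2) +
      (case p of (j, n) \<Rightarrow> norm (coeff a n) * (cmod (v (\<rho> (- n) j)))\<^sup>2)) summable_on J \<times> UNIV"
    by (intro summable_on_add has_sum_imp_summable[OF weighted_square_has_sum[OF u, of "\<lambda>n j. j" a]]
        has_sum_imp_summable[OF weighted_square_has_sum[OF v, of "\<lambda>n. \<rho> (- n)" a]] bij_\<rho>)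
       (simp add: bij_betw_def)
  then have "(\<lambda>p. norm (G p)) summable_on J \<times> UNIV"
  proof (rule summable_on_comparison_test)
    fix p :: "'j \<times> int" assume p: "p \<in> J \<times> UNIV"
    obtain j n where jn: "p = (j, n)" "j \<in> J" using p by auto
    have "norm (G p) = cmod (coeff a n (q j)) * cmod (u j * v (\<rho> (- n) j))"
      using jn by (simp add: G_def norm_mult c_norm mult_ac)
    also have "\<dots> \<le> norm (coeff a n) * ((cmod (u j))\<^sup>2 + (cmod (v (\<rho> (- n) j)))\<^sup>2)"
      by (intro mult_mono norm_bounded cmod_mult_le_squares) auto
    finally show "norm (G p) \<le> (case p of (j, n) \<Rightarrow> norm (coeff a n) * (cmod (u j))\<^sup>2) +
      (case p of (j, n) \<Rightarrow> norm (coeff a n) * (cmod (v (\<rho> (- n) j)))\<^sup>2)"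
      using jn by (simp add: distrib_left)
  qed simp
  then have Gs: "G summable_on J \<times> UNIV" by (rule abs_summable_summable)
  have Fs: "F summable_on J \<times> UNIV"
    using iffD2[OF summable_on_reindex_bij_betw[OF bij] Gs]
    by (rule summable_on_cong[THEN iffD1, rotated]) (use FG in auto)
  have "infsum F (J \<times> UNIV) = infsum G (J \<times> UNIV)"
    unfolding infsum_reindex_bij_betw[OF bij, of G, symmetric] by (rule infsum_cong) (simp add: FG)
  moreover have "infsum F (J \<times> UNIV) = hinner (ell2 J) (act (ell1_star \<sigma> a) u) v"
  proof -
    have "infsum F (J \<times> UNIV) = (\<Sum>\<^sub>\<infinity>j\<in>J. \<Sum>\<^sub>\<infinity>n. F (j, n))"
      using infsum_Sigma'_banach[of "\<lambda>j n. F (j, n)" J "\<lambda>_. UNIV"] Fs by (simp add: case_prod_unfold)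
    also have "\<dots> = hinner (ell2 J) (act (ell1_star \<sigma> a) u) v"
      unfolding ell2_sel by (rule infsum_cong) (simp add: F_def act_def infsum_cmult_left')
    finally show ?thesis .
  qed
  moreover have "infsum G (J \<times> UNIV) = hinner (ell2 J) u (act a v)"
  proof -
    have "infsum G (J \<times> UNIV) = (\<Sum>\<^sub>\<infinity>j\<in>J. \<Sum>\<^sub>\<infinity>n. G (j, n))"
      using infsum_Sigma'_banach[of "\<lambda>j n. G (j, n)" J "\<lambda>_. UNIV"] Gs by (simp add: case_prod_unfold)
    also have "\<dots> = hinner (ell2 J) u (act a v)"
      unfolding ell2_sel
      by (rule infsum_cong) (simp add: G_def act_def infsum_cmult_right' flip: infsum_cnj)
    finally show ?thesis .
  qed
  ultimately show ?thesis by simp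
qed

lemma involutive_rep_act: "involutive_rep \<sigma> (ell2 J) act"
proof -
  let ?H = "ell2 J"
  have B: "\<forall>j\<in>J. cmod (u j) \<le> hnorm ?H u" if "u \<in> hcarrier ?H" for u by (simp add: ell2_coord_le[OF that])
  have "bounded_operator ?H (act a)" for a
    unfolding bounded_operator_def
  proof (intro conjI ballI allI)
    fix u v s assume u: "u \<in> hcarrier ?H"
    show "act a u \<in> hcarrier ?H" by (rule act_ell2_bound[OF u])
    show "act a (hscale ?H s u) = hscale ?H s (act a u)"
      unfolding ell2_sel by (rule ext) (rule act_scale_right)
    assume v: "v \<in> hcarrier ?H"
    show "act a (hadd ?H u v) = hadd ?H (act a u) (act a v)"
      unfolding ell2_sel by (rule ext) (rule act_add_right[OF B[OF u] B[OF v]])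
  next
    show "\<exists>K. \<forall>u\<in>hcarrier ?H. hnorm ?H (act a u) \<le> K * hnorm ?H u"
      using act_ell2_bound(2) by blast
  qed
  moreover have "act (a + b) u = hadd ?H (act a u) (act b u)" if "u \<in> hcarrier ?H" for a b u
    unfolding ell2_sel by (rule ext) (rule act_add_left[OF B[OF that]])
  moreover have "act (ell1_scale s a) u = hscale ?H s (act a u)" for s a u
    unfolding ell2_sel by (rule ext) (rule act_scale_left)
  moreover have "act (ell1_times \<sigma> a b) u = act a (act b u)" if "u \<in> hcarrier ?H" for a b u
    by (rule ext) (rule act_times[OF B[OF that]])
  ultimately show ?thesis
    unfolding involutive_rep_def using act_star by blast
qed

lemma act_ket: "j \<in> J \<Longrightarrow> act a (ket k) j = (\<Sum>\<^sub>\<infinity>n. if \<rho> (- n) j = k then c n j * coeff a n (q j) else 0)"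
  unfolding act_def by (auto intro!: infsum_cong simp: ket_def)

text \<open>Stated for an arbitrary \<open>\<pi>\<close> because the representations of points are
  obtained by choice. Matrix entries are continuous in \<open>a\<close> by
  \<open>contractive\<close>, so agreement on monomials determines all of them.\<close>

lemma rep_kernel_eq:
  assumes \<pi>: "involutive_rep \<sigma> (ell2 J) \<pi>"
    and single: "\<And>f m k j. k \<in> J \<Longrightarrow> j \<in> J \<Longrightarrow>
      \<pi> (ell1_single f m) (ket k) j = act (ell1_single f m) (ket k) j"
  shows "rep_kernel (ell2 J) \<pi> = {a. \<forall>j\<in>J. \<forall>k\<in>J. act a (ket k) j = 0}"
proof -
  interpret R: complex_inner_space "ell2 J" by (rule ell2_inner_space)
  interpret R: inv_rep "ell2 J" \<sigma> \<pi> by unfold_locales (rule homeo \<pi>)+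
  have eq: "\<pi> a (ket k) j = act a (ket k) j" if k: "k \<in> J" and j: "j \<in> J" for a k j
  proof -
    note kc = ket_carrier[OF k]
    have kB: "\<forall>j\<in>J. cmod (ket k j) \<le> 1" by (simp add: ket_def)
    have "bounded_linear (\<lambda>a. \<pi> a (ket k) j)"
    proof (rule bounded_linear_intro[where K = "hnorm (ell2 J) (ket k)"])
      show "\<pi> (x + y) (ket k) j = \<pi> x (ket k) j + \<pi> y (ket k) j" for x y
        using R.rep_add[OF kc, of x y] by simp
      show "\<pi> (r *\<^sub>R x) (ket k) j = r *\<^sub>R \<pi> x (ket k) j" for r x
        using R.rep_scaleR[OF kc, of r x] by (simp add: scaleR_conv_of_real)
      show "norm (\<pi> x (ket k) j) \<le> norm x * hnorm (ell2 J) (ket k)" for x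
        using ell2_coord_le[OF R.rep_closed[OF kc], of x j] R.contractive[OF kc, of x] by linarith
    qed
    moreover have "bounded_linear (\<lambda>a. act a (ket k) j)"
      by (rule bounded_linear_intro[where K = 1])
         (auto simp: act_add_left[OF kB] act_scaleR_left intro: act_bound[OF kB j, simplified])
    ultimately have "closed {a. \<pi> a (ket k) j = act a (ket k) j}"
      by (intro closed_Collect_eq linear_continuous_on)
    then have "a \<in> {a. \<pi> a (ket k) j = act a (ket k) j}"
    proof (rule ell1_closed_induct)
      show "0 \<in> {a. \<pi> a (ket k) j = act a (ket k) j}"
        using R.rep_0[OF kc] by (simp add: act_def)
    qed (use R.rep_add[OF kc] k j single in \<open>auto simp: act_add_left[OF kB]\<close>)
    then show ?thesis by simp
  qed
  \<comment> \<open>Vanishing entries only give vanishing on basis vectors. A general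
    \<open>u\<close> is reached through the adjoint: a coordinate of \<open>\<pi> a u\<close> is the
    inner product of \<open>u\<close> with an image of a basis vector under
    \<open>\<pi> (ell1_star \<sigma> a)\<close>.\<close>
  have "\<pi> a u = hzero (ell2 J)" if a: "\<And>j k. j \<in> J \<Longrightarrow> k \<in> J \<Longrightarrow> act a (ket k) j = 0"
    and u: "u \<in> hcarrier (ell2 J)" for a u
  proof -
    have 1: "\<pi> a (ket j) = hzero (ell2 J)" if "j \<in> J" for j
      using eq[OF that, of _ a] a that R.rep_closed[OF ket_carrier[OF that], of a] by (auto simp: fun_eq_iff)
    have 2: "\<pi> (ell1_star \<sigma> a) (ket k) j = 0" if "k \<in> J" "j \<in> J" for k j
      using R.rep_star[OF ket_carrier[OF that(1)] ket_carrier[OF that(2)], of a] 1[OF that(2)]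
      by (simp only: ell2_inner_ket[OF that(2)] R.inner_zero_right[OF ket_carrier[OF that(1)]])
    have 3: "\<pi> (ell1_star \<sigma> a) (ket k) = hzero (ell2 J)" if "k \<in> J" for k
      using 2[OF that] R.rep_closed[OF ket_carrier[OF that], of "ell1_star \<sigma> a"] by (auto simp: fun_eq_iff)
    have "\<pi> a u k = 0" if "k \<in> J" for k
      using R.rep_star'[OF u ket_carrier[OF that], of a]
      by (simp only: ell2_inner_ket[OF that] 3[OF that] R.inner_zero_right[OF u])
    then show ?thesis using R.rep_closed[OF u, of a] by (auto simp: fun_eq_iff)
  qed
  moreover have "act a (ket k) j = 0" if "\<And>u. u \<in> hcarrier (ell2 J) \<Longrightarrow> \<pi> a u = hzero (ell2 J)"
    "j \<in> J" "k \<in> J" for a j k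
    using that(1)[OF ket_carrier[OF that(3)]] eq[OF that(3,2), of a] by simp
  ultimately show ?thesis
    unfolding rep_kernel_def by blast
qed

end

section \<open>Vanishing ideals as kernels\<close>

text \<open>The matrix entry between \<open>(z, l)\<close> and \<open>(x, l)\<close> of the
  representation on an invariant set: at most one term for aperiodic \<open>x\<close>, a sum over a
  residue class of exponents or an empty sum for periodic \<open>x\<close>.\<close>

definition fiber_sum :: "('a::topological_space \<Rightarrow> 'a) \<Rightarrow> 'a ell1 \<Rightarrow> 'a \<Rightarrow> complex \<Rightarrow> 'a \<Rightarrow> complex" where
  "fiber_sum \<sigma> a x l z = (\<Sum>\<^sub>\<infinity>n. if int_iter \<sigma> (- n) x = z then l powi n * coeff a n x else 0)"

lemma transform_times_cf:
  assumes "homeomorphism UNIV UNIV \<sigma> (inv \<sigma>)"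
  shows "transform (ell1_times \<sigma> a (ell1_of_cf f)) (x, l) =
    (\<Sum>\<^sub>\<infinity>n. l powi n * coeff a n x * f (int_iter \<sigma> (- n) x))"
  by (simp add: transform_def ell1_of_cf_eq_single coeff_times_single_right[OF assms] mult.assoc)

text \<open>Multiplying \<open>a\<close> by \<open>f\<close> on the right weights the exponent
  \<open>n\<close> by the value of \<open>f\<close> at \<open>\<tau> n\<close>. Sorting the series
  by this point proves one direction; choosing \<open>f\<close> as a bump at \<open>z\<close>
  isolates a single fiber for the other.\<close>

lemma fiber_sum_eq_0_iff:
  fixes \<sigma> :: "'a::t2_space \<Rightarrow> 'a"
  assumes cpt: "compact (UNIV :: 'a set)" and h: "homeomorphism UNIV UNIV \<sigma> (inv \<sigma>)"
    and l: "cmod l = 1"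
  shows "(\<forall>f. transform (ell1_times \<sigma> a (ell1_of_cf f)) (x, l) = 0) \<longleftrightarrow> (\<forall>z. fiber_sum \<sigma> a x l z = 0)"
proof -
  define g where "g n = l powi n * coeff a n x" for n
  define \<tau> where "\<tau> n = int_iter \<sigma> (- n) x" for n
  have gs: "(\<lambda>n. norm (g n)) summable_on UNIV"
    using summable_norm_coeff[of a] unfolding g_def
    by (rule summable_on_comparison_test) (auto simp: norm_mult norm_power_int l norm_bounded)
  have tr: "transform (ell1_times \<sigma> a (ell1_of_cf f)) (x, l) = (\<Sum>\<^sub>\<infinity>n. g n * f (\<tau> n))" for f
    by (simp add: transform_times_cf[OF h] g_def \<tau>_def)
  have fs: "fiber_sum \<sigma> a x l z = (\<Sum>\<^sub>\<infinity>n. if \<tau> n = z then g n else 0)" for z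
    unfolding fiber_sum_def g_def \<tau>_def ..
  have hs: "(\<lambda>n. norm (g n * f (\<tau> n))) summable_on UNIV" for f :: "'a \<Rightarrow>\<^sub>C complex"
    by (rule summable_on_comparison_test[OF summable_on_cmult_left[OF gs, of "norm f"]])
       (auto simp: norm_mult norm_bounded intro!: mult_left_mono)
  show ?thesis
  proof (intro iffI allI)
    fix f :: "'a \<Rightarrow>\<^sub>C complex"
    assume fib: "\<forall>z. fiber_sum \<sigma> a x l z = 0"
    define s where "s = (\<Sum>\<^sub>\<infinity>n. g n * f (\<tau> n))"
    have "((\<lambda>n. g n * f (\<tau> n)) has_sum s) UNIV"
      unfolding s_def by (rule has_sum_infsum[OF abs_summable_summable[OF hs]])
    moreover have bij: "bij_betw (\<lambda>n. (\<tau> n, n)) UNIV (SIGMA z:UNIV. {n. \<tau> n = z})"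
      by (rule bij_betw_byWitness[where f' = snd]) auto
    ultimately have "((\<lambda>(z, n). g n * f (\<tau> n)) has_sum s) (SIGMA z:UNIV. {n. \<tau> n = z})"
      using has_sum_reindex_bij_betw[OF bij, of "\<lambda>(z, n). g n * f (\<tau> n)"] by simp
    then have "((\<lambda>z. 0) has_sum s) (UNIV :: 'a set)"
    proof (rule has_sum_SigmaD)
      fix z
      have "(\<lambda>n. norm (if \<tau> n = z then g n else 0)) summable_on UNIV"
        by (rule summable_on_comparison_test[OF gs]) auto
      from has_sum_infsum[OF abs_summable_summable[OF this]]
      have "((\<lambda>n. if \<tau> n = z then g n else 0) has_sum 0) UNIV"
        using fib by (simp add: fs)
      then have "(g has_sum 0) {n. \<tau> n = z}"
        by (rule has_sum_cong_neutral[THEN iffD1, rotated 3]) auto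
      from has_sum_cmult_left[OF this, of "f z"]
      have "((\<lambda>n. g n * f z) has_sum 0) {n. \<tau> n = z}" by simp
      then show "((\<lambda>n. case (z, n) of (z, n) \<Rightarrow> g n * f (\<tau> n)) has_sum 0) {n. \<tau> n = z}"
        by (rule has_sum_cong[THEN iffD1, rotated]) auto
    qed
    then have "s = 0" by (metis has_sum_0_simp has_sum_unique)
    then show "transform (ell1_times \<sigma> a (ell1_of_cf f)) (x, l) = 0" by (simp add: tr s_def)
  next
    fix z assume van: "\<forall>f. transform (ell1_times \<sigma> a (ell1_of_cf f)) (x, l) = 0"
    have "cmod (fiber_sum \<sigma> a x l z) \<le> 0"
    proof (rule field_le_epsilon)
      fix e :: real assume "0 < e"
      obtain F where F: "finite F"
        "dist (\<Sum>n\<in>F. norm (g n)) (\<Sum>\<^sub>\<infinity>n. norm (g n)) \<le> e"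
        using infsum_finite_approximation[OF gs \<open>0 < e\<close>] by auto
      have "(\<Sum>\<^sub>\<infinity>n\<in>F \<union> - F. norm (g n)) = (\<Sum>\<^sub>\<infinity>n\<in>F. norm (g n)) + (\<Sum>\<^sub>\<infinity>n\<in>- F. norm (g n))"
        by (rule infsum_Un_disjoint) (auto intro: summable_on_subset_banach[OF gs])
      then have tail: "(\<Sum>\<^sub>\<infinity>n\<in>- F. norm (g n)) \<le> e"
        using F by (simp add: dist_real_def)
      \<comment> \<open>The bump vanishes at the finitely many points \<open>\<tau> n\<close> with
        \<open>n \<in> F\<close> other than \<open>z\<close>, so it separates the fiber of
        \<open>z\<close> up to the tail outside \<open>F\<close>.\<close>
      have op: "open (- (\<tau> ` F - {z}))" "z \<in> - (\<tau> ` F - {z})"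
        using F(1) by (auto intro!: open_Compl finite_imp_closed simp del: Compl_Diff_eq)
      obtain f :: "'a \<Rightarrow>\<^sub>C complex" where f: "f z = 1" "\<And>y. y \<notin> - (\<tau> ` F - {z}) \<Longrightarrow> f y = 0"
        "\<And>y. cmod (f y) \<le> 1"
        using bump_bcontfun[OF cpt op] by blast
      let ?d = "\<lambda>n. (if \<tau> n = z then g n else 0) - g n * f (\<tau> n)"
      have s1: "(\<lambda>n. norm (if \<tau> n = z then g n else 0)) summable_on UNIV"
        by (rule summable_on_comparison_test[OF gs]) auto
      have "((\<lambda>n. (if \<tau> n = z then g n else 0) + (- (g n * f (\<tau> n)))) has_sum
          fiber_sum \<sigma> a x l z + (- 0)) UNIV"
        using has_sum_infsum[OF abs_summable_summable[OF hs[of f]]] van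
        unfolding fs by (intro has_sum_add has_sum_infsum[OF abs_summable_summable[OF s1]] has_sum_uminusI)
          (simp add: tr)
      then have sd: "(?d has_sum fiber_sum \<sigma> a x l z) UNIV" by simp
      have dle: "norm (?d n) \<le> norm (g n)" "n \<in> F \<Longrightarrow> ?d n = 0" for n
        using f mult_left_mono[OF f(3)[of "\<tau> n"], of "cmod (g n)"] by (auto simp: norm_mult)
      have ds: "(\<lambda>n. norm (?d n)) summable_on UNIV"
        by (rule summable_on_comparison_test[OF gs]) (auto simp only: dle norm_ge_zero)
      have "cmod (fiber_sum \<sigma> a x l z) \<le> (\<Sum>\<^sub>\<infinity>n. norm (?d n))"
        using norm_infsum_bound[OF ds] infsumI[OF sd] by simp
      also have "\<dots> \<le> (\<Sum>\<^sub>\<infinity>n\<in>- F. norm (g n))"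
        by (rule infsum_mono_neutral[OF ds summable_on_subset_banach[OF gs]]) (use dle in auto)
      finally show "cmod (fiber_sum \<sigma> a x l z) \<le> 0 + e" using tail by simp
    qed
    then show "fiber_sum \<sigma> a x l z = 0" by simp
  qed
qed

lemma mem_vanishing_ideal_iff:
  fixes \<sigma> :: "'a::t2_space \<Rightarrow> 'a"
  assumes "compact (UNIV :: 'a set)" "homeomorphism UNIV UNIV \<sigma> (inv \<sigma>)"
    and S: "S \<subseteq> UNIV \<times> sphere 0 1"
  shows "a \<in> vanishing_ideal \<sigma> S \<longleftrightarrow> (\<forall>x l. (x, l) \<in> S \<longrightarrow> (\<forall>z. fiber_sum \<sigma> a x l z = 0))"
proof -
  have "(\<forall>f. transform (ell1_times \<sigma> a (ell1_of_cf f)) (x, l) = 0) \<longleftrightarrow> (\<forall>z. fiber_sum \<sigma> a x l z = 0)"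
    if "(x, l) \<in> S" for x l
    using fiber_sum_eq_0_iff[OF assms(1,2), of l a x] S that by fastforce
  then show ?thesis unfolding vanishing_ideal_def by fastforce
qed

lemma invariant_set_int_iter:
  assumes "bij \<sigma>" "map_prod \<sigma> id ` S = S" "(x, l) \<in> S"
  shows "(int_iter \<sigma> n x, l) \<in> S"
proof (induction n rule: int_induct[where k = 0])
  case (step1 i)
  then have "map_prod \<sigma> id (int_iter \<sigma> i x, l) \<in> S" using assms(2) by blast
  then show ?case by (simp add: int_iter_plus_1[OF assms(1)])
next
  case (step2 i)
  then have "(int_iter \<sigma> i x, l) \<in> map_prod \<sigma> id ` S" by (simp add: assms(2))
  then obtain y where y: "(y, l) \<in> S" "int_iter \<sigma> i x = \<sigma> y" by (auto elim!: imageE)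
  have "\<sigma> (int_iter \<sigma> (i - 1) x) = \<sigma> y"
    using y(2) int_iter_plus_1[OF assms(1), of "i - 1" x] by simp
  then have "int_iter \<sigma> (i - 1) x = y" using assms(1) by (meson bij_is_inj injD)
  then show ?case using y(1) by simp
qed (use assms in simp)

text \<open>The dummy component \<open>0\<close> only makes the index type the one provided in \<open>invrep_kernels\<close>.\<close>

definition slots :: "('a \<times> complex) set \<Rightarrow> ('a \<times> int \<times> complex) set" where
  "slots S = (\<lambda>(x, l). (x, 0, l)) ` S"

lemma slots_iff [simp]: "(x, i, l) \<in> slots S \<longleftrightarrow> i = 0 \<and> (x, l) \<in> S"
  by (auto simp: slots_def)

lemma orbit_action_slots:
  fixes \<sigma> :: "'a::topological_space \<Rightarrow> 'a"
  assumes h: "homeomorphism UNIV UNIV \<sigma> (inv \<sigma>)" and S: "S \<subseteq> UNIV \<times> sphere 0 1"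
    and inv: "map_prod \<sigma> id ` S = S"
  shows "orbit_action \<sigma> (slots S) (\<lambda>n p. (int_iter \<sigma> n (fst p), snd p)) fst (\<lambda>n p. snd (snd p) powi n)"
proof -
  have b: "bij \<sigma>" by (rule homeomorphism_imp[OF h])
  have l: "cmod l = 1" if "(x, l) \<in> S" for x l using S that by auto
  have "l \<noteq> 0" if "(x, l) \<in> S" for x l using l[OF that] by auto
  then show ?thesis
    by unfold_locales
       (auto simp: h int_iter_add[OF b] norm_power_int power_int_add invariant_set_int_iter[OF b inv] l)
qed

lemma vanishing_ideal_eq_kernel:
  fixes \<sigma> :: "'a::t2_space \<Rightarrow> 'a"
  assumes cpt: "compact (UNIV :: 'a set)" and h: "homeomorphism UNIV UNIV \<sigma> (inv \<sigma>)"
    and S: "S \<subseteq> UNIV \<times> sphere 0 1" and inv: "map_prod \<sigma> id ` S = S"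
  obtains \<pi> where "involutive_rep \<sigma> (ell2 (slots S)) \<pi>"
    "vanishing_ideal \<sigma> S = rep_kernel (ell2 (slots S)) \<pi>"
proof -
  interpret orbit_action \<sigma> "slots S" "\<lambda>n p. (int_iter \<sigma> n (fst p), snd p)" fst "\<lambda>n p. snd (snd p) powi n"
    by (rule orbit_action_slots[OF h S inv])
  have b: "bij \<sigma>" by (rule homeomorphism_imp[OF h])
  have ket: "act a (ket (z, 0, m)) (x, 0, l) = (if m = l then fiber_sum \<sigma> a x l z else 0)"
    if "(x, l) \<in> S" for a z m x l
    using that by (auto simp: act_ket fiber_sum_def intro!: infsum_cong infsum_0)
  have "a \<in> vanishing_ideal \<sigma> S \<longleftrightarrow> (\<forall>j\<in>slots S. \<forall>k\<in>slots S. act a (ket k) j = 0)" for a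
  proof -
    \<comment> \<open>By invariance such a \<open>z\<close> is off the orbit of \<open>x\<close> and
      its fiber is empty; hence entries indexed by \<open>slots S\<close> account for all
      \<open>z\<close>.\<close>
    have "fiber_sum \<sigma> a x l z = 0" if "(x, l) \<in> S" "(z, l) \<notin> S" for x l z
    proof -
      have "int_iter \<sigma> (- n) x \<noteq> z" for n
        using invariant_set_int_iter[OF b inv that(1), of "- n"] that(2) by auto
      then show ?thesis by (simp add: fiber_sum_def)
    qed
    then show ?thesis
      unfolding mem_vanishing_ideal_iff[OF cpt h S] using ket by (fastforce simp: slots_def)
  qed
  then have "vanishing_ideal \<sigma> S = rep_kernel (ell2 (slots S)) act"
    by (subst rep_kernel_eq[OF involutive_rep_act]) auto
  with involutive_rep_act show thesis by (rule that)
qed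

section \<open>Transport of Hilbert spaces into the carrier type of
  \<open>invrep_kernels\<close>\<close>

definition inr_space :: "'b cspace \<Rightarrow> ('h + 'b) cspace" where
  "inr_space H = \<lparr>hcarrier = Inr ` hcarrier H, hzero = Inr (hzero H),
     hadd = (\<lambda>u v. Inr (hadd H (projr u) (projr v))), hscale = (\<lambda>c u. Inr (hscale H c (projr u))),
     hinner = (\<lambda>u v. hinner H (projr u) (projr v))\<rparr>"

lemma inr_space_sel [simp]:
  "hcarrier (inr_space H) = Inr ` hcarrier H" "hzero (inr_space H) = Inr (hzero H)"
  "hadd (inr_space H) u v = Inr (hadd H (projr u) (projr v))"
  "hscale (inr_space H) c u = Inr (hscale H c (projr u))"
  "hinner (inr_space H) u v = hinner H (projr u) (projr v)"
  by (simp_all add: inr_space_def)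

lemma inr_space_hnorm [simp]: "hnorm (inr_space H) u = hnorm H (projr u)"
  by (simp add: hnorm_def)

lemma inr_space_hdist [simp]: "hdist (inr_space H) u v = hdist H (projr u) (projr v)"
  by (simp add: hdist_def)

lemma inr_space_hilbert:
  assumes H: "complex_hilbert_space H" and M: "Metric_space (hcarrier H) (hdist H)"
  shows "complex_hilbert_space (inr_space H :: ('h + 'b) cspace)"
proof -
  interpret H: complex_hilbert_space H by (rule H)
  interpret M: Metric_space "hcarrier H" "hdist H" by (rule M)
  interpret M': Metric_space "hcarrier (inr_space H :: ('h + 'b) cspace)" "hdist (inr_space H)"
    by unfold_locales (use M.commute M.triangle in auto)
  have "\<exists>x. limitin M'.mtopology X x sequentially" if X: "M'.MCauchy X" for X
  proof -
    note XM = X[unfolded M'.MCauchy_def]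
    have Xc: "X i \<in> Inr ` hcarrier H" for i
      using subsetD[OF conjunct1[OF XM], of "X i"] by simp
    then have Xc': "projr (X i) \<in> hcarrier H" for i by (metis imageE sum.sel(2))
    have "M.MCauchy (\<lambda>i. projr (X i))"
      unfolding M.MCauchy_def using conjunct2[OF XM] Xc' by auto
    then obtain x where "limitin M.mtopology (\<lambda>i. projr (X i)) x sequentially"
      using H.complete unfolding M.mcomplete_def by blast
    then have "limitin M'.mtopology X (Inr x) sequentially"
      using Xc unfolding M.limitin_metric M'.limitin_metric by (simp add: eventually_conj_iff)
    then show ?thesis ..
  qed
  then have complete: "M'.mcomplete" by (simp only: M'.mcomplete_def) blast
  show ?thesis
  proof (rule complex_hilbert_space.intro, goal_cases)
    case (5 u v)
    then obtain u' v' where "u = Inr u'" "v = Inr v'" "u' \<in> hcarrier H" "v' \<in> hcarrier H" by auto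
    then show ?case using H.add_commute[of u' v'] by simp
  next
    case (14 u v)
    then obtain u' v' where "u = Inr u'" "v = Inr v'" "u' \<in> hcarrier H" "v' \<in> hcarrier H" by auto
    then show ?case using H.inner_commute[of u' v'] by simp
  next
    case 17
    show ?case by (rule complete)
  qed (auto simp: H.zero_closed H.add_closed H.scale_closed H.add_assoc H.add_zero H.add_inverse
      H.scale_add_right H.scale_add_left H.scale_scale H.scale_one H.inner_add_left
      H.inner_scale_left H.inner_nonneg H.inner_definite)
qed

lemma inr_space_involutive_rep:
  assumes "involutive_rep \<sigma> H \<pi>"
  shows "involutive_rep \<sigma> (inr_space H :: ('h + 'b) cspace) (\<lambda>a u. Inr (\<pi> a (projr u)))"
    "rep_kernel (inr_space H :: ('h + 'b) cspace) (\<lambda>a u. Inr (\<pi> a (projr u))) = rep_kernel H \<pi>"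
  using assms by (auto simp: involutive_rep_def bounded_operator_def rep_kernel_def)

lemma vanishing_ideal_in_invrep_kernels:
  fixes \<sigma> :: "'a::t2_space \<Rightarrow> 'a"
  assumes "compact (UNIV :: 'a set)" "homeomorphism UNIV UNIV \<sigma> (inv \<sigma>)"
    "S \<subseteq> UNIV \<times> sphere 0 1" "map_prod \<sigma> id ` S = S"
  shows "vanishing_ideal \<sigma> S \<in> invrep_kernels TYPE('h) \<sigma>"
proof -
  obtain \<pi> where \<pi>: "involutive_rep \<sigma> (ell2 (slots S)) \<pi>"
    "vanishing_ideal \<sigma> S = rep_kernel (ell2 (slots S)) \<pi>"
    by (rule vanishing_ideal_eq_kernel[OF assms])
  let ?H = "inr_space (ell2 (slots S)) :: ('h + ('a \<times> int \<times> complex \<Rightarrow> complex)) cspace"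
  have "complex_hilbert_space ?H"
    by (rule inr_space_hilbert[OF ell2_hilbert_space ell2_Metric_space])
  then show ?thesis
    unfolding invrep_kernels_def \<pi>(2)
    using inr_space_involutive_rep[OF \<pi>(1), where 'h = 'h] by blast
qed

section \<open>Kernels as closed self-adjoint ideals\<close>

lemma (in inv_rep) closed_annihilator:
  assumes u: "u \<in> hcarrier H"
  shows "closed {a. \<pi> a u = hzero H}"
proof (unfold closed_sequential_limits, intro allI impI)
  fix X :: "nat \<Rightarrow> 'a ell1" and a
  assume X: "(\<forall>n. X n \<in> {a. \<pi> a u = hzero H}) \<and> X \<longlonglongrightarrow> a"
  have "hnorm H (\<pi> a u) \<le> norm (X n - a) * hnorm H u" for n
  proof -
    have "\<pi> (a - X n) u = \<pi> a u"
      using X u by (simp add: rep_diff scale_of_zero add_zero)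
    then show ?thesis using contractive[OF u, of "a - X n"] by (simp add: norm_minus_commute)
  qed
  moreover have "(\<lambda>n. norm (X n - a) * hnorm H u) \<longlonglongrightarrow> 0"
    using X by (auto intro!: tendsto_eq_intros simp: LIM_zero tendsto_norm_zero)
  ultimately have "hnorm H (\<pi> a u) \<le> 0"
    by (intro LIMSEQ_le_const[of "\<lambda>n. norm (X n - a) * hnorm H u"]) auto
  then have "hnorm H (\<pi> a u) = 0" using hnorm_nonneg[OF rep_closed[OF u], of a] by simp
  then show "a \<in> {a. \<pi> a u = hzero H}" using u by (simp add: hnorm_eq_0_iff)
qed

lemma (in inv_rep) rep_kernel_closed_ideal: "rep_kernel H \<pi> \<in> closed_ideals \<sigma>"
proof -
  have "rep_kernel H \<pi> = (\<Inter>u\<in>hcarrier H. {a. \<pi> a u = hzero H})"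
    by (auto simp: rep_kernel_def)
  then have "closed (rep_kernel H \<pi>)"
    using closed_annihilator by (simp only:) (intro closed_INT ballI)
  then show ?thesis
    unfolding closed_ideals_def
    by (auto simp: rep_kernel_def rep_0 rep_add rep_scale rep_times scale_of_zero add_zero rep_hzero closed)
qed

lemma (in inv_rep) rep_kernel_star: "a \<in> rep_kernel H \<pi> \<Longrightarrow> ell1_star \<sigma> a \<in> rep_kernel H \<pi>"
  unfolding rep_kernel_def
  by (auto intro!: eqI_inner simp: rep_star inner_zero_left inner_zero_right closed)

lemma invrep_kernelsE:
  fixes \<sigma> :: "'a::topological_space \<Rightarrow> 'a"
  assumes "homeomorphism UNIV UNIV \<sigma> (inv \<sigma>)" "K \<in> invrep_kernels TYPE('h) \<sigma>"
  obtains H :: "('h + ('a \<times> int \<times> complex \<Rightarrow> complex)) cspace" and \<pi>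
  where "inv_rep H \<sigma> \<pi>" "K = rep_kernel H \<pi>"
proof -
  obtain H :: "('h + ('a \<times> int \<times> complex \<Rightarrow> complex)) cspace" and \<pi>
    where H: "complex_hilbert_space H" "involutive_rep \<sigma> H \<pi>" "K = rep_kernel H \<pi>"
    using assms(2) unfolding invrep_kernels_def by blast
  interpret complex_inner_space H by (rule complex_hilbert_imp_inner_space[OF H(1)])
  have "inv_rep H \<sigma> \<pi>" by unfold_locales (rule assms(1) H(2))+
  then show thesis using H(3) by (rule that)
qed

section \<open>Zero sets\<close>

text \<open>Conjugation by a power of \<open>delta\<close> stays in the ideal and shifts the
  coefficients along the orbit.\<close>

lemma zero_set_int_iter:
  assumes h: "homeomorphism UNIV UNIV \<sigma> (inv \<sigma>)" and I: "I \<in> closed_ideals \<sigma>"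
    and xl: "(x, l) \<in> zero_set I"
  shows "(int_iter \<sigma> m x, l) \<in> zero_set I"
proof -
  note b = homeomorphism_imp(1)[OF h]
  have l: "cmod l = 1" using xl by (auto simp: zero_set_def)
  have "transform a (int_iter \<sigma> m x, l) = 0" if a: "a \<in> I" for a
  proof -
    let ?b = "ell1_times \<sigma> (ell1_single (const_bcontfun 1) (- m)) (ell1_times \<sigma> a (ell1_single (const_bcontfun 1) m))"
    have "coeff ?b n x = coeff a n (int_iter \<sigma> m x)" for n
      by (simp add: coeff_times_single_left[OF h] coeff_times_single_right[OF h] const_bcontfun.rep_eq)
    then have "transform ?b (x, l) = transform a (int_iter \<sigma> m x, l)"
      by (simp add: transform_def)
    moreover have "?b \<in> I" using I a by (auto simp: closed_ideals_def)
    ultimately show ?thesis using xl by (auto simp: zero_set_def)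
  qed
  then show ?thesis using l by (auto simp: zero_set_def)
qed

lemma zero_set_subset: "zero_set I \<subseteq> UNIV \<times> sphere 0 1"
  by (auto simp: zero_set_def)

lemma zero_set_invariant:
  assumes h: "homeomorphism UNIV UNIV \<sigma> (inv \<sigma>)" and I: "I \<in> closed_ideals \<sigma>"
  shows "map_prod \<sigma> id ` zero_set I = zero_set I"
proof -
  note b = homeomorphism_imp(1)[OF h]
  have 1: "int_iter \<sigma> 1 x = \<sigma> x" for x using int_iter_plus_1[OF b, of 0 x] by simp
  have "map_prod \<sigma> id z \<in> zero_set I" if "z \<in> zero_set I" for z
    using zero_set_int_iter[OF h I, of "fst z" "snd z" 1] that by (simp add: 1 map_prod_def split_def)
  moreover have "z \<in> map_prod \<sigma> id ` zero_set I" if "z \<in> zero_set I" for z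
  proof -
    have "(int_iter \<sigma> (- 1) (fst z), snd z) \<in> zero_set I"
      using zero_set_int_iter[OF h I, of "fst z" "snd z" "- 1"] that by simp
    moreover have "z = map_prod \<sigma> id (int_iter \<sigma> (- 1) (fst z), snd z)"
      using int_iter_minus_cancel(2)[OF b, of 1 "fst z"] by (simp add: 1)
    ultimately show ?thesis by blast
  qed
  ultimately show ?thesis by (intro subset_antisym image_subsetI subsetI)
qed

text \<open>Both properties are inherited from kernels; the one-sided definition of the vanishing
  ideal does not display them.\<close>

lemma vanishing_ideal_closed_ideal:
  fixes \<sigma> :: "'a::t2_space \<Rightarrow> 'a"
  assumes "compact (UNIV :: 'a set)" "homeomorphism UNIV UNIV \<sigma> (inv \<sigma>)"
    "S \<subseteq> UNIV \<times> sphere 0 1" "map_prod \<sigma> id ` S = S"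
  shows "vanishing_ideal \<sigma> S \<in> closed_ideals \<sigma>"
    "a \<in> vanishing_ideal \<sigma> S \<Longrightarrow> ell1_star \<sigma> a \<in> vanishing_ideal \<sigma> S"
proof -
  obtain \<pi> where \<pi>: "involutive_rep \<sigma> (ell2 (slots S)) \<pi>"
    "vanishing_ideal \<sigma> S = rep_kernel (ell2 (slots S)) \<pi>"
    by (rule vanishing_ideal_eq_kernel[OF assms])
  interpret complex_inner_space "ell2 (slots S)" by (rule ell2_inner_space)
  interpret inv_rep "ell2 (slots S)" \<sigma> \<pi> by unfold_locales (rule assms(2) \<pi>(1))+
  show "vanishing_ideal \<sigma> S \<in> closed_ideals \<sigma>"
    "a \<in> vanishing_ideal \<sigma> S \<Longrightarrow> ell1_star \<sigma> a \<in> vanishing_ideal \<sigma> S"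
    unfolding \<pi>(2) by (rule rep_kernel_closed_ideal) (rule rep_kernel_star)
qed

section \<open>The algebra of the trivial system\<close>

text \<open>For the trivial system the transform is evaluation at characters of a commutative
  algebra, and so a homomorphism.\<close>

lemma transform_times_id:
  assumes "cmod l = 1"
  shows "transform (ell1_times id a b) (x, l) = transform a (x, l) * transform b (x, l)"
proof -
  define F where "F k m = (l powi k * coeff a k x) * (l powi m * coeff b m x)" for k m
  have l0: "l \<noteq> 0" using assms by auto
  have "norm (F k m) \<le> norm (coeff a k) * norm (coeff b m)" for k m
    by (auto simp: F_def norm_mult norm_power_int assms norm_bounded intro!: mult_mono)
  note conv = infsum_convolution[of F, OF this summable_norm_coeff summable_norm_coeff]
  have "l powi n * coeff (ell1_times id a b) n x = (\<Sum>\<^sub>\<infinity>k. F k (n - k))" for n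
  proof -
    have "((\<lambda>k. l powi n * (coeff a k x * coeff b (n - k) (int_iter id (- k) x))) has_sum
        l powi n * coeff (ell1_times id a b) n x) UNIV"
      by (intro has_sum_cmult_right coeff_times_has_sum homeomorphism_id)
    moreover have "l powi n * (coeff a k x * coeff b (n - k) (int_iter id (- k) x)) = F k (n - k)" for k
      using l0 power_int_add[of l k "n - k"] by (simp add: F_def)
    ultimately show ?thesis by (simp add: infsumI)
  qed
  then have "transform (ell1_times id a b) (x, l) = (\<Sum>\<^sub>\<infinity>k. \<Sum>\<^sub>\<infinity>m. F k m)"
    using conv(1) by (simp add: transform_def)
  also have "\<dots> = transform a (x, l) * transform b (x, l)"
    by (simp add: F_def transform_def infsum_cmult_right' infsum_cmult_left')
  finally show ?thesis .
qed

lemma transform_star_id: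
  assumes "cmod l = 1"
  shows "transform (ell1_star id a) (x, l) = cnj (transform a (x, l))"
proof -
  have "l powi n = cnj (l powi (- n))" for n
  proof -
    have "l * cnj l = 1" using assms complex_norm_square[of l] by simp
    then have "cnj l = inverse l" by (metis inverse_unique)
    then show ?thesis by (simp add: power_int_minus power_int_inverse)
  qed
  then have "transform (ell1_star id a) (x, l) = cnj (\<Sum>\<^sub>\<infinity>n. l powi (- n) * coeff a (- n) x)"
    by (simp add: transform_def coeff_ell1_star_apply[OF homeomorphism_id] flip: infsum_cnj)
  also have "(\<Sum>\<^sub>\<infinity>n. l powi (- n) * coeff a (- n) x) = transform a (x, l)"
    unfolding transform_def prod.case
    by (rule infsum_reindex_bij_betw[of uminus UNIV UNIV "\<lambda>n. l powi n * coeff a n x"])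
       (rule bij_betw_byWitness[where f' = uminus], auto)
  finally show ?thesis .
qed

text \<open>If the relevant points of \<open>U\<close> are fixed by \<open>p\<close> iterations,
  these are elements on which the product of the system and the product \<open>ell1_times id\<close>
  act alike; see \<open>rep_times_id\<close>.\<close>

definition subordinate :: "nat \<Rightarrow> 'a set \<Rightarrow> 'a::topological_space ell1 set" where
  "subordinate p U = {b. \<forall>n y. (\<not> int p dvd n \<or> y \<notin> U) \<longrightarrow> coeff b n y = 0}"

lemma subordinate_times:
  assumes "a \<in> subordinate p U" "b \<in> subordinate p U"
  shows "ell1_times id a b \<in> subordinate p U"
proof -
  have "coeff (ell1_times id a b) n y = 0" if "\<not> int p dvd n \<or> y \<notin> U" for n y
  proof (rule has_sum_unique[OF coeff_times_has_sum[OF homeomorphism_id]])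
    have "coeff a k y * coeff b (n - k) (int_iter id (- k) y) = 0" for k
      using assms that dvd_add_right_iff[of "int p" k "n - k"] by (auto simp: subordinate_def)
    then show "((\<lambda>k. coeff a k y * coeff b (n - k) (int_iter id (- k) y)) has_sum 0) UNIV"
      by (simp only: has_sum_0_simp)
  qed
  then show ?thesis by (simp add: subordinate_def)
qed

lemma subordinate_star: "a \<in> subordinate p U \<Longrightarrow> ell1_star id a \<in> subordinate p U"
  by (simp add: subordinate_def coeff_ell1_star_apply[OF homeomorphism_id])

lemma subordinate_linear:
  "a \<in> subordinate p U \<Longrightarrow> b \<in> subordinate p U \<Longrightarrow> a + b \<in> subordinate p U"
  "a \<in> subordinate p U \<Longrightarrow> b \<in> subordinate p U \<Longrightarrow> a - b \<in> subordinate p U"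
  "a \<in> subordinate p U \<Longrightarrow> r *\<^sub>R a \<in> subordinate p U"
  "0 \<in> subordinate p U"
  by (simp_all add: subordinate_def)

text \<open>Keeps track of the exponents of repeated squares, so that their coefficients can be
  counted.\<close>

lemma coeff_times_range:
  assumes "\<And>n. R < \<bar>n\<bar> \<Longrightarrow> coeff a n = 0" "\<And>n. R' < \<bar>n\<bar> \<Longrightarrow> coeff b n = 0" "R + R' < \<bar>n\<bar>"
  shows "coeff (ell1_times id a b) n = 0"
proof (rule bcontfun_eqI)
  fix y
  have "coeff a k y * coeff b (n - k) (int_iter id (- k) y) = 0" for k
    using assms(1)[of k] assms(2)[of "n - k"] assms(3) by (cases "R < \<bar>k\<bar>") auto
  then have "((\<lambda>k. coeff a k y * coeff b (n - k) (int_iter id (- k) y)) has_sum 0) UNIV"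
    by (simp only: has_sum_0_simp)
  from has_sum_unique[OF coeff_times_has_sum[OF homeomorphism_id] this]
  show "coeff (ell1_times id a b) n y = apply_bcontfun 0 y" by simp
qed

text \<open>If \<open>t = 1 + d\<close> with \<open>d > 0\<close>, Bernoulli's inequality for
  \<open>m = 2 ^ k\<close>, once squared, makes the power of exponent \<open>2 * m\<close> grow
  quadratically in \<open>m\<close>, against a linear bound.\<close>

lemma le_1_if_powers_grow_linearly:
  fixes t C :: real
  assumes "0 \<le> t" and le: "\<And>k. t ^ (2 ^ k) \<le> 2 ^ k * C + 1"
  shows "t \<le> 1"
proof (rule ccontr)
  assume "\<not> t \<le> 1"
  define d where "d = t - 1"
  have d: "0 < d" "t = 1 + d" using \<open>\<not> t \<le> 1\<close> by (auto simp: d_def)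
  have "real m * d\<^sup>2 \<le> 2 * C" if m: "m = 2 ^ k" for m k
  proof -
    have "0 < real m" using m by simp
    have "1 + real m * d \<le> t ^ m" using Bernoulli_inequality[of d m] d by simp
    then have "(1 + real m * d)\<^sup>2 \<le> (t ^ m)\<^sup>2" using d by (intro power_mono) auto
    also have "\<dots> \<le> 2 * real m * C + 1"
      using le[of "Suc k"] m by (simp add: power_mult[symmetric] mult.commute)
    finally have "real m * (2 * d + real m * d\<^sup>2) \<le> real m * (2 * C)"
      by (simp add: power2_eq_square algebra_simps)
    then have "2 * d + real m * d\<^sup>2 \<le> 2 * C" using \<open>0 < real m\<close> by (rule mult_left_le_imp_le)
    then show ?thesis using d by simp
  qed
  then have bd: "2 ^ k * d\<^sup>2 \<le> 2 * C" for k by fastforce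
  obtain k :: nat where "2 * C / d\<^sup>2 < real k" using reals_Archimedean2 by blast
  then have "2 * C < real k * d\<^sup>2" using d by (simp add: field_simps)
  also have "\<dots> \<le> 2 ^ k * d\<^sup>2"
    using of_nat_less_two_power[of k, where 'a = real] by (intro mult_right_mono) auto
  finally show False using bd[of k] by simp
qed

section \<open>The action of functions, and vectors supported on invariant sets\<close>

locale inv_rep_compact = inv_rep H \<sigma> \<pi>
  for H :: "'h cspace" and \<sigma> :: "'a::t2_space \<Rightarrow> 'a" and \<pi> :: "'a ell1 \<Rightarrow> 'h \<Rightarrow> 'h" +
  assumes cpt: "compact (UNIV :: 'a set)"
begin

lemmas bij_\<sigma> = homeomorphism_imp(1)[OF homeo]

abbreviation mult_op :: "('a \<Rightarrow>\<^sub>C complex) \<Rightarrow> 'h \<Rightarrow> 'h" where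
  "mult_op f \<equiv> \<pi> (ell1_single f 0)"

lemma times_single_0:
  "ell1_times \<sigma> (ell1_single f 0) (ell1_single g 0) = ell1_single (cf_times f g) 0"
  by (intro ell1_eqI bcontfun_eqI) (simp add: coeff_times_single_left[OF homeo])

lemma mult_op_times: "u \<in> hcarrier H \<Longrightarrow> mult_op (cf_times f g) u = mult_op f (mult_op g u)"
  by (simp add: rep_times[symmetric] times_single_0)

lemma cf_times_commute: "cf_times f g = cf_times g f"
  by (rule bcontfun_eqI) simp

lemma mult_op_diff:
  "u \<in> hcarrier H \<Longrightarrow> mult_op (f - g) u = hadd H (mult_op f u) (hscale H (- 1) (mult_op g u))"
proof -
  assume u: "u \<in> hcarrier H"
  have "ell1_single (f - g) 0 = ell1_single f 0 - ell1_single g 0"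
    by (intro ell1_eqI) simp
  then show ?thesis using u by (simp add: rep_diff)
qed

text \<open>The functions that kill \<open>r\<close> form an ideal of C(X), and membership of
  \<open>f\<close> is decided by zero sets. This is \<open>localization\<close> with the functions
  as their own symbols and \<open>Q\<close> the nonnegative killing functions; \<open>e\<close> is
  replaced by its squared modulus to enter \<open>Q\<close>.\<close>

lemma mult_op_vanish:
  fixes f :: "'a \<Rightarrow>\<^sub>C complex"
  assumes r: "r \<in> hcarrier H"
    and hull: "\<And>z. f z \<noteq> 0 \<Longrightarrow> \<exists>e :: 'a \<Rightarrow>\<^sub>C complex. mult_op e r = hzero H \<and> e z \<noteq> 0"
  shows "mult_op f r = hzero H"
proof -
  let ?Q = "{q. \<exists>e :: 'a \<Rightarrow>\<^sub>C complex. mult_op e r = hzero H \<and> (\<forall>z. e z = complex_of_real (q z) \<and> 0 \<le> q z)}"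
  have "hnorm H (mult_op f r) \<le> 0"
  proof (rule localization[where \<Omega> = UNIV and A = UNIV and F = apply_bcontfun and Q = ?Q
        and s = "\<lambda>f. hnorm H (mult_op f r)" and C = "hnorm H r"])
    show "compact (UNIV :: 'a set)" by (rule cpt)
    show "continuous_on UNIV (apply_bcontfun b)" for b :: "'a \<Rightarrow>\<^sub>C complex" by simp
    show "hnorm H (mult_op b r) \<le> hnorm H r * M"
      if "\<And>z. z \<in> UNIV \<Longrightarrow> cmod (b z) \<le> M" for b :: "'a \<Rightarrow>\<^sub>C complex" and M
    proof -
      have "norm b \<le> M" using that by (intro norm_bound) auto
      then show ?thesis
        using contractive[OF r, of "ell1_single b 0"] mult_right_mono[of "norm b" M "hnorm H r"] r
        by (simp add: mult.commute)
    qed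
    show "0 \<le> hnorm H r" using r by simp
    show "continuous_on UNIV q" if "q \<in> ?Q" for q
    proof -
      from that obtain e :: "'a \<Rightarrow>\<^sub>C complex" where "\<forall>z. e z = complex_of_real (q z)" by blast
      then have "q = (\<lambda>z. Re (e z))" by auto
      then show ?thesis by (simp add: continuous_intros)
    qed
    show "0 \<le> q z" if "q \<in> ?Q" for q z using that by blast
    show "(\<lambda>_. 0) \<in> ?Q"
    proof -
      have "ell1_single (0 :: 'a \<Rightarrow>\<^sub>C complex) 0 = 0" by (rule ell1_eqI) simp
      then have "mult_op 0 r = hzero H" using r by (simp add: rep_0)
      then show ?thesis by (auto intro!: exI[of _ 0])
    qed
    show "(\<lambda>z. q z + q' z) \<in> ?Q" if "q \<in> ?Q" "q' \<in> ?Q" for q q'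
    proof -
      from that obtain e e' :: "'a \<Rightarrow>\<^sub>C complex" where e: "mult_op e r = hzero H" "\<forall>z. e z = complex_of_real (q z) \<and> 0 \<le> q z"
        "mult_op e' r = hzero H" "\<forall>z. e' z = complex_of_real (q' z) \<and> 0 \<le> q' z" by blast
      have "ell1_single (e + e') 0 = ell1_single e 0 + ell1_single e' 0" by (rule ell1_eqI) simp
      then have "mult_op (e + e') r = hzero H" using e r by (simp add: rep_add add_zero closed)
      then show ?thesis using e by (auto intro!: exI[of _ "e + e'"])
    qed
    show "(\<lambda>z. t * q z) \<in> ?Q" if "q \<in> ?Q" "0 \<le> t" for q t
    proof -
      from that obtain e :: "'a \<Rightarrow>\<^sub>C complex" where e: "mult_op e r = hzero H" "\<forall>z. e z = complex_of_real (q z) \<and> 0 \<le> q z" by blast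
      have "ell1_single (t *\<^sub>R e) 0 = t *\<^sub>R ell1_single e 0" by (rule ell1_eqI) simp
      then have "mult_op (t *\<^sub>R e) r = hzero H" using e r by (simp add: rep_scaleR scale_of_zero)
      then show ?thesis using e that(2) by (auto intro!: exI[of _ "t *\<^sub>R e"] simp: scaleR_conv_of_real)
    qed
    show "\<exists>b'\<in>UNIV. (\<forall>z\<in>UNIV. apply_bcontfun b' z = (1 - complex_of_real (q z)) * b z) \<and>
        hnorm H (mult_op b' r) = hnorm H (mult_op b r)" if "q \<in> ?Q" for q and b :: "'a \<Rightarrow>\<^sub>C complex"
    proof -
      from that obtain e :: "'a \<Rightarrow>\<^sub>C complex" where e: "mult_op e r = hzero H" "\<forall>z. e z = complex_of_real (q z) \<and> 0 \<le> q z" by blast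
      have "mult_op (cf_times e b) r = hzero H"
        using r e by (simp add: cf_times_commute[of e] mult_op_times rep_hzero)
      then have "mult_op (b - cf_times e b) r = mult_op b r"
        using r by (simp add: mult_op_diff scale_of_zero add_zero)
      then show ?thesis using e by (intro bexI[of _ "b - cf_times e b"]) (auto simp: algebra_simps)
    qed
    show "\<exists>q\<in>?Q. q z \<noteq> 0" if z: "f z \<noteq> 0" for z
    proof -
      obtain e :: "'a \<Rightarrow>\<^sub>C complex" where e: "mult_op e r = hzero H" "e z \<noteq> 0" using hull z by blast
      have "mult_op (cf_times (cf_cnj e) e) r = hzero H"
        using e r by (simp add: mult_op_times rep_hzero)
      moreover have "cf_times (cf_cnj e) e z = complex_of_real ((cmod (e z))\<^sup>2)" for z
        by (simp add: complex_norm_square mult.commute del: of_real_power)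
      ultimately have "(\<lambda>z. (cmod (e z))\<^sup>2) \<in> ?Q" by (intro CollectI exI[of _ "cf_times (cf_cnj e) e"]) auto
      with e(2) show ?thesis by (intro bexI[of _ "\<lambda>z. (cmod (e z))\<^sup>2"]) auto
    qed
  qed auto
  then have "hnorm H (mult_op f r) = 0"
    using hnorm_nonneg[OF rep_closed[OF r], of "ell1_single f 0"] by linarith
  then show ?thesis using r by (simp add: hnorm_eq_0_iff)
qed

text \<open>For closed \<open>E\<close> this says that the spectral measure of \<open>u\<close>
  under the action of functions lives on \<open>E\<close>, expressed without measures.\<close>

definition supported :: "'h \<Rightarrow> 'a set \<Rightarrow> bool" where
  "supported u E \<longleftrightarrow> u \<in> hcarrier H \<and> (\<forall>f. (\<forall>y\<in>E. apply_bcontfun f y = 0) \<longrightarrow> mult_op f u = hzero H)"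

text \<open>In a monomial the coefficient can be moved to the right of the power of
  \<open>delta\<close>, where it acts on \<open>u\<close> directly. The move translates the
  coefficient along orbits, which is why \<open>E\<close> has to be invariant.\<close>

lemma supported_vanish:
  assumes inv: "\<And>n y. y \<in> E \<Longrightarrow> int_iter \<sigma> n y \<in> E" and u: "supported u E"
    and a: "\<And>n y. y \<in> E \<Longrightarrow> coeff a n y = 0"
  shows "\<pi> a u = hzero H"
proof -
  have uc: "u \<in> hcarrier H" using u by (simp add: supported_def)
  have "a \<in> {a. \<pi> a u = hzero H}"
  proof (rule ell1_closed_induct[OF closed_annihilator[OF uc]])
    fix n
    let ?g = "int_iter (alpha \<sigma>) (- n) (coeff a n)"
    have "ell1_single (coeff a n) n = ell1_times \<sigma> (ell1_single (const_bcontfun 1) n) (ell1_single ?g 0)"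
      by (intro ell1_eqI bcontfun_eqI)
         (auto simp: coeff_times_single_left[OF homeo] const_bcontfun.rep_eq apply_alpha_iter[OF homeo]
           int_iter_minus_cancel[OF bij_\<sigma>])
    moreover have "mult_op ?g u = hzero H"
      using u a inv by (auto simp: supported_def apply_alpha_iter[OF homeo])
    ultimately show "ell1_single (coeff a n) n \<in> {a. \<pi> a u = hzero H}"
      using uc by (simp add: rep_times rep_hzero)
  qed (use uc in \<open>auto simp: rep_0 rep_add add_zero closed\<close>)
  then show ?thesis by simp
qed

lemma supported_rep:
  assumes inv: "\<And>n y. y \<in> E \<Longrightarrow> int_iter \<sigma> n y \<in> E" and u: "supported u E"
  shows "supported (\<pi> a u) E"
proof -
  have uc: "u \<in> hcarrier H" using u by (simp add: supported_def)
  have "mult_op f (\<pi> a u) = hzero H" if "\<forall>y\<in>E. f y = 0" for f :: "'a \<Rightarrow>\<^sub>C complex"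
    unfolding rep_times[OF uc, symmetric]
    by (rule supported_vanish[OF inv u]) (use that in \<open>auto simp: coeff_times_single_left[OF homeo]\<close>)
  then show ?thesis using uc by (simp add: supported_def)
qed

text \<open>The device for exchanging products: on such vectors only the coefficient values on
  \<open>E\<close> matter.\<close>

lemma supported_cong:
  assumes inv: "\<And>n y. y \<in> E \<Longrightarrow> int_iter \<sigma> n y \<in> E" and u: "supported u E"
    and ab: "\<And>n y. y \<in> E \<Longrightarrow> coeff a n y = coeff b n y"
  shows "\<pi> a u = \<pi> b u"
proof -
  have uc: "u \<in> hcarrier H" using u by (simp add: supported_def)
  have "\<pi> (a - b) u = hzero H"
    by (rule supported_vanish[OF inv u]) (use ab in auto)
  moreover have "\<pi> a u = hadd H (\<pi> (a - b) u) (\<pi> b u)"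
    using rep_add[OF uc, of "a - b" b] by simp
  ultimately show ?thesis using uc by (simp add: zero_add)
qed

end

lemma bij_int_iter: "bij g \<Longrightarrow> bij (int_iter g k)"
  by (rule bij_betw_byWitness[where f' = "int_iter g (- k)"]) (auto simp: int_iter_minus_cancel)

section \<open>The commutative estimate near points of a given period\<close>

context inv_rep_compact
begin

text \<open>In the application \<open>E\<close> consists of the points of period at most
  \<open>p\<close>, and \<open>U\<close> is a neighbourhood in which the points of \<open>E\<close>
  have period exactly \<open>p\<close>.\<close>

context
  fixes p :: nat and E U :: "'a set"
  assumes inv: "\<And>n y. y \<in> E \<Longrightarrow> int_iter \<sigma> n y \<in> E"
    and fixed: "\<And>y. y \<in> E \<Longrightarrow> y \<in> U \<Longrightarrow> int_iter \<sigma> (int p) y = y"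
begin

lemma fixed_multiple:
  assumes "y \<in> E" "y \<in> U" "int p dvd k"
  shows "int_iter \<sigma> k y = y"
proof -
  obtain j where "k = int p * j" using assms(3) ..
  then show ?thesis
    using int_iter_mult[OF bij_\<sigma>, of "int p" j y]
      int_iter_fixed[OF bij_int_iter[OF bij_\<sigma>] fixed[OF assms(1,2)], of j]
    by simp
qed

text \<open>\<open>U\<close> itself need not be invariant. But points of \<open>E\<close> in
  \<open>U\<close> are fixed by multiples of \<open>p\<close>, so a translation by such a multiple
  cannot lead from \<open>E\<close> outside \<open>U\<close> into \<open>U\<close>.\<close>

lemma subordinate_invariant:
  assumes y: "y \<in> E" and b: "b \<in> subordinate p U" and k: "int p dvd k"
  shows "coeff b n (int_iter \<sigma> k y) = coeff b n y"
proof (cases "y \<in> U")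
  case True
  then show ?thesis using fixed_multiple[OF y True k] by simp
next
  case False
  have "int_iter \<sigma> k y \<notin> U"
  proof
    assume "int_iter \<sigma> k y \<in> U"
    from fixed_multiple[OF inv[OF y] this, of "- k"] k
    have "y = int_iter \<sigma> k y" by (simp add: int_iter_minus_cancel[OF bij_\<sigma>])
    with \<open>int_iter \<sigma> k y \<in> U\<close> False show False by simp
  qed
  then show ?thesis using False b by (simp add: subordinate_def)
qed

lemma rep_times_id:
  assumes u: "supported u E" and a: "a \<in> subordinate p U" and b: "b \<in> subordinate p U"
  shows "\<pi> (ell1_times id a b) u = \<pi> a (\<pi> b u)"
proof -
  have "\<pi> (ell1_times id a b) u = \<pi> (ell1_times \<sigma> a b) u"
  proof (rule supported_cong[OF inv u])
    fix n y assume y: "y \<in> E"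
    have eq: "coeff a k y * coeff b (n - k) (int_iter id (- k) y) =
        coeff a k y * coeff b (n - k) (int_iter \<sigma> (- k) y)" for k
    proof (cases "int p dvd k")
      case True
      then show ?thesis using subordinate_invariant[OF y b, of "- k" "n - k"] by simp
    next
      case False
      then show ?thesis using a by (simp add: subordinate_def)
    qed
    show "coeff (ell1_times id a b) n y = coeff (ell1_times \<sigma> a b) n y"
      by (rule has_sum_unique[OF coeff_times_has_sum[OF homeomorphism_id]])
         (unfold eq, rule coeff_times_has_sum[OF homeo])
  qed
  then show ?thesis using u by (simp add: rep_times supported_def)
qed

lemma rep_star_id:
  assumes u: "supported u E" and v: "v \<in> hcarrier H" and b: "b \<in> subordinate p U"
  shows "hinner H (\<pi> (ell1_star id b) u) v = hinner H u (\<pi> b v)"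
proof -
  have "\<pi> (ell1_star id b) u = \<pi> (ell1_star \<sigma> b) u"
  proof (rule supported_cong[OF inv u])
    fix n y assume y: "y \<in> E"
    show "coeff (ell1_star id b) n y = coeff (ell1_star \<sigma> b) n y"
    proof (cases "int p dvd n")
      case True
      then show ?thesis
        using subordinate_invariant[OF y b, of "- n" "- n"]
        by (simp add: coeff_ell1_star_apply[OF homeo] coeff_ell1_star_apply[OF homeomorphism_id])
    next
      case False
      then show ?thesis
        using b by (simp add: coeff_ell1_star_apply[OF homeo] coeff_ell1_star_apply[OF homeomorphism_id]
            subordinate_def)
    qed
  qed
  then show ?thesis using u v by (simp add: rep_star supported_def)
qed

text \<open>The operator of \<open>b\<^sup>* b\<close> is symmetric on supported vectors, so its
  size at \<open>u\<close> is controlled by that of its iterated squares, whose algebra norm exceeds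
  the supremum of their transform only by a factor linear in the exponent.\<close>

lemma rep_le_transform_finite:
  assumes u: "supported u E" and b: "b \<in> subordinate p U"
    and N: "\<And>n. int N < \<bar>n\<bar> \<Longrightarrow> coeff b n = 0"
    and M: "0 < M" "\<And>x l. cmod l = 1 \<Longrightarrow> cmod (transform b (x, l)) \<le> M"
  shows "hnorm H (\<pi> b u) \<le> M * hnorm H u"
proof (cases "hnorm H u = 0")
  case True
  then show ?thesis using u contractive[of u b] by (simp add: supported_def)
next
  case False
  have uc: "u \<in> hcarrier H" using u by (simp add: supported_def)
  then have u0: "0 < hnorm H u" using False hnorm_nonneg[OF uc] by linarith
  \<comment> \<open>\<open>h k\<close> is the power of exponent \<open>2 ^ k\<close> of
    \<open>b\<^sup>* b\<close> in the commutative product.\<close>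
  define h where "h = rec_nat (ell1_times id (ell1_star id b) b) (\<lambda>_ c. ell1_times id c c)"
  have h0: "h 0 = ell1_times id (ell1_star id b) b" and hS: "h (Suc k) = ell1_times id (h k) (h k)" for k
    by (simp_all add: h_def)
  have hsub: "h k \<in> subordinate p U" for k
    by (induction k) (auto simp: h0 hS intro!: subordinate_times subordinate_star b)
  have hT: "transform (h k) (x, l) = complex_of_real ((cmod (transform b (x, l)))\<^sup>2 ^ (2 ^ k))"
    if "cmod l = 1" for k x l
  proof (induction k)
    case 0
    then show ?case
      using complex_norm_square[of "transform b (x, l)"]
      by (simp add: h0 transform_times_id[OF that] transform_star_id[OF that] mult.commute)
  next
    case (Suc k)
    then show ?case
      by (simp add: hS transform_times_id[OF that] power_mult power2_eq_square flip: power_add mult_2)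
  qed
  have range: "coeff (h k) n = 0" if "2 * 2 ^ k * int N < \<bar>n\<bar>" for k n
    using that
  proof (induction k arbitrary: n)
    case 0
    show ?case unfolding h0
    proof (rule coeff_times_range[of "int N" _ "int N"])
      show "coeff (ell1_star id b) n = 0" if "int N < \<bar>n\<bar>" for n
        by (rule bcontfun_eqI) (use N[of "- n"] that in \<open>simp add: coeff_ell1_star_apply[OF homeomorphism_id]\<close>)
    qed (use N 0 in auto)
  next
    case (Suc k)
    show ?case unfolding hS
      by (rule coeff_times_range[of "2 * 2 ^ k * int N" _ "2 * 2 ^ k * int N"]) (use Suc in \<open>auto simp: mult_ac\<close>)
  qed
  have hnorm1: "norm (h k) \<le> (2 ^ k * (4 * real N) + 1) * (M\<^sup>2) ^ (2 ^ k)" for k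
  proof -
    \<comment> \<open>The exponents of \<open>h k\<close> lie between \<open>- ?R\<close> and
      \<open>?R\<close>, which leaves \<open>2 * ?R + 1\<close> coefficients to be bounded by the
      supremum of the transform.\<close>
    let ?R = "2 * 2 ^ k * N"
    have "norm (h k) = (\<Sum>\<^sub>\<infinity>n\<in>{- int ?R..int ?R}. norm (coeff (h k) n))"
      unfolding norm_ell1.rep_eq by (rule infsum_cong_neutral) (use range[of k] in auto)
    also have "\<dots> = (\<Sum>n\<in>{- int ?R..int ?R}. norm (coeff (h k) n))" by simp
    also have "\<dots> \<le> (\<Sum>n\<in>{- int ?R..int ?R}. (M\<^sup>2) ^ (2 ^ k))"
    proof (rule sum_mono, rule norm_coeff_le_transform)
      fix x and l :: complex assume l: "cmod l = 1"
      have "(cmod (transform b (x, l)))\<^sup>2 ^ 2 ^ k \<le> (M\<^sup>2) ^ 2 ^ k"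
        using M(2)[OF l] by (intro power_mono) auto
      then show "cmod (transform (h k) (x, l)) \<le> (M\<^sup>2) ^ 2 ^ k"
        by (simp add: hT[OF l] norm_power flip: of_real_power)
    qed
    also have "\<dots> = (2 ^ k * (4 * real N) + 1) * (M\<^sup>2) ^ (2 ^ k)"
      by simp
    finally show ?thesis .
  qed
  have supp: "supported (\<pi> a v) E" if "supported v E" for a v
    by (rule supported_rep[OF inv that])
  have pih0: "\<pi> (h 0) v = \<pi> (ell1_star id b) (\<pi> b v)" if "supported v E" for v
    unfolding h0 by (rule rep_times_id[OF that subordinate_star[OF b] b])
  have pihS: "\<pi> (h (Suc k)) v = \<pi> (h k) (\<pi> (h k) v)" if "supported v E" for v k
    unfolding hS by (rule rep_times_id[OF that hsub hsub])
  have sc: "v \<in> hcarrier H" if "supported v E" for v using that by (simp add: supported_def)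
  have sym: "hinner H (\<pi> (h k) v) w = hinner H v (\<pi> (h k) w)" if "supported v E" "supported w E" for k v w
    using that
  proof (induction k arbitrary: v w)
    case 0
    have 1: "hinner H (\<pi> (h 0) v) w = hinner H (\<pi> b v) (\<pi> b w)" if "supported v E" "supported w E" for v w
      using rep_star_id[OF supp[OF that(1)] sc[OF that(2)] b, of b] that by (simp add: pih0)
    have "hinner H v (\<pi> (h 0) w) = cnj (hinner H (\<pi> (h 0) w) v)"
      using 0 by (intro inner_commute) (auto simp: sc)
    also have "\<dots> = hinner H (\<pi> b v) (\<pi> b w)"
      using 1[OF 0(2,1)] inner_commute[of "\<pi> b v" "\<pi> b w"] 0 by (simp add: sc)
    finally show ?case using 1[OF 0] by simp
  next
    case (Suc k)
    then show ?case using Suc.IH[OF supp[OF Suc.prems(1)] Suc.prems(2), of "h k"]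
        Suc.IH[OF Suc.prems(1) supp[OF Suc.prems(2)], of "h k"] by (simp add: pihS)
  qed
  define x where "x k = hnorm H (\<pi> (h k) u)" for k
  have x0: "0 \<le> x k" for k unfolding x_def using uc by simp
  \<comment> \<open>By symmetry the squared norm of the image of \<open>u\<close> under
    \<open>h k\<close> is a diagonal coefficient of its square \<open>h (Suc k)\<close>.\<close>
  have xsq: "(x k)\<^sup>2 \<le> x (Suc k) * hnorm H u" for k
  proof -
    have "(x k)\<^sup>2 = Re (hinner H (\<pi> (h (Suc k)) u) u)"
      using sym[OF supp[OF u] u, of k "h k"] uc unfolding x_def by (simp add: hnorm_power2 pihS[OF u])
    also have "\<dots> \<le> x (Suc k) * hnorm H u"
      unfolding x_def using Cauchy_Schwarz[of "\<pi> (h (Suc k)) u" u] complex_Re_le_cmod uc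
      by (meson order_trans rep_closed)
    finally show ?thesis .
  qed
  have iter: "x 0 ^ (2 ^ k) * hnorm H u \<le> x k * hnorm H u ^ (2 ^ k)" for k
  proof (induction k)
    case (Suc k)
    have "(x 0 ^ (2 ^ k) * hnorm H u)\<^sup>2 \<le> (x k * hnorm H u ^ (2 ^ k))\<^sup>2"
      using Suc x0 u0 by (intro power_mono) auto
    also have "\<dots> \<le> (x (Suc k) * hnorm H u) * (hnorm H u ^ (2 ^ k))\<^sup>2"
      unfolding power_mult_distrib by (intro mult_right_mono xsq) auto
    finally have "(x 0 ^ (2 ^ Suc k) * hnorm H u) * hnorm H u \<le> (x (Suc k) * hnorm H u ^ (2 ^ Suc k)) * hnorm H u"
      by (simp add: power_mult_distrib power_mult[symmetric] power2_eq_square mult_ac)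
         (simp add: power_add[symmetric] mult_2 mult_ac)
    then show ?case using u0 by (rule mult_right_le_imp_le)
  qed simp
  \<comment> \<open>Normalised so that the bound for \<open>b\<^sup>* b\<close> reads
    \<open>t \<le> 1\<close>; after division, \<open>iter\<close> and \<open>hnorm1\<close> leave
    growth linear in \<open>2 ^ k\<close>.\<close>
  define t where "t = x 0 / (M\<^sup>2 * hnorm H u)"
  have "t \<le> 1"
  proof (rule le_1_if_powers_grow_linearly[where C = "4 * real N"])
    show "0 \<le> t" using x0 u0 by (simp add: t_def)
    fix k
    have "x k \<le> norm (h k) * hnorm H u" unfolding x_def by (rule contractive[OF uc])
    also have "\<dots> \<le> (2 ^ k * (4 * real N) + 1) * (M\<^sup>2) ^ (2 ^ k) * hnorm H u"
      using hnorm1[of k] u0 by (intro mult_right_mono) auto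
    finally have "x k * hnorm H u ^ (2 ^ k) \<le>
        ((2 ^ k * (4 * real N) + 1) * (M\<^sup>2) ^ (2 ^ k) * hnorm H u) * hnorm H u ^ (2 ^ k)"
      using u0 by (intro mult_right_mono) auto
    with iter[of k] have "x 0 ^ (2 ^ k) * hnorm H u \<le>
        ((2 ^ k * (4 * real N) + 1) * ((M\<^sup>2) ^ (2 ^ k) * hnorm H u ^ (2 ^ k))) * hnorm H u"
      by (simp add: mult_ac)
    then have "x 0 ^ (2 ^ k) \<le> (2 ^ k * (4 * real N) + 1) * (M\<^sup>2 * hnorm H u) ^ (2 ^ k)"
      using u0 unfolding power_mult_distrib by (rule mult_right_le_imp_le)
    then show "t ^ (2 ^ k) \<le> 2 ^ k * (4 * real N) + 1"
      using u0 M(1) by (simp add: t_def power_divide divide_le_eq)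
  qed
  then have "x 0 \<le> M\<^sup>2 * hnorm H u" using u0 M(1) by (simp add: t_def divide_le_eq)
  moreover have "(hnorm H (\<pi> b u))\<^sup>2 \<le> x 0 * hnorm H u"
  proof -
    have "(hnorm H (\<pi> b u))\<^sup>2 = Re (hinner H (\<pi> (h 0) u) u)"
      using rep_star_id[OF supp[OF u] uc b, of b] uc by (simp add: hnorm_power2 pih0[OF u])
    also have "\<dots> \<le> x 0 * hnorm H u"
      unfolding x_def using Cauchy_Schwarz[of "\<pi> (h 0) u" u] complex_Re_le_cmod uc
      by (meson order_trans rep_closed)
    finally show ?thesis .
  qed
  ultimately have "(hnorm H (\<pi> b u))\<^sup>2 \<le> (M\<^sup>2 * hnorm H u) * hnorm H u"
    using u0 mult_right_mono[of "x 0" "M\<^sup>2 * hnorm H u" "hnorm H u"] by linarith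
  then have "(hnorm H (\<pi> b u))\<^sup>2 \<le> (M * hnorm H u)\<^sup>2"
    by (simp add: power2_eq_square mult_ac)
  then show ?thesis by (rule power2_le_imp_le) (use M(1) u0 in simp)
qed

lemma rep_le_transform:
  assumes u: "supported u E" and b: "b \<in> subordinate p U"
    and M: "0 < M" "\<And>x l. cmod l = 1 \<Longrightarrow> cmod (transform b (x, l)) \<le> M"
  shows "hnorm H (\<pi> b u) \<le> M * hnorm H u"
proof -
  have uc: "u \<in> hcarrier H" using u by (simp add: supported_def)
  \<comment> \<open>Truncating \<open>b\<close> costs \<open>e\<close> twice: once in the supremum
    of the transform, once in the operator norm of the tail.\<close>
  have "hnorm H (\<pi> b u) \<le> M * hnorm H u + e * (2 * hnorm H u)" if e: "0 < e" for e
  proof -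
    obtain F where F: "finite F" "\<And>G. F \<subseteq> G \<Longrightarrow> norm (b - ell1_restrict G b) < e"
      using ell1_restrict_tail[OF e, of b] by blast
    define N where "N = nat (\<Sum>n\<in>F. \<bar>n\<bar>)"
    have "\<bar>n\<bar> \<le> int N" if "n \<in> F" for n
      using member_le_sum[OF that, of "\<lambda>n. \<bar>n\<bar>"] F(1) by (simp add: N_def sum_nonneg)
    then have "F \<subseteq> {- int N..int N}" by force
    define b' where "b' = ell1_restrict {- int N..int N} b"
    have le: "norm (b - b') < e" unfolding b'_def by (rule F(2)) fact
    have "hnorm H (\<pi> b' u) \<le> (M + e) * hnorm H u"
    proof (rule rep_le_transform_finite[OF u])
      show "b' \<in> subordinate p U" using b by (auto simp: b'_def subordinate_def)
      show "coeff b' n = 0" if "int N < \<bar>n\<bar>" for n using that by (auto simp: b'_def)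
      show "0 < M + e" using M(1) e by simp
      show "cmod (transform b' (x, l)) \<le> M + e" if l: "cmod l = 1" for x l
      proof -
        have "transform b' (x, l) = transform b (x, l) - transform (b - b') (x, l)"
          by (simp add: transform_diff[OF l])
        then have "cmod (transform b' (x, l)) = cmod (transform b (x, l) - transform (b - b') (x, l))"
          by (rule arg_cong)
        then show ?thesis
          using norm_triangle_ineq4[of "transform b (x, l)" "transform (b - b') (x, l)"]
            M(2)[OF l, of x] norm_transform_le[OF l, of "b - b'" x] le by linarith
      qed
    qed
    moreover have "hnorm H (\<pi> (b - b') u) \<le> e * hnorm H u"
      using contractive[OF uc, of "b - b'"] le mult_right_mono[of "norm (b - b')" e "hnorm H u"] uc by simp
    moreover have "hnorm H (\<pi> b u) \<le> hnorm H (\<pi> b' u) + hnorm H (\<pi> (b - b') u)"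
      using hnorm_triangle[of "\<pi> b' u" "\<pi> (b - b') u"] rep_add[OF uc, of b' "b - b'"] uc by simp
    ultimately show ?thesis by (simp add: algebra_simps)
  qed
  note le = this
  show ?thesis
  proof (rule field_le_epsilon)
    fix d :: real assume "0 < d"
    have "0 < 2 * hnorm H u + 1" using hnorm_nonneg[OF uc] by linarith
    moreover have "d / (2 * hnorm H u + 1) * (2 * hnorm H u) \<le> d"
      using \<open>0 < d\<close> calculation by (simp add: field_simps)
    ultimately show "hnorm H (\<pi> b u) \<le> M * hnorm H u + d"
      using le[of "d / (2 * hnorm H u + 1)"] \<open>0 < d\<close> by fastforce
  qed
qed

text \<open>Here \<open>localization\<close> runs with the transform as symbol. Since
  \<open>e\<close> kills every \<open>\<pi> c u\<close>, it kills \<open>\<pi> b u\<close>, so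
  replacing \<open>b\<close> by \<open>b - e b\<close> leaves \<open>\<pi> b u\<close> unchanged;
  and \<open>e\<^sup>* e\<close>, whose transform is nonnegative, kills the same vectors.\<close>

lemma rep_vanish_subordinate:
  assumes u: "supported u E" and b: "b \<in> subordinate p U"
    and hull: "\<And>x l. cmod l = 1 \<Longrightarrow> transform b (x, l) \<noteq> 0 \<Longrightarrow>
      \<exists>e\<in>subordinate p U. (\<forall>c. \<pi> e (\<pi> c u) = hzero H) \<and> transform e (x, l) \<noteq> 0"
  shows "\<pi> b u = hzero H"
proof -
  let ?\<Omega> = "UNIV \<times> sphere 0 1 :: ('a \<times> complex) set"
  let ?K = "{e \<in> subordinate p U. \<forall>c. \<pi> e (\<pi> c u) = hzero H}"
  let ?Q = "{q. \<exists>e\<in>?K. \<forall>z\<in>?\<Omega>. transform e z = complex_of_real (q z) \<and> 0 \<le> q z}"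
  have uc: "u \<in> hcarrier H" using u by (simp add: supported_def)
  have supp: "supported (\<pi> a u) E" for a by (rule supported_rep[OF inv u])
  have "hnorm H (\<pi> b u) \<le> 0"
  proof (rule localization[where \<Omega> = ?\<Omega> and A = "subordinate p U" and F = transform and Q = ?Q
        and s = "\<lambda>b. hnorm H (\<pi> b u)" and C = "hnorm H u"])
    show "compact ?\<Omega>" using cpt by (intro compact_Times) auto
    show "continuous_on ?\<Omega> (transform b)" for b by (rule continuous_on_transform)
    show "hnorm H (\<pi> b u) \<le> hnorm H u * M" if "b \<in> subordinate p U" "0 < M"
      "\<And>z. z \<in> ?\<Omega> \<Longrightarrow> cmod (transform b z) \<le> M" for b M
      using rep_le_transform[OF u that(1,2)] that(3) by (simp add: mult.commute)
    show "0 \<le> hnorm H u" using uc by simp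
    show "continuous_on ?\<Omega> q" if "q \<in> ?Q" for q
    proof -
      from that obtain e where "\<forall>z\<in>?\<Omega>. transform e z = complex_of_real (q z)" by blast
      then show ?thesis
        by (intro continuous_on_eq[OF continuous_on_Re[OF continuous_on_transform[of e]]]) auto
    qed
    show "0 \<le> q z" if "q \<in> ?Q" "z \<in> ?\<Omega>" for q z using that by blast
    show "(\<lambda>_. 0) \<in> ?Q"
    proof -
      have "0 \<in> ?K" using uc by (simp add: subordinate_linear rep_0)
      then show ?thesis by (auto simp: transform_def intro!: bexI[of _ 0])
    qed
    show "(\<lambda>z. q z + q' z) \<in> ?Q" if "q \<in> ?Q" "q' \<in> ?Q" for q q'
    proof -
      from that obtain e e' where e: "e \<in> ?K" "\<forall>z\<in>?\<Omega>. transform e z = complex_of_real (q z) \<and> 0 \<le> q z"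
        "e' \<in> ?K" "\<forall>z\<in>?\<Omega>. transform e' z = complex_of_real (q' z) \<and> 0 \<le> q' z" by blast
      have "e + e' \<in> ?K" using e uc by (simp add: subordinate_linear rep_add add_zero closed)
      then show ?thesis using e by (auto simp: transform_add intro!: bexI[of _ "e + e'"])
    qed
    show "(\<lambda>z. t * q z) \<in> ?Q" if "q \<in> ?Q" "0 \<le> t" for q t
    proof -
      from that obtain e where e: "e \<in> ?K" "\<forall>z\<in>?\<Omega>. transform e z = complex_of_real (q z) \<and> 0 \<le> q z" by blast
      have "t *\<^sub>R e \<in> ?K" using e uc by (simp add: subordinate_linear rep_scaleR scale_of_zero)
      then show ?thesis
        using e that(2) by (auto simp: transform_scaleR scaleR_conv_of_real intro!: bexI[of _ "t *\<^sub>R e"])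
    qed
    show "\<exists>b'\<in>subordinate p U. (\<forall>z\<in>?\<Omega>. transform b' z = (1 - complex_of_real (q z)) * transform b z) \<and>
        hnorm H (\<pi> b' u) = hnorm H (\<pi> b u)" if "q \<in> ?Q" "b \<in> subordinate p U" for q b
    proof -
      from that obtain e where e: "e \<in> subordinate p U" "\<And>c. \<pi> e (\<pi> c u) = hzero H"
        "\<forall>z\<in>?\<Omega>. transform e z = complex_of_real (q z) \<and> 0 \<le> q z" by blast
      let ?b = "b - ell1_times id e b"
      have "?b \<in> subordinate p U" using e(1) that(2) by (intro subordinate_linear subordinate_times)
      moreover have "\<pi> ?b u = \<pi> b u"
        using uc by (simp add: rep_diff rep_times_id[OF u e(1) that(2)] e(2) scale_of_zero add_zero)
      moreover have "\<forall>z\<in>?\<Omega>. transform ?b z = (1 - complex_of_real (q z)) * transform b z"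
        using e(3) by (auto simp: transform_diff transform_times_id algebra_simps)
      ultimately show ?thesis by (intro bexI[of _ ?b]) auto
    qed
    show "\<exists>q\<in>?Q. q z \<noteq> 0" if z: "z \<in> ?\<Omega>" "transform b z \<noteq> 0" for z
    proof -
      obtain x l where xl: "z = (x, l)" "cmod l = 1" using z(1) by auto
      obtain e where e: "e \<in> subordinate p U" "\<And>c. \<pi> e (\<pi> c u) = hzero H" "transform e (x, l) \<noteq> 0"
        using hull[OF xl(2)] z(2) xl(1) by blast
      let ?e = "ell1_times id (ell1_star id e) e"
      have "?e \<in> ?K"
        using e subordinate_times[OF subordinate_star[OF e(1)] e(1)]
        by (simp add: rep_times_id[OF supp subordinate_star[OF e(1)] e(1)] rep_hzero)
      moreover have "\<forall>z\<in>?\<Omega>. transform ?e z = complex_of_real ((cmod (transform e z))\<^sup>2)"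
        by (auto simp: transform_times_id transform_star_id complex_norm_square mult.commute
            simp del: of_real_power)
      ultimately have "(\<lambda>z. (cmod (transform e z))\<^sup>2) \<in> ?Q" by (intro CollectI bexI[of _ ?e]) auto
      then show ?thesis using e(3) xl(1) by (intro bexI[of _ "\<lambda>z. (cmod (transform e z))\<^sup>2"]) auto
    qed
  qed (rule b)
  then have "hnorm H (\<pi> b u) = 0" using hnorm_nonneg[OF rep_closed[OF uc], of b] by linarith
  then show ?thesis using uc by (simp add: hnorm_eq_0_iff)
qed

end

end

section \<open>Kernels of involutive representations are vanishing ideals\<close>

text \<open>For functions \<open>f\<close> and \<open>g\<close> supported in \<open>U\<close> the
  products \<open>f \<delta>^j g\<close> with \<open>j\<close> in \<open>F\<close> vanish;
  compressions use this to remove unwanted coefficients.\<close>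

lemma separating_neighbourhood:
  fixes \<sigma> :: "'a::t2_space \<Rightarrow> 'a"
  assumes h: "homeomorphism UNIV UNIV \<sigma> (inv \<sigma>)" and "finite F"
    and "\<And>j. j \<in> F \<Longrightarrow> int_iter \<sigma> j z \<noteq> z"
  obtains U where "open U" "z \<in> U" "\<And>j y. j \<in> F \<Longrightarrow> y \<in> U \<Longrightarrow> int_iter \<sigma> j y \<notin> U"
  using assms(2,3)
proof (induction F arbitrary: thesis rule: finite_induct)
  case empty
  show ?case by (rule empty(1)[of UNIV]) auto
next
  case (insert i F)
  obtain U where U: "open U" "z \<in> U" "\<And>j y. j \<in> F \<Longrightarrow> y \<in> U \<Longrightarrow> int_iter \<sigma> j y \<notin> U"
    by (rule insert.IH) (use insert.prems(2) in auto)
  obtain A B where AB: "open A" "open B" "z \<in> A" "int_iter \<sigma> i z \<in> B" "A \<inter> B = {}"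
    using hausdorff[of z "int_iter \<sigma> i z"] insert.prems(2)[of i] by auto
  have "open (int_iter \<sigma> i -` B)"
    using AB(2) continuous_on_int_iter[OF h] by (intro open_vimage)
  then show ?case
    using U AB by (intro insert.prems(1)[of "U \<inter> A \<inter> int_iter \<sigma> i -` B"]) auto
qed

lemma int_iter_eq_self_iff:
  assumes "bij \<sigma>" "0 < p" "int_iter \<sigma> (int p) y = y"
    and "\<And>j. 0 < j \<Longrightarrow> j < int p \<Longrightarrow> int_iter \<sigma> j y \<noteq> y"
  shows "int_iter \<sigma> n y = int_iter \<sigma> (n mod int p) y" "int_iter \<sigma> n y = y \<longleftrightarrow> int p dvd n"
proof -
  have "int_iter \<sigma> (int p * m) y = y" for m
    using int_iter_mult[OF assms(1), of "int p" m y] int_iter_fixed[OF bij_int_iter[OF assms(1)] assms(3), of m]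
    by simp
  then show eq: "int_iter \<sigma> n y = int_iter \<sigma> (n mod int p) y"
    using int_iter_add[OF assms(1), of "n mod int p" "int p * (n div int p)" y] by simp
  show "int_iter \<sigma> n y = y \<longleftrightarrow> int p dvd n"
  proof (cases "n mod int p = 0")
    case False
    moreover have "0 \<le> n mod int p" "n mod int p < int p" using assms(2) by simp_all
    ultimately have "int_iter \<sigma> (n mod int p) y \<noteq> y" by (intro assms(4)) linarith+
    then show ?thesis using False unfolding eq by (simp add: dvd_eq_mod_eq_0)
  qed (simp add: eq dvd_eq_mod_eq_0)
qed

section \<open>The orthogonal complement and points of low period\<close>

context inv_rep_compact
begin

abbreviation hull_ideal :: "'a ell1 set" where
  "hull_ideal \<equiv> vanishing_ideal \<sigma> (zero_set (rep_kernel H \<pi>))"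

lemma zero_set_kernel:
  "zero_set (rep_kernel H \<pi>) \<subseteq> UNIV \<times> sphere 0 1"
  "map_prod \<sigma> id ` zero_set (rep_kernel H \<pi>) = zero_set (rep_kernel H \<pi>)"
  by (rule zero_set_subset) (rule zero_set_invariant[OF homeo rep_kernel_closed_ideal])

lemma hull_ideal_times:
  assumes "a \<in> hull_ideal"
  shows "ell1_times \<sigma> a b \<in> hull_ideal" "ell1_times \<sigma> b a \<in> hull_ideal" "ell1_star \<sigma> a \<in> hull_ideal"
  using vanishing_ideal_closed_ideal[OF cpt homeo zero_set_kernel] assms
  by (auto simp: closed_ideals_def)

lemma kernel_times:
  assumes "k \<in> rep_kernel H \<pi>"
  shows "ell1_times \<sigma> k b \<in> rep_kernel H \<pi>"
  using rep_kernel_closed_ideal assms by (auto simp: closed_ideals_def)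

text \<open>The space \<open>R\<close> of the overview.\<close>

definition core :: "'h set" where
  "core = {u \<in> hcarrier H. \<forall>v\<in>hcarrier H. (\<forall>b\<in>hull_ideal. \<pi> b v = hzero H) \<longrightarrow> hinner H u v = 0}"

lemma core_carrier: "u \<in> core \<Longrightarrow> u \<in> hcarrier H"
  by (simp add: core_def)

lemma core_rep:
  assumes "u \<in> core"
  shows "\<pi> a u \<in> core"
proof -
  have "hinner H (\<pi> a u) v = 0" if v: "v \<in> hcarrier H" "\<forall>b\<in>hull_ideal. \<pi> b v = hzero H" for v
  proof -
    have "\<pi> b (\<pi> (ell1_star \<sigma> a) v) = hzero H" if "b \<in> hull_ideal" for b
      using v hull_ideal_times(1)[OF that] by (simp add: rep_times[symmetric])
    then have "hinner H u (\<pi> (ell1_star \<sigma> a) v) = 0"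
      using assms v(1) by (simp add: core_def)
    then show ?thesis using assms v(1) by (simp add: rep_star' core_carrier)
  qed
  then show ?thesis using core_carrier[OF assms] by (simp add: core_def)
qed

lemma core_eq_0:
  assumes "u \<in> core" "\<And>b. b \<in> hull_ideal \<Longrightarrow> \<pi> b u = hzero H"
  shows "u = hzero H"
  using assms inner_definite[of u] by (auto simp: core_def)

text \<open>Since the ideal is self-adjoint, its ranges are orthogonal to the vectors it kills.
  Hence it acts as zero once \<open>core\<close> is trivial.\<close>

lemma rep_hull_ideal_core:
  assumes "a \<in> hull_ideal" "w \<in> hcarrier H"
  shows "\<pi> a w \<in> core"
  using assms hull_ideal_times(3)[OF assms(1)] by (simp add: core_def rep_star' inner_zero_right)

definition low :: "nat \<Rightarrow> 'a set" where
  "low n = {x. \<exists>d. 0 < d \<and> d \<le> n \<and> int_iter \<sigma> (int d) x = x}"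

lemma closed_low: "closed (low n)"
proof -
  have "low n = (\<Union>d\<in>{1..n}. {x. int_iter \<sigma> (int d) x = x})"
    by (auto simp: low_def Bex_def Suc_le_eq)
  moreover have "closed {x. int_iter \<sigma> (int d) x = x}" for d
    using continuous_on_int_iter[OF homeo] by (intro closed_Collect_eq continuous_intros)
  ultimately show ?thesis by (simp add: closed_UN)
qed

lemma low_invariant: "y \<in> low n \<Longrightarrow> int_iter \<sigma> k y \<in> low n"
  unfolding low_def using int_iter_add[OF bij_\<sigma>] by (auto, metis add.commute)

lemma star_single_0: "ell1_star \<sigma> (ell1_single f 0) = ell1_single (cf_cnj f) 0"
  by (intro ell1_eqI bcontfun_eqI) (simp add: coeff_ell1_star_apply[OF homeo])

text \<open>By \<open>mult_op_vanish\<close> it is enough to find, at each point outside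
  \<open>low (p - 1)\<close>, a function that is nonzero there and kills \<open>w\<close>. Outside
  \<open>low p\<close> the support of \<open>w\<close> provides it; at a point of exact period
  \<open>p\<close> a bump \<open>e\<close> works, because \<open>mult_op e w\<close> lies in
  \<open>core\<close> and is killed by the hull ideal.\<close>

lemma core_supported_step:
  assumes p: "0 < p" and w: "w \<in> core" and supp: "supported w (low p)"
  shows "supported w (low (p - 1))"
proof -
  have wc: "w \<in> hcarrier H" by (rule core_carrier[OF w])
  have "\<exists>e :: 'a \<Rightarrow>\<^sub>C complex. mult_op e w = hzero H \<and> apply_bcontfun e z \<noteq> 0" if z: "z \<notin> low (p - 1)" for z
  proof (cases "z \<in> low p")
    case False
    obtain e :: "'a \<Rightarrow>\<^sub>C complex" where e: "e z = 1" "\<And>y. y \<notin> - low p \<Longrightarrow> e y = 0"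
      "\<And>y. cmod (e y) \<le> 1"
      by (rule bump_bcontfun[OF cpt open_Compl[OF closed_low] iffD2[OF Compl_iff False]]) (rule that)
    have "mult_op e w = hzero H" using supp e(2) by (simp add: supported_def)
    then show ?thesis using e(1) by (intro exI[of _ e]) simp
  next
    case True
    have zj: "int_iter \<sigma> j z \<noteq> z" if j: "j \<in> {1..<int p}" for j
    proof
      assume "int_iter \<sigma> j z = z"
      then have "z \<in> low (p - 1)" using j unfolding low_def by (intro CollectI exI[of _ "nat j"]) auto
      with z show False ..
    qed
    obtain U where U: "open U" "z \<in> U"
      "\<And>j y. j \<in> {1..<int p} \<Longrightarrow> y \<in> U \<Longrightarrow> int_iter \<sigma> j y \<notin> U"
      by (rule separating_neighbourhood[OF homeo, where F = "{1..<int p}" and z = z]) (simp, erule zj, rule that)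
    obtain e :: "'a \<Rightarrow>\<^sub>C complex" where e: "e z = 1" "\<And>y. y \<notin> U \<Longrightarrow> e y = 0"
      "\<And>y. cmod (e y) \<le> 1"
      by (rule bump_bcontfun[OF cpt U(1,2)]) (rule that)
    have per: "int_iter \<sigma> (int p) y = y" if y: "y \<in> low p" "y \<in> U" for y
    proof -
      obtain d where d: "0 < d" "d \<le> p" "int_iter \<sigma> (int d) y = y" using y(1) by (auto simp: low_def)
      have "d = p"
      proof (rule ccontr)
        assume "d \<noteq> p"
        then have "int d \<in> {1..<int p}" using d by simp
        from U(3)[OF this y(2)] d(3) y(2) show False by simp
      qed
      then show ?thesis using d by simp
    qed
    have per_iff: "int_iter \<sigma> n y = int_iter \<sigma> (n mod int p) y" "int_iter \<sigma> n y = y \<longleftrightarrow> int p dvd n"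
      if y: "y \<in> low p" "y \<in> U" for y n
    proof -
      have nz: "int_iter \<sigma> j y \<noteq> y" if "0 < j" "j < int p" for j
        using U(3)[of j y] y(2) that by (metis atLeastLessThan_iff int_one_le_iff_zero_less)
      show "int_iter \<sigma> n y = int_iter \<sigma> (n mod int p) y" "int_iter \<sigma> n y = y \<longleftrightarrow> int p dvd n"
        by (rule int_iter_eq_self_iff[OF bij_\<sigma> p per[OF y] nz]; assumption)+
    qed
    define g where "g = cf_times (cf_cnj e) e"
    have g0: "g y \<noteq> 0 \<longleftrightarrow> e y \<noteq> 0" for y by (simp add: g_def)
    \<comment> \<open>On vectors supported in \<open>low p\<close>, \<open>e\<^sup>* k e\<close>
      acts as \<open>comp k\<close>: exponents not divisible by \<open>p\<close> move points of
      \<open>low p\<close> in \<open>U\<close> out of \<open>U\<close>, the others fix them.\<close>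
    define comp where "comp k = ell1_restrict {n. int p dvd n} (ell1_times \<sigma> (ell1_single g 0) k)" for k
    have comp_sub: "comp k \<in> subordinate p U" for k
      using e(2) by (auto simp: comp_def subordinate_def g_def coeff_times_single_left[OF homeo])
    have compress: "mult_op (cf_cnj e) (\<pi> k (mult_op e v)) = \<pi> (comp k) v"
      if v: "supported v (low p)" for k v
    proof -
      have vc: "v \<in> hcarrier H" using v by (simp add: supported_def)
      let ?m = "ell1_times \<sigma> (ell1_single (cf_cnj e) 0) (ell1_times \<sigma> k (ell1_single e 0))"
      have "\<pi> ?m v = \<pi> (comp k) v"
      proof (rule supported_cong[OF low_invariant v])
        fix n y assume y: "y \<in> low p"
        have m: "coeff ?m n y = cnj (e y) * (coeff k n y * e (int_iter \<sigma> (- n) y))"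
          by (simp add: coeff_times_single_left[OF homeo] coeff_times_single_right[OF homeo])
        have c: "coeff (comp k) n y = (if int p dvd n then cnj (e y) * e y * coeff k n y else 0)"
          by (simp add: comp_def g_def coeff_times_single_left[OF homeo])
        show "coeff ?m n y = coeff (comp k) n y"
        proof (cases "y \<in> U")
          case False
          then show ?thesis by (simp add: m c e(2))
        next
          case yU: True
          show ?thesis
          proof (cases "int p dvd n")
            case True
            then have "int_iter \<sigma> (- n) y = y" using per_iff(2)[OF y yU, of "- n"] by simp
            then show ?thesis using True by (simp add: m c)
          next
            case False
            then have "(- n) mod int p \<noteq> 0" using dvd_minus_iff[of "int p" n] by presburger
            moreover have "0 \<le> (- n) mod int p" "(- n) mod int p < int p" using p by simp_all
            ultimately have *: "(- n) mod int p \<in> {1..<int p}"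
              unfolding atLeastLessThan_iff by linarith
            have "int_iter \<sigma> (- n) y \<notin> U"
              unfolding per_iff(1)[OF y yU, of "- n"] by (rule U(3)[OF * yU])
            then show ?thesis using False by (simp add: m c e(2))
          qed
        qed
      qed
      then show ?thesis using vc by (simp add: rep_times)
    qed
    have tcomp: "transform (comp k) (x, l) = g x * (\<Sum>\<^sub>\<infinity>n. if int p dvd n then l powi n * coeff k n x else 0)"
      for k x l
      unfolding transform_def prod.case infsum_cmult_right'[symmetric]
      by (rule infsum_cong) (simp add: comp_def coeff_times_single_left[OF homeo])
    \<comment> \<open>Wherever the transform of \<open>comp c\<close> is nonzero, a killing
      subordinate element has to be produced: outside \<open>low p\<close> a function, by the
      support of \<open>w\<close>; inside, a compressed kernel element.\<close>
    have vanish: "\<pi> (comp c) w = hzero H" if c: "c \<in> hull_ideal" for c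
    proof (rule rep_vanish_subordinate[OF low_invariant per supp comp_sub])
      fix x and l :: complex assume l: "cmod l = 1" and t: "transform (comp c) (x, l) \<noteq> 0"
      then have ex: "e x \<noteq> 0" and tc: "(\<Sum>\<^sub>\<infinity>n. if int p dvd n then l powi n * coeff c n x else 0) \<noteq> 0"
        using g0[of x] by (auto simp: tcomp)
      have xU: "x \<in> U" using e(2) ex by blast
      have l0: "l \<noteq> 0" using l by auto
      show "\<exists>e\<in>subordinate p U. (\<forall>c. \<pi> e (\<pi> c w) = hzero H) \<and> transform e (x, l) \<noteq> 0"
      proof (cases "x \<in> low p")
        case False
        obtain f :: "'a \<Rightarrow>\<^sub>C complex" where f: "f x = 1" "\<And>y. y \<notin> U \<inter> - low p \<Longrightarrow> f y = 0"
          "\<And>y. cmod (f y) \<le> 1"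
          by (rule bump_bcontfun[OF cpt open_Int[OF U(1) open_Compl[OF closed_low]]
              IntI[OF xU iffD2[OF Compl_iff False]]]) (rule that)
        have "ell1_single f 0 \<in> subordinate p U" using f(2) by (auto simp: subordinate_def)
        moreover have "\<pi> (ell1_single f 0) (\<pi> c w) = hzero H" for c
          using supported_rep[OF low_invariant supp, of c] f(2) by (simp add: supported_def)
        moreover have "transform (ell1_single f 0) (x, l) \<noteq> 0" using f(1) by (simp add: transform_single)
        ultimately show ?thesis by blast
      next
        case xlow: True
        have iff: "int_iter \<sigma> (- n) x = x \<longleftrightarrow> int p dvd n" for n
          using per_iff(2)[OF xlow xU, of "- n"] by simp
        \<comment> \<open>Up to the factor \<open>g x\<close> the transform of \<open>comp c\<close>
          at \<open>(x, l)\<close> is the fiber sum of \<open>c\<close> over \<open>x\<close>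
          itself, which vanishes on the zero set.\<close>
        have "(x, l) \<notin> zero_set (rep_kernel H \<pi>)"
        proof
          assume "(x, l) \<in> zero_set (rep_kernel H \<pi>)"
          then have "fiber_sum \<sigma> c x l x = 0"
            using c mem_vanishing_ideal_iff[OF cpt homeo zero_set_kernel(1)] by blast
          then show False using tc by (simp add: fiber_sum_def iff)
        qed
        then obtain k where k: "k \<in> rep_kernel H \<pi>" "transform k (x, l) \<noteq> 0"
          using l by (auto simp: zero_set_def)
        have "transform (ell1_times \<sigma> k (ell1_of_cf (const_bcontfun 1))) (x, l) \<noteq> 0"
          using k(2) ell1_one_times(2)[OF homeo, of k] by (simp add: ell1_one_def ell1_of_cf_eq_single)
        then obtain z' where z': "fiber_sum \<sigma> k x l z' \<noteq> 0"
          using fiber_sum_eq_0_iff[OF cpt homeo l, of k x] by blast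
        have "\<exists>r. int_iter \<sigma> (- r) x = z'"
        proof (rule ccontr)
          assume "\<nexists>r. int_iter \<sigma> (- r) x = z'"
          then show False using z' by (simp add: fiber_sum_def)
        qed
        then obtain r where r: "int_iter \<sigma> (- r) x = z'" ..
        \<comment> \<open>The nonzero fiber of \<open>k\<close> may lie over another point of the
          orbit; multiplication by a power of \<open>delta\<close> moves it over \<open>x\<close>,
          where the transform of \<open>comp k'\<close> detects it.\<close>
        define k' where "k' = ell1_times \<sigma> k (ell1_single (const_bcontfun 1) (- r))"
        have k': "k' \<in> rep_kernel H \<pi>" unfolding k'_def by (rule kernel_times[OF k(1)])
        have "fiber_sum \<sigma> k x l z' =
            (\<Sum>\<^sub>\<infinity>n. if int_iter \<sigma> (- (n + r)) x = z' then l powi (n + r) * coeff k (n + r) x else 0)"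
          unfolding fiber_sum_def
          by (rule infsum_reindex_bij_betw[symmetric, of "\<lambda>n. n + r" UNIV UNIV])
             (rule bij_betw_byWitness[where f' = "\<lambda>n. n - r"], auto)
        also have "\<dots> = (\<Sum>\<^sub>\<infinity>n. l powi r * (if int p dvd n then l powi n * coeff k' n x else 0))"
        proof (rule infsum_cong)
          fix n
          have "int_iter \<sigma> (- (n + r)) x = int_iter \<sigma> (- r) (int_iter \<sigma> (- n) x)"
          proof -
            have "- (n + r) = - r + - n" by simp
            then show ?thesis by (simp only: int_iter_add[OF bij_\<sigma>])
          qed
          then have "int_iter \<sigma> (- (n + r)) x = z' \<longleftrightarrow> int p dvd n"
            unfolding r[symmetric] iff[symmetric] using bij_int_iter[OF bij_\<sigma>, of "- r"]
            by (metis bij_is_inj injD)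
          then show "(if int_iter \<sigma> (- (n + r)) x = z' then l powi (n + r) * coeff k (n + r) x else 0) =
              l powi r * (if int p dvd n then l powi n * coeff k' n x else 0)"
            using l0 by (simp add: k'_def coeff_times_single_right[OF homeo] const_bcontfun.rep_eq power_int_add)
        qed
        also have "\<dots> = l powi r * (\<Sum>\<^sub>\<infinity>n. if int p dvd n then l powi n * coeff k' n x else 0)"
          by (rule infsum_cmult_right')
        finally have "transform (comp k') (x, l) \<noteq> 0"
          using z' ex g0[of x] by (auto simp: tcomp)
        moreover have "\<pi> (comp k') (\<pi> c w) = hzero H" for c
          using k' compress[OF supported_rep[OF low_invariant supp], of k' c] wc
          by (simp add: rep_kernel_def rep_hzero)
        ultimately show ?thesis using comp_sub by blast
      qed
    qed
    have "mult_op e w = hzero H"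
    proof (rule core_eq_0[OF core_rep[OF w]])
      fix a assume a: "a \<in> hull_ideal"
      \<comment> \<open>Passing to \<open>a\<^sup>* a\<close>, again in the ideal, expresses the
        norm of \<open>\<pi> a (mult_op e w)\<close> by a compression.\<close>
      let ?c = "ell1_times \<sigma> (ell1_star \<sigma> a) a"
      have ew: "mult_op e w \<in> hcarrier H" using wc by simp
      have "(hnorm H (\<pi> a (mult_op e w)))\<^sup>2 = Re (hinner H (\<pi> ?c (mult_op e w)) (mult_op e w))"
        by (rule hnorm_rep_sq[OF ew])
      also have "\<dots> = Re (hinner H (mult_op (cf_cnj e) (\<pi> ?c (mult_op e w))) w)"
        using rep_star[of "\<pi> ?c (mult_op e w)" w "ell1_single e 0"] wc by (simp add: star_single_0)
      also have "\<dots> = 0"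
        using vanish[OF hull_ideal_times(2)[OF a]] wc by (simp add: compress[OF supp] inner_zero_left)
      finally show "\<pi> a (mult_op e w) = hzero H" using ew by (simp add: hnorm_eq_0_iff)
    qed
    then show ?thesis using e(1) by (intro exI[of _ e]) simp
  qed
  then have "mult_op f w = hzero H" if "\<forall>y\<in>low (p - 1). apply_bcontfun f y = 0" for f
    by (rule mult_op_vanish[OF wc]) (use that in blast)
  then show ?thesis using wc by (simp add: supported_def)
qed

lemma core_supported_low:
  assumes "w \<in> core" "supported w (low p)"
  shows "w = hzero H"
  using assms
proof (induction p)
  case 0
  have wc: "w \<in> hcarrier H" by (rule core_carrier[OF 0(1)])
  \<comment> \<open>\<open>low 0\<close> is empty, so \<open>w\<close> is killed by the unit and
    hence by the whole algebra.\<close>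
  have "\<pi> ell1_one w = hzero H" using 0(2) by (simp add: supported_def low_def ell1_one_def)
  then have "\<pi> b w = hzero H" for b
    using rep_times[OF wc, of b ell1_one] by (simp add: ell1_one_times[OF homeo] rep_hzero)
  then show ?case using core_eq_0[OF 0(1)] by blast
next
  case (Suc p)
  then show ?case using core_supported_step[of "Suc p" w] by simp
qed

text \<open>If the coefficient \<open>b0\<close> were nonzero at \<open>y\<close>, a vector
  \<open>v\<close> localised near a point of large period would satisfy both that \<open>b0\<close>
  shrinks it to at most \<open>\<epsilon>\<close> times its norm, by compression of
  \<open>\<pi> b = 0\<close>, and that \<open>b0\<close> has modulus above
  \<open>2 * \<epsilon>\<close> on its support.\<close>

lemma kernel_coeff_0_vanish:
  assumes b: "b \<in> rep_kernel H \<pi>"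
    and y: "\<And>f. (\<And>r. r \<in> core \<Longrightarrow> mult_op f r = hzero H) \<Longrightarrow> apply_bcontfun f y = 0"
  shows "coeff b 0 y = 0"
proof (rule ccontr)
  assume "coeff b 0 y \<noteq> 0"
  define b0 where "b0 = coeff b 0"
  \<comment> \<open>A quarter leaves room for \<open>b0\<close> to exceed
    \<open>2 * \<epsilon>\<close> on a whole neighbourhood of \<open>y\<close>, while the tail stays
    below \<open>\<epsilon>\<close>.\<close>
  define \<epsilon> where "\<epsilon> = cmod (b0 y) / 4"
  have \<epsilon>: "0 < \<epsilon>" "2 * \<epsilon> < cmod (b0 y)" using \<open>coeff b 0 y \<noteq> 0\<close> by (auto simp: \<epsilon>_def b0_def)
  define V where "V = {x. 2 * \<epsilon> < cmod (b0 x)}"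
  have V: "open V" "y \<in> V"
    unfolding V_def using \<epsilon>(2) by (auto intro!: open_Collect_less continuous_intros)
  obtain F where F: "finite F" "\<And>G. F \<subseteq> G \<Longrightarrow> norm (b - ell1_restrict G b) < \<epsilon>"
    using ell1_restrict_tail[OF \<epsilon>(1), of b] by blast
  define N where "N = nat (\<Sum>n\<in>F. \<bar>n\<bar>)"
  have "\<bar>n\<bar> \<le> int N" if "n \<in> F" for n
    using member_le_sum[OF that, of "\<lambda>n. \<bar>n\<bar>"] F(1) by (simp add: N_def sum_nonneg)
  then have "F \<subseteq> {- int N..int N}" by force
  define tail where "tail = b - ell1_restrict {- int N..int N} b"
  have tail: "norm tail < \<epsilon>" unfolding tail_def by (rule F(2)) fact
  define mid where "mid = ell1_restrict ({- int N..int N} - {0}) b"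
  have b_eq: "b = ell1_single b0 0 + (mid + tail)"
    by (rule ell1_eqI) (auto simp: b0_def mid_def tail_def)
  obtain f :: "'a \<Rightarrow>\<^sub>C complex" where f: "f y = 1" "\<And>x. x \<notin> V \<Longrightarrow> f x = 0"
    "\<And>y. cmod (f y) \<le> 1"
    by (rule bump_bcontfun[OF cpt V]) (rule that)
  obtain r where r: "r \<in> core" "mult_op f r \<noteq> hzero H"
    using y[of f] f(1) by auto
  have rc: "r \<in> hcarrier H" by (rule core_carrier[OF r(1)])
  \<comment> \<open>The exclusion of low periods enters here. It yields a point \<open>z\<close> in
    \<open>V\<close> outside \<open>low N\<close> at which every function killing \<open>r\<close>
    vanishes.\<close>
  have "\<not> supported (mult_op f r) (low N)"
    using core_supported_low[OF core_rep[OF r(1)]] r(2) by blast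
  then obtain g where g: "\<forall>x\<in>low N. apply_bcontfun g x = 0" "mult_op g (mult_op f r) \<noteq> hzero H"
    using rc unfolding supported_def by auto
  have "mult_op (cf_times g f) r \<noteq> hzero H" using g(2) rc by (simp add: mult_op_times)
  then obtain z where z: "g z * f z \<noteq> 0" "\<And>e. mult_op e r = hzero H \<Longrightarrow> apply_bcontfun e z = 0"
    using mult_op_vanish[OF rc, of "cf_times g f"] by auto
  have zV: "z \<in> V" "z \<notin> low N" using z(1) f(2) g(1) by auto
  have zj: "int_iter \<sigma> j z \<noteq> z" if j: "j \<in> {- int N..int N} - {0}" for j
  proof
    assume eq: "int_iter \<sigma> j z = z"
    then have "int_iter \<sigma> (- j) z = z" using int_iter_minus_cancel(1)[OF bij_\<sigma>, of j z] by simp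
    with eq have "int_iter \<sigma> (int (nat \<bar>j\<bar>)) z = z" by (cases "0 \<le> j") auto
    then have "z \<in> low N" using j unfolding low_def by (intro CollectI exI[of _ "nat \<bar>j\<bar>"]) auto
    with zV(2) show False ..
  qed
  obtain U where U: "open U" "z \<in> U"
    "\<And>j y. j \<in> {- int N..int N} - {0} \<Longrightarrow> y \<in> U \<Longrightarrow> int_iter \<sigma> j y \<notin> U"
    by (rule separating_neighbourhood[OF homeo, where F = "{- int N..int N} - {0}" and z = z])
       (simp, erule zj, rule that)
  obtain h :: "'a \<Rightarrow>\<^sub>C complex" where h: "h z = 1" "\<And>x. x \<notin> U \<inter> V \<Longrightarrow> h x = 0"
    "\<And>y. cmod (h y) \<le> 1"
    by (rule bump_bcontfun[OF cpt open_Int[OF U(1) V(1)] IntI[OF U(2) zV(1)]]) (rule that)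
  define v where "v = mult_op h r"
  have vc: "v \<in> hcarrier H" using rc by (simp add: v_def)
  have "v \<noteq> hzero H" using z(2)[of h] h(1) by (auto simp: v_def)
  then have v0: "0 < hnorm H v" using hnorm_nonneg[OF vc] hnorm_eq_0_iff[OF vc] by linarith
  let ?x = "mult_op b0 v"
  \<comment> \<open>The nonzero exponents of \<open>mid\<close> move points of \<open>U\<close> out
    of \<open>U\<close>, so \<open>h\<close> on both sides annihilates this part.\<close>
  have midx: "hinner H (\<pi> mid v) ?x = 0"
  proof -
    let ?e = "ell1_single (cf_times b0 h) 0"
    have "ell1_times \<sigma> (ell1_star \<sigma> ?e) (ell1_times \<sigma> mid (ell1_single h 0)) = 0"
    proof (intro ell1_eqI bcontfun_eqI)
      fix n x
      have "h x * (coeff mid n x * h (int_iter \<sigma> (- n) x)) = 0"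
      proof (cases "n \<in> {- int N..int N} - {0}")
        case True
        then have "- n \<in> {- int N..int N} - {0}" by auto
        then show ?thesis using U(3)[of "- n" x] h(2)[of x] h(2)[of "int_iter \<sigma> (- n) x"] by auto
      qed (auto simp: mid_def)
      then show "coeff (ell1_times \<sigma> (ell1_star \<sigma> ?e) (ell1_times \<sigma> mid (ell1_single h 0))) n x =
          coeff 0 n x"
        by (simp add: star_single_0 coeff_times_single_left[OF homeo] coeff_times_single_right[OF homeo])
    qed
    then have "\<pi> (ell1_star \<sigma> ?e) (\<pi> mid v) = hzero H"
      unfolding v_def using rc by (simp add: rep_times[symmetric] rep_0)
    then show ?thesis
      using rep_star[of "\<pi> mid v" r ?e] rc vc by (simp add: v_def mult_op_times inner_zero_left)
  qed
  have "hinner H (\<pi> b v) ?x = 0" using b vc by (simp add: rep_kernel_def inner_zero_left)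
  then have "hinner H ?x ?x + hinner H (\<pi> tail v) ?x = 0"
    unfolding b_eq using vc midx by (simp add: rep_add inner_simps)
  then have "Re (hinner H ?x ?x + hinner H (\<pi> tail v) ?x) = 0" by simp
  then have "(hnorm H ?x)\<^sup>2 = - Re (hinner H (\<pi> tail v) ?x)"
    using hnorm_power2[of ?x] vc by simp
  also have "\<dots> \<le> hnorm H (\<pi> tail v) * hnorm H ?x"
    using Cauchy_Schwarz[of "\<pi> tail v" ?x] abs_Re_le_cmod[of "hinner H (\<pi> tail v) ?x"] vc by simp
  also have "\<dots> \<le> (\<epsilon> * hnorm H v) * hnorm H ?x"
    using contractive[OF vc, of tail] tail v0 vc
    by (intro mult_right_mono) (auto intro: order_trans[OF _ mult_right_mono])
  finally have xx: "hnorm H ?x * hnorm H ?x \<le> (\<epsilon> * hnorm H v) * hnorm H ?x"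
    by (simp only: power2_eq_square)
  have xle: "hnorm H ?x \<le> \<epsilon> * hnorm H v"
  proof (cases "hnorm H ?x = 0")
    case False
    then have "0 < hnorm H ?x" using hnorm_nonneg[OF rep_closed[OF vc], of "ell1_single b0 0"] by linarith
    with xx show ?thesis by (rule mult_right_le_imp_le)
  qed (use \<epsilon>(1) v0 in simp)
  \<comment> \<open>A globally continuous substitute for the inverse of \<open>b0\<close>: exact on
    \<open>V\<close>, where the squared modulus exceeds \<open>4 * \<epsilon>\<^sup>2\<close>, and
    everywhere bounded by \<open>1 / (2 * \<epsilon>)\<close>.\<close>
  define k :: "'a \<Rightarrow>\<^sub>C complex"
    where "k = Bcontfun (\<lambda>x. cnj (b0 x) / complex_of_real (max ((cmod (b0 x))\<^sup>2) (4 * \<epsilon>\<^sup>2)))"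
  have mpos: "0 < max ((cmod (b0 x))\<^sup>2) (4 * \<epsilon>\<^sup>2)" for x using \<epsilon>(1) by (simp add: less_max_iff_disj)
  have k: "k x = cnj (b0 x) / complex_of_real (max ((cmod (b0 x))\<^sup>2) (4 * \<epsilon>\<^sup>2))" for x
  proof -
    have "max ((cmod (b0 x))\<^sup>2) (4 * \<epsilon>\<^sup>2) \<noteq> 0" for x using mpos[of x] by simp
    then have "continuous_on UNIV (\<lambda>x. cnj (b0 x) / complex_of_real (max ((cmod (b0 x))\<^sup>2) (4 * \<epsilon>\<^sup>2)))"
      by (intro continuous_intros) (simp_all del: max_def)
    then show ?thesis unfolding k_def by (simp add: apply_Bcontfun[OF continuous_imp_bcontfun[OF cpt]])
  qed
  have "cf_times k (cf_times b0 h) = h"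
  proof (rule bcontfun_eqI)
    fix x
    show "cf_times k (cf_times b0 h) x = h x"
    proof (cases "x \<in> V")
      case True
      then have "2 * \<epsilon> < cmod (b0 x)" by (simp add: V_def)
      then have "(2 * \<epsilon>)\<^sup>2 \<le> (cmod (b0 x))\<^sup>2" "b0 x \<noteq> 0"
        using \<epsilon>(1) power_mono[of "2 * \<epsilon>" "cmod (b0 x)" 2] by auto
      then have "k x * b0 x = 1"
        using complex_norm_square[of "b0 x"] by (simp add: k max_absorb1 power_mult_distrib mult.commute)
      then show ?thesis by (simp flip: mult.assoc)
    next
      case False
      then show ?thesis by (simp add: h(2))
    qed
  qed
  then have "v = mult_op k ?x" using rc by (simp add: v_def mult_op_times[symmetric])
  then have "hnorm H v \<le> norm k * hnorm H ?x"
    using contractive[of ?x "ell1_single k 0"] vc by simp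
  moreover have "norm k \<le> 1 / (2 * \<epsilon>)"
  proof (rule norm_bound)
    fix x
    have "cmod (b0 x) * (2 * \<epsilon>) \<le> max ((cmod (b0 x))\<^sup>2) (4 * \<epsilon>\<^sup>2)"
    proof (cases "cmod (b0 x) \<le> 2 * \<epsilon>")
      case True
      then have "cmod (b0 x) * (2 * \<epsilon>) \<le> (2 * \<epsilon>) * (2 * \<epsilon>)" using \<epsilon>(1) by (intro mult_right_mono) auto
      then show ?thesis by (simp add: power2_eq_square le_max_iff_disj)
    next
      case False
      then have "cmod (b0 x) * (2 * \<epsilon>) \<le> cmod (b0 x) * cmod (b0 x)" by (intro mult_left_mono) auto
      then show ?thesis by (simp add: power2_eq_square le_max_iff_disj)
    qed
    moreover have "cmod (k x) = cmod (b0 x) / max ((cmod (b0 x))\<^sup>2) (4 * \<epsilon>\<^sup>2)"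
      using mpos[of x] by (simp add: k norm_divide del: of_real_mult of_real_power of_real_numeral)
    ultimately show "cmod (k x) \<le> 1 / (2 * \<epsilon>)"
      using \<epsilon>(1) by (simp only: pos_divide_le_eq[OF mpos]) (simp add: field_simps)
  qed
  then have "norm k * hnorm H ?x \<le> 1 / (2 * \<epsilon>) * (\<epsilon> * hnorm H v)"
    using xle vc \<epsilon>(1) by (intro mult_mono) auto
  ultimately have "hnorm H v \<le> 1 / (2 * \<epsilon>) * (\<epsilon> * hnorm H v)" by (rule order_trans)
  then show False using v0 \<epsilon>(1) by simp
qed

theorem hull_ideal_subset_kernel: "hull_ideal \<subseteq> rep_kernel H \<pi>"
proof
  fix a assume a: "a \<in> hull_ideal"
  \<comment> \<open>The support of C(X) acting on \<open>core\<close>.\<close>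
  define Y where "Y = {y. \<forall>f. (\<forall>r\<in>core. mult_op f r = hzero H) \<longrightarrow> apply_bcontfun f y = 0}"
  have vanish: "coeff a n y = 0" if y: "y \<in> Y" and a: "a \<in> hull_ideal" for a n y
  proof -
    have "(y, l) \<in> zero_set (rep_kernel H \<pi>)" if l: "cmod l = 1" for l
    proof -
      have "coeff b m y = 0" if b: "b \<in> rep_kernel H \<pi>" for b m
      proof -
        have "coeff (ell1_times \<sigma> b (ell1_single (const_bcontfun 1) (- m))) 0 y = 0"
          by (rule kernel_coeff_0_vanish[OF kernel_times[OF b]]) (use y in \<open>auto simp: Y_def\<close>)
        then show ?thesis by (simp add: coeff_times_single_right[OF homeo] const_bcontfun.rep_eq)
      qed
      then show ?thesis using l by (auto simp: zero_set_def transform_def)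
    qed
    then have "transform (ell1_times \<sigma> a (ell1_of_cf (const_bcontfun 1))) (y, l) = 0" if "cmod l = 1" for l
      using a that unfolding vanishing_ideal_def by blast
    then have "transform a (y, l) = 0" if "cmod l = 1" for l
      using that ell1_one_times(2)[OF homeo, of a] by (simp add: ell1_one_def ell1_of_cf_eq_single)
    then show ?thesis by (rule coeff_eq_0_transform)
  qed
  have core0: "r = hzero H" if r: "r \<in> core" for r
  proof (rule core_eq_0[OF r])
    fix b assume b: "b \<in> hull_ideal"
    note rc = core_carrier[OF r]
    have "b \<in> {b. \<pi> b r = hzero H}"
    proof (rule ell1_closed_induct[OF closed_annihilator[OF rc]])
      fix n
      let ?s = "ell1_single (const_bcontfun 1) n"
      \<comment> \<open>The coefficient vanishes on \<open>Y\<close>; off \<open>Y\<close> some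
        function kills all of \<open>core\<close>, in particular \<open>\<pi> ?s r\<close>. So
        \<open>mult_op_vanish\<close> applies.\<close>
      have "mult_op (coeff b n) (\<pi> ?s r) = hzero H"
      proof (rule mult_op_vanish)
        show "\<pi> ?s r \<in> hcarrier H" using rc by simp
        fix z assume "coeff b n z \<noteq> 0"
        then have "z \<notin> Y" using vanish[OF _ b] by blast
        then obtain f where "\<forall>r\<in>core. mult_op f r = hzero H" "apply_bcontfun f z \<noteq> 0"
          unfolding Y_def by blast
        then show "\<exists>e. mult_op e (\<pi> ?s r) = hzero H \<and> apply_bcontfun e z \<noteq> 0"
          using core_rep[OF r] by blast
      qed
      moreover have "ell1_single (coeff b n) n = ell1_times \<sigma> (ell1_single (coeff b n) 0) ?s"
        by (intro ell1_eqI bcontfun_eqI) (simp add: coeff_times_single_left[OF homeo] const_bcontfun.rep_eq)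
      ultimately show "ell1_single (coeff b n) n \<in> {b. \<pi> b r = hzero H}"
        using rc by (simp add: rep_times)
    qed (use rc in \<open>auto simp: rep_0 rep_add add_zero closed\<close>)
    then show "\<pi> b r = hzero H" by simp
  qed
  show "a \<in> rep_kernel H \<pi>"
    unfolding rep_kernel_def using core0 rep_hull_ideal_core[OF a] by blast
qed

end

section \<open>The ideals of points\<close>

context orbit_action
begin

lemma act_single_ket:
  assumes "k \<in> J"
  shows "act (ell1_single f m) (ket k) = (\<lambda>j. c m (\<rho> m k) * f (q (\<rho> m k)) * ket (\<rho> m k) j)"
proof
  fix j
  show "act (ell1_single f m) (ket k) j = c m (\<rho> m k) * f (q (\<rho> m k)) * ket (\<rho> m k) j"
  proof (cases "j \<in> J")
    case True
    have "\<rho> (- m) j = k \<longleftrightarrow> j = \<rho> m k"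
      using \<rho>_inverse[OF True, of m] \<rho>_inverse[OF assms, of m] by auto
    then show ?thesis using True by (auto simp: act_single ket_def)
  next
    case False
    then show ?thesis using \<rho>_closed[OF assms, of m] by (auto simp: act_def ket_def)
  qed
qed

text \<open>The representations of points are specified on \<open>delta\<close> and on functions
  only. Together with the inverse of \<open>delta\<close> these generate all monomials, so the
  specification fixes the matrix entries.\<close>

lemma rep_kernel_eq_generators:
  assumes \<pi>: "involutive_rep \<sigma> (ell2 J) \<pi>"
    and cf: "\<And>f k. k \<in> J \<Longrightarrow> \<pi> (ell1_of_cf f) (ket k) = act (ell1_of_cf f) (ket k)"
    and delta: "\<And>k. k \<in> J \<Longrightarrow> \<pi> delta (ket k) = act delta (ket k)"
  shows "rep_kernel (ell2 J) \<pi> = {a. \<forall>j\<in>J. \<forall>k\<in>J. act a (ket k) j = 0}"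
proof (rule rep_kernel_eq[OF \<pi>])
  interpret R: complex_inner_space "ell2 J" by (rule ell2_inner_space)
  interpret R: inv_rep "ell2 J" \<sigma> \<pi> by unfold_locales (rule homeo \<pi>)+
  interpret A: inv_rep "ell2 J" \<sigma> act by unfold_locales (rule homeo involutive_rep_act)+
  define s where "s m = (ell1_single (const_bcontfun 1) m :: 'a ell1)" for m
  have times_s: "ell1_times \<sigma> (ell1_single f m) (s n) = ell1_single f (m + n)" for f m n
    by (intro ell1_eqI bcontfun_eqI)
       (auto simp: s_def coeff_times_single_left[OF homeo] const_bcontfun.rep_eq)
  have ds: "delta = s 1" "ell1_of_cf f = ell1_single f 0" for f
    by (simp_all add: s_def delta_eq_single ell1_of_cf_eq_single)
  have s_ket: "act (s m) (ket k) = hscale (ell2 J) (c m (\<rho> m k)) (ket (\<rho> m k))" if "k \<in> J" for m k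
    unfolding s_def act_single_ket[OF that] by (simp add: const_bcontfun.rep_eq)
  have comp: "\<pi> (ell1_times \<sigma> b (s m)) (ket k) = act (ell1_times \<sigma> b (s m)) (ket k)"
    if b: "\<And>k. k \<in> J \<Longrightarrow> \<pi> b (ket k) = act b (ket k)"
      and m: "\<And>k. k \<in> J \<Longrightarrow> \<pi> (s m) (ket k) = act (s m) (ket k)" and k: "k \<in> J" for b m k
  proof -
    have "\<pi> (ell1_times \<sigma> b (s m)) (ket k) = \<pi> b (hscale (ell2 J) (c m (\<rho> m k)) (ket (\<rho> m k)))"
      by (simp only: R.rep_times[OF ket_carrier[OF k]] m[OF k] s_ket[OF k])
    also have "\<dots> = hscale (ell2 J) (c m (\<rho> m k)) (act b (ket (\<rho> m k)))"
      by (simp only: R.rep_hscale[OF ket_carrier[OF \<rho>_closed[OF k]]] b[OF \<rho>_closed[OF k]])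
    also have "\<dots> = act b (act (s m) (ket k))"
      by (simp only: A.rep_hscale[OF ket_carrier[OF \<rho>_closed[OF k]]] s_ket[OF k])
    also have "\<dots> = act (ell1_times \<sigma> b (s m)) (ket k)"
      by (simp only: A.rep_times[OF ket_carrier[OF k]])
    finally show ?thesis .
  qed
  have s0: "\<pi> (s 0) (ket k) = act (s 0) (ket k)" if "k \<in> J" for k
    using cf[OF that, of "const_bcontfun 1"] by (simp add: ds s_def)
  have s1: "\<pi> (s 1) (ket k) = act (s 1) (ket k)" if "k \<in> J" for k
    using delta[OF that] by (simp add: ds)
  \<comment> \<open>The inverse of \<open>delta\<close> is not part of the specification. Its value
    at \<open>ket k\<close> follows because \<open>ket k\<close> is, up to a unit scalar, the image
    under \<open>delta\<close> of the preceding basis vector.\<close>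
  have sm1: "\<pi> (s (- 1)) (ket k) = act (s (- 1)) (ket k)" if k: "k \<in> J" for k
  proof -
    let ?k = "\<rho> (- 1) k"
    have k': "?k \<in> J" by (rule \<rho>_closed[OF k])
    have dk: "act (s 1) (ket ?k) = hscale (ell2 J) (c 1 k) (ket k)"
      using s_ket[OF k', of 1] \<rho>_inverse(1)[OF k, of 1] by simp
    have e: "s 0 = ell1_times \<sigma> (s (- 1)) (s 1)" using times_s[of "const_bcontfun 1" "- 1" 1] by (simp add: s_def)
    have "hscale (ell2 J) (c 1 k) (\<pi> (s (- 1)) (ket k)) = \<pi> (s 0) (ket ?k)"
      unfolding e by (simp only: R.rep_times[OF ket_carrier[OF k']] s1[OF k'] dk R.rep_hscale[OF ket_carrier[OF k]])
    also have "\<dots> = hscale (ell2 J) (c 1 k) (act (s (- 1)) (ket k))"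
      unfolding s0[OF k'] unfolding e
      by (simp only: A.rep_times[OF ket_carrier[OF k']] dk A.rep_hscale[OF ket_carrier[OF k]])
    finally show ?thesis using c_norm[OF k, of 1] by (auto simp: fun_eq_iff)
  qed
  have s_all: "\<forall>k\<in>J. \<pi> (s m) (ket k) = act (s m) (ket k)" for m
  proof (induction m rule: int_induct[where k = 0])
    case (step1 i)
    have "s (i + 1) = ell1_times \<sigma> (s 1) (s i)"
      using times_s[of "const_bcontfun 1" 1 i] by (simp add: s_def add.commute)
    then show ?case using comp[of "s 1" i] s1 step1 by simp
  next
    case (step2 i)
    have "s (i - 1) = ell1_times \<sigma> (s (- 1)) (s i)"
      using times_s[of "const_bcontfun 1" "- 1" i] by (simp add: s_def)
    then show ?case using comp[of "s (- 1)" i] sm1 step2 by simp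
  qed (use s0 in simp)
  fix f m k j assume "k \<in> J" "j \<in> J"
  then show "\<pi> (ell1_single f m) (ket k) j = act (ell1_single f m) (ket k) j"
    using comp[of "ell1_single f 0" m k] cf s_all[of m] times_s[of f 0 m] by (simp add: ds)
qed

end

section \<open>Membership in the ideals of aperiodic and of periodic points\<close>

lemma Aper_int_iter_inj:
  assumes "bij \<sigma>" "x \<in> Aper \<sigma>" "int_iter \<sigma> m x = int_iter \<sigma> n x"
  shows "m = n"
proof -
  have *: "\<not> i < j" if "int_iter \<sigma> i x = int_iter \<sigma> j x" for i j
  proof
    assume "i < j"
    have "int_iter \<sigma> (j - i) x = int_iter \<sigma> (- i) (int_iter \<sigma> j x)"
      using int_iter_add[OF assms(1), of "- i" j x] by simp
    also have "\<dots> = x" by (simp flip: that add: int_iter_minus_cancel[OF assms(1)])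
    finally have "(\<sigma> ^^ nat (j - i)) x = x" using \<open>i < j\<close> by (simp add: int_iter_def)
    moreover have "0 < nat (j - i)" using \<open>i < j\<close> by simp
    ultimately show False using assms(2) by (auto simp: Aper_def)
  qed
  show ?thesis using *[of m n] *[of n m] assms(3) by force
qed

text \<open>On an aperiodic orbit each fiber holds at most one exponent, so a fiber sum is a single
  coefficient times a phase. Hence one unit scalar \<open>l\<close>, whichever it is, describes the
  ideal.\<close>

lemma mem_P_aper_iff:
  fixes \<sigma> :: "'a::topological_space \<Rightarrow> 'a"
  assumes h: "homeomorphism UNIV UNIV \<sigma> (inv \<sigma>)" and x: "x \<in> Aper \<sigma>" and l: "cmod l = 1"
  shows "a \<in> P_aper \<sigma> x \<longleftrightarrow> (\<forall>y\<in>orbit \<sigma> x. \<forall>z. fiber_sum \<sigma> a y l z = 0)"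
proof -
  have b: "bij \<sigma>" by (rule homeomorphism_imp[OF h])
  interpret orbit_action \<sigma> UNIV "\<lambda>n k. k + n" "\<lambda>k. int_iter \<sigma> k x" "\<lambda>_ _. 1"
  proof
    show "int_iter \<sigma> (j + n) x = int_iter \<sigma> n (int_iter \<sigma> j x)" for j n
      unfolding add.commute[of j] by (rule int_iter_add[OF b])
  qed (auto simp: h)
  let ?spec = "\<lambda>\<pi>. involutive_rep \<sigma> (ell2 UNIV) \<pi> \<and> (\<forall>k. \<pi> delta (ket k) = ket (k + 1)) \<and>
     (\<forall>f k. \<pi> (ell1_of_cf f) (ket k) = hscale (ell2 UNIV) (apply_bcontfun f (int_iter \<sigma> k x)) (ket k))"
  have delta: "act delta (ket k) = ket (k + 1)" for k
    unfolding delta_eq_single by (subst act_single_ket) (auto simp: const_bcontfun.rep_eq)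
  have cf: "act (ell1_of_cf f) (ket k) = hscale (ell2 UNIV) (f (int_iter \<sigma> k x)) (ket k)" for f k
    unfolding ell1_of_cf_eq_single by (subst act_single_ket) auto
  have "?spec act" by (intro conjI allI involutive_rep_act delta cf)
  then have "?spec (rep_aper \<sigma> x)" unfolding rep_aper_def by (rule someI[where P = ?spec and x = act])
  then have "rep_kernel (ell2 UNIV) (rep_aper \<sigma> x) = {a. \<forall>j\<in>UNIV. \<forall>k\<in>UNIV. act a (ket k) j = 0}"
    by (intro rep_kernel_eq_generators) (simp_all only: delta cf)
  moreover have "act a (ket k) j = coeff a (j - k) (int_iter \<sigma> j x)" for j k
    unfolding act_ket[OF UNIV_I] by (subst infsum_singleI[of "j - k"]) auto
  ultimately have "a \<in> P_aper \<sigma> x \<longleftrightarrow> (\<forall>j k. coeff a (j - k) (int_iter \<sigma> j x) = 0)"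
    by (simp add: P_aper_def)
  also have "\<dots> \<longleftrightarrow> (\<forall>j n. coeff a n (int_iter \<sigma> j x) = 0)"
    by (metis diff_diff_eq2 diff_add_cancel add_diff_cancel_left')
  also have "\<dots> \<longleftrightarrow> (\<forall>j z. fiber_sum \<sigma> a (int_iter \<sigma> j x) l z = 0)"
  proof
    assume "\<forall>j z. fiber_sum \<sigma> a (int_iter \<sigma> j x) l z = 0"
    moreover have "fiber_sum \<sigma> a (int_iter \<sigma> j x) l (int_iter \<sigma> (j - n) x) =
        l powi n * coeff a n (int_iter \<sigma> j x)" for j n
    proof -
      have "int_iter \<sigma> (- i) (int_iter \<sigma> j x) = int_iter \<sigma> (j - n) x \<longleftrightarrow> i = n" for i
        using Aper_int_iter_inj[OF b x, of "- i + j" "j - n"] by (auto simp flip: int_iter_add[OF b])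
      then show ?thesis unfolding fiber_sum_def by (subst infsum_singleI[of n]) auto
    qed
    moreover have "l \<noteq> 0" using l by auto
    ultimately show "\<forall>j n. coeff a n (int_iter \<sigma> j x) = 0"
      by (metis mult_eq_0_iff power_int_eq_0_iff)
  qed (simp add: fiber_sum_def cong: if_cong)
  also have "\<dots> \<longleftrightarrow> (\<forall>y\<in>orbit \<sigma> x. \<forall>z. fiber_sum \<sigma> a y l z = 0)"
    by (auto simp: orbit_def)
  finally show ?thesis .
qed

text \<open>The scalar \<open>m\<close> of the zero set multiplies every step along the orbit,
  whereas the representation multiplies only the return to the start. Going once around the orbit
  gives \<open>m ^ period \<sigma> x\<close> in both pictures.\<close>

lemma mem_P_per_iff:
  fixes \<sigma> :: "'a::topological_space \<Rightarrow> 'a"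
  assumes h: "homeomorphism UNIV UNIV \<sigma> (inv \<sigma>)" and x: "x \<in> Per \<sigma>" and m: "cmod m = 1"
  shows "a \<in> P_per \<sigma> x (m ^ period \<sigma> x) \<longleftrightarrow> (\<forall>y\<in>orbit \<sigma> x. \<forall>z. fiber_sum \<sigma> a y m z = 0)"
proof -
  have b: "bij \<sigma>" by (rule homeomorphism_imp[OF h])
  define p where "p = period \<sigma> x"
  define l where "l = m ^ p"
  have l1: "cmod l = 1" using m by (simp add: l_def norm_power)
  have l0: "l \<noteq> 0" and m0: "m \<noteq> 0" using l1 m by auto
  have "\<exists>n>0. (\<sigma> ^^ n) x = x" using x by (simp add: Per_def)
  from LeastI_ex[OF this] have p: "0 < p" "(\<sigma> ^^ p) x = x"
    by (auto simp: p_def period_def)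
  have least: "(\<sigma> ^^ n) x \<noteq> x" if "0 < n" "n < p" for n
    using not_less_Least[of n "\<lambda>n. 0 < n \<and> (\<sigma> ^^ n) x = x"] that by (auto simp: p_def period_def)
  have per: "int_iter \<sigma> (int p) x = x" using p(2) by (simp add: int_iter_of_nat)
  have nonper: "int_iter \<sigma> j x \<noteq> x" if "0 < j" "j < int p" for j
    using least[of "nat j"] that by (simp add: int_iter_def)
  note per_mod = int_iter_eq_self_iff(1)[OF b p(1) per nonper]
  have per_iff: "int_iter \<sigma> i x = int_iter \<sigma> j x \<longleftrightarrow> i mod int p = j mod int p" for i j
  proof
    assume "int_iter \<sigma> i x = int_iter \<sigma> j x"
    then have "int_iter \<sigma> (i - j) x = x"
      using int_iter_add[OF b, of "- j" i x] int_iter_add[OF b, of "- j" j x] by simp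
    then have "int p dvd i - j" using int_iter_eq_self_iff(2)[OF b p(1) per nonper] by blast
    then show "i mod int p = j mod int p" by (simp add: mod_eq_dvd_iff)
  next
    assume "i mod int p = j mod int p"
    then show "int_iter \<sigma> i x = int_iter \<sigma> j x" using per_mod[of i] per_mod[of j] by simp
  qed
  define \<rho> where "\<rho> n k = nat ((int k + n) mod int p)" for n and k :: nat
  \<comment> \<open>The exponent counts the returns from \<open>p - 1\<close> to \<open>0\<close>
    during \<open>n\<close> steps that end at \<open>k\<close>.\<close>
  define c where "c n k = l powi (- ((int k - n) div int p))" for n and k :: nat
  have int_\<rho>: "int (\<rho> n k) = (int k + n) mod int p" for n k using p(1) by (simp add: \<rho>_def)
  interpret orbit_action \<sigma> "{..<p}" \<rho> "\<lambda>k. (\<sigma> ^^ k) x" c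
  proof
    show "homeomorphism UNIV UNIV \<sigma> (inv \<sigma>)" by (rule h)
    fix j n n' assume "j \<in> {..<p}"
    then have j: "j < p" by simp
    show "\<rho> n j \<in> {..<p}" using p(1) by (simp add: \<rho>_def nat_less_iff)
    show "\<rho> 0 j = j" using j by (simp add: \<rho>_def)
    have "int (\<rho> (n + n') j) = int (\<rho> n (\<rho> n' j))"
      unfolding int_\<rho> mod_add_left_eq by (simp add: add_ac)
    then show "\<rho> (n + n') j = \<rho> n (\<rho> n' j)" by simp
    have "int_iter \<sigma> (int (\<rho> n j)) x = int_iter \<sigma> n (int_iter \<sigma> (int j) x)"
      using per_mod[of "n + int j"] by (simp add: int_\<rho> int_iter_add[OF b] add.commute[of "int j"])
    then show "(\<sigma> ^^ \<rho> n j) x = int_iter \<sigma> n ((\<sigma> ^^ j) x)" by (simp add: int_iter_of_nat)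
    show "cmod (c n j) = 1" by (simp add: c_def norm_power_int l1)
    \<comment> \<open>Reducing the intermediate index modulo \<open>p\<close> shifts the quotient by
      a whole number, so the returns of two successive moves add up; this is the cocycle
      identity.\<close>
    have "int j - n - n' = (int j - n) mod int p - n' + int p * ((int j - n) div int p)"
      using mult_div_mod_eq[of "int p" "int j - n"] by linarith
    then have "(int j - n - n') div int p =
        ((int j - n) mod int p - n' + int p * ((int j - n) div int p)) div int p"
      by (rule arg_cong)
    also have "\<dots> = (int j - n) div int p + ((int j - n) mod int p - n') div int p"
      by (rule div_mult_self2) (use p(1) in simp)
    finally have "- ((int j - (n + n')) div int p) =
        - ((int j - n) div int p) + - ((int (\<rho> (- n) j) - n') div int p)"
      by (simp add: int_\<rho> diff_diff_eq)
    then show "c (n + n') j = c n j * c n' (\<rho> (- n) j)"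
      by (simp only: c_def power_int_add[OF disjI1[OF l0]])
  qed
  let ?H = "ell2 {..<p}"
  let ?spec = "\<lambda>\<pi>. involutive_rep \<sigma> ?H \<pi> \<and> (\<forall>k < p - 1. \<pi> delta (ket k) = ket (k + 1)) \<and>
       \<pi> delta (ket (p - 1)) = hscale ?H l (ket 0) \<and>
       (\<forall>f. \<forall>k<p. \<pi> (ell1_of_cf f) (ket k) = hscale ?H (apply_bcontfun f ((\<sigma> ^^ k) x)) (ket k))"
  have delta1: "act delta (ket k) = ket (k + 1)" if "k < p - 1" for k
  proof -
    have "\<rho> 1 k = k + 1" "c 1 (k + 1) = 1" using that by (auto simp: \<rho>_def c_def nat_add_distrib)
    then show ?thesis
      unfolding delta_eq_single using that by (subst act_single_ket) (auto simp: const_bcontfun.rep_eq)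
  qed
  have delta2: "act delta (ket (p - 1)) = hscale ?H l (ket 0)"
  proof -
    have "\<rho> 1 (p - 1) = 0" "c 1 0 = l" using p(1) by (auto simp: \<rho>_def c_def of_nat_diff div_eq_minus1 )
    then show ?thesis
      unfolding delta_eq_single using p(1) by (subst act_single_ket) (auto simp: const_bcontfun.rep_eq)
  qed
  have cf: "act (ell1_of_cf f) (ket k) = hscale ?H (f ((\<sigma> ^^ k) x)) (ket k)" if "k < p" for f k
    unfolding ell1_of_cf_eq_single using that by (subst act_single_ket) (auto simp: \<rho>_0 c_0)
  have "?spec act" by (intro conjI allI impI involutive_rep_act delta1 delta2 cf)
  then have spec: "?spec (rep_per \<sigma> x l)"
    unfolding rep_per_def Let_def p_def[symmetric] by (rule someI[where P = ?spec and x = act])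
  have deltas: "rep_per \<sigma> x l delta (ket k) = act delta (ket k)" if "k \<in> {..<p}" for k
    using spec delta1[of k] delta2 that by (cases "k < p - 1") (auto, metis Suc_pred less_antisym p(1))
  have "rep_kernel ?H (rep_per \<sigma> x l) = {a. \<forall>j\<in>{..<p}. \<forall>k\<in>{..<p}. act a (ket k) j = 0}"
    by (rule rep_kernel_eq_generators) (use spec deltas cf in \<open>auto simp del: ell2_sel\<close>)
  then have "a \<in> P_per \<sigma> x l \<longleftrightarrow> (\<forall>j<p. \<forall>k<p. act a (ket k) j = 0)"
    unfolding P_per_def p_def[symmetric] by auto
  also have "\<dots> \<longleftrightarrow> (\<forall>j<p. \<forall>k<p. fiber_sum \<sigma> a (int_iter \<sigma> (int j) x) m (int_iter \<sigma> (int k) x) = 0)"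
  proof -
    \<comment> \<open>The diagonal unitary with entries \<open>m ^ j\<close> relates the two ways of
      placing the phase; it changes each matrix entry by a nonzero factor only.\<close>
    have "fiber_sum \<sigma> a (int_iter \<sigma> (int j) x) m (int_iter \<sigma> (int k) x) =
        m powi (int j - int k) * act a (ket k) j" if "j < p" "k < p" for j k
    proof -
      have "(if int_iter \<sigma> (- n) (int_iter \<sigma> (int j) x) = int_iter \<sigma> (int k) x
          then m powi n * coeff a n (int_iter \<sigma> (int j) x) else 0) =
        m powi (int j - int k) * (if \<rho> (- n) j = k then c n j * coeff a n ((\<sigma> ^^ j) x) else 0)" for n
      proof -
        have "int_iter \<sigma> (- n) (int_iter \<sigma> (int j) x) = int_iter \<sigma> (int j - n) x"
          by (simp flip: int_iter_add[OF b])
        then have iff: "int_iter \<sigma> (- n) (int_iter \<sigma> (int j) x) = int_iter \<sigma> (int k) x \<longleftrightarrow>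
            (int j - n) mod int p = int k"
          using per_iff[of "int j - n" "int k"] that(2) by simp
        have iff': "\<rho> (- n) j = k \<longleftrightarrow> (int j - n) mod int p = int k"
          using int_\<rho>[of "- n" j] by auto
        have "m powi n = m powi (int j - int k) * c n j" if "(int j - n) mod int p = int k"
        proof -
          have "n = (int j - int k) + int p * (- ((int j - n) div int p))"
            using mult_div_mod_eq[of "int p" "int j - n"] that by simp
          then have "m powi n = m powi (int j - int k) * m powi (int p * (- ((int j - n) div int p)))"
            using power_int_add[OF disjI1[OF m0]] by metis
          then show ?thesis by (simp only: c_def l_def power_int_mult power_int_of_nat)
        qed
        then show ?thesis unfolding iff iff' by (simp add: int_iter_of_nat)
      qed
      then show ?thesis
        unfolding fiber_sum_def using that
        by (subst act_ket) (auto simp: infsum_cmult_right' simp flip: infsum_cmult_right')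
    qed
    then show ?thesis using m0 by simp
  qed
  also have "\<dots> \<longleftrightarrow> (\<forall>y\<in>orbit \<sigma> x. \<forall>z. fiber_sum \<sigma> a y m z = 0)"
  proof -
    have orb: "orbit \<sigma> x = (\<lambda>j. int_iter \<sigma> (int j) x) ` {..<p}"
    proof -
      have "int_iter \<sigma> n x = int_iter \<sigma> (int (nat (n mod int p))) x" "nat (n mod int p) < p" for n
        using per_mod[of n] p(1) by (auto simp: nat_less_iff)
      then show ?thesis unfolding orbit_def by blast
    qed
    have "fiber_sum \<sigma> a y m z = 0" if "y \<in> orbit \<sigma> x" "z \<notin> orbit \<sigma> x" for y z
    proof -
      obtain i where "y = int_iter \<sigma> i x" using \<open>y \<in> orbit \<sigma> x\<close> by (auto simp: orbit_def)
      then have "int_iter \<sigma> (- n) y \<in> orbit \<sigma> x" for n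
        by (simp add: orbit_def flip: int_iter_add[OF b])
      then have "int_iter \<sigma> (- n) y \<noteq> z" for n using \<open>z \<notin> orbit \<sigma> x\<close> by auto
      then show ?thesis by (simp add: fiber_sum_def)
    qed
    then have "(\<forall>y\<in>orbit \<sigma> x. \<forall>z. fiber_sum \<sigma> a y m z = 0) \<longleftrightarrow>
        (\<forall>y\<in>orbit \<sigma> x. \<forall>z\<in>orbit \<sigma> x. fiber_sum \<sigma> a y m z = 0)"
      by metis
    also have "\<dots> \<longleftrightarrow>
        (\<forall>j<p. \<forall>k<p. fiber_sum \<sigma> a (int_iter \<sigma> (int j) x) m (int_iter \<sigma> (int k) x) = 0)"
      unfolding orb by (simp, simp only: Ball_def lessThan_iff)
    finally show ?thesis by (rule sym)
  qed
  finally show ?thesis by (simp add: l_def p_def)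
qed

section \<open>The Galois connection\<close>

lemma closed_zero_set: "closed (zero_set (I :: 'a::t2_space ell1 set))"
proof -
  let ?\<Omega> = "UNIV \<times> sphere 0 1 :: ('a \<times> complex) set"
  have "closed {z \<in> ?\<Omega>. transform a z = 0}" for a :: "'a ell1"
    by (rule continuous_closed_preimage_constant[OF continuous_on_transform]) (simp add: closed_Times)
  then have "closed (?\<Omega> \<inter> (\<Inter>a\<in>I. {z \<in> ?\<Omega>. transform a z = 0}))"
    by (intro closed_Int closed_INT closed_Times ballI) auto
  moreover have "?\<Omega> \<inter> (\<Inter>a\<in>I. {z \<in> ?\<Omega>. transform a z = 0}) = zero_set I"
    by (auto simp: zero_set_def)
  ultimately show ?thesis by simp
qed

lemma subset_vanishing_ideal_zero_set:
  assumes "I \<in> closed_ideals \<sigma>"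
  shows "I \<subseteq> vanishing_ideal \<sigma> (zero_set I)"
  using assms by (auto simp: vanishing_ideal_def zero_set_def closed_ideals_def)

lemma zero_set_vanishing_ideal:
  assumes h: "homeomorphism UNIV UNIV \<sigma> (inv \<sigma>)" and I: "I \<in> closed_ideals \<sigma>"
  shows "zero_set (vanishing_ideal \<sigma> (zero_set I)) = zero_set I"
proof
  show "zero_set (vanishing_ideal \<sigma> (zero_set I)) \<subseteq> zero_set I"
    using subset_vanishing_ideal_zero_set[OF I] by (auto simp: zero_set_def)
  have "transform a z = 0" if "a \<in> vanishing_ideal \<sigma> (zero_set I)" "z \<in> zero_set I" for a z
  proof -
    have "transform (ell1_times \<sigma> a (ell1_of_cf (const_bcontfun 1))) z = 0"
      using that unfolding vanishing_ideal_def by blast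
    then show ?thesis
      using ell1_one_times(2)[OF h, of a] by (simp add: ell1_one_def ell1_of_cf_eq_single)
  qed
  then show "zero_set I \<subseteq> zero_set (vanishing_ideal \<sigma> (zero_set I))"
    using zero_set_subset[of I] unfolding zero_set_def[of "vanishing_ideal \<sigma> (zero_set I)"] by blast
qed

lemma invrep_kernels_properties:
  fixes \<sigma> :: "'a::t2_space \<Rightarrow> 'a"
  assumes cpt: "compact (UNIV :: 'a set)" and h: "homeomorphism UNIV UNIV \<sigma> (inv \<sigma>)"
    and K: "K \<in> invrep_kernels TYPE('h) \<sigma>"
  shows "K \<in> closed_ideals \<sigma>" "vanishing_ideal \<sigma> (zero_set K) = K"
proof -
  obtain H :: "('h + ('a \<times> int \<times> complex \<Rightarrow> complex)) cspace" and \<pi>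
    where H: "inv_rep H \<sigma> \<pi>" "K = rep_kernel H \<pi>"
    by (rule invrep_kernelsE[OF h K])
  interpret inv_rep H \<sigma> \<pi> by (rule H(1))
  interpret inv_rep_compact H \<sigma> \<pi> by unfold_locales (rule cpt)
  show K': "K \<in> closed_ideals \<sigma>" unfolding H(2) by (rule rep_kernel_closed_ideal)
  show "vanishing_ideal \<sigma> (zero_set K) = K"
    using subset_vanishing_ideal_zero_set[OF K'] hull_ideal_subset_kernel unfolding H(2) by blast
qed

text \<open>For \<open>x\<close> in \<open>Sap\<close> the ideal does not depend on the scalar, so
  \<open>T x\<close> disappears from the right-hand side. It must be nonempty there: otherwise
  \<open>x\<close> would contribute nothing to \<open>S\<close> but still cut down the
  intersection.\<close>

lemma vanishing_ideal_zero_set_eq_Inter: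
  fixes \<sigma> :: "'a::t2_space \<Rightarrow> 'a"
  assumes cpt: "compact (UNIV :: 'a set)" and h: "homeomorphism UNIV UNIV \<sigma> (inv \<sigma>)"
    and Sap: "Sap \<subseteq> Aper \<sigma>" and Sp: "Sp \<subseteq> Per \<sigma>"
    and T: "\<forall>x\<in>Sap \<union> Sp. T x \<subseteq> sphere 0 1" "\<forall>x\<in>Sap. T x \<noteq> {}"
    and S: "S = (\<Union>x\<in>Sap. \<Union>l\<in>T x. orbit \<sigma> x \<times> {l}) \<union> (\<Union>x\<in>Sp. \<Union>m\<in>T x. orbit \<sigma> x \<times> {m})"
  shows "vanishing_ideal \<sigma> S =
    (\<Inter>x\<in>Sap. P_aper \<sigma> x) \<inter> (\<Inter>x\<in>Sp. \<Inter>m\<in>T x. P_per \<sigma> x (m ^ period \<sigma> x))"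
proof -
  have sub: "S \<subseteq> UNIV \<times> sphere 0 1" unfolding S using T(1) by blast
  have unit: "cmod l = 1" if "x \<in> Sap \<union> Sp" "l \<in> T x" for x l
    using T(1) that by (metis in_mono mem_sphere_0)
  have ap: "a \<in> P_aper \<sigma> x \<longleftrightarrow> (\<forall>l\<in>T x. \<forall>y\<in>orbit \<sigma> x. \<forall>z. fiber_sum \<sigma> a y l z = 0)"
    if "x \<in> Sap" for x a
    using mem_P_aper_iff[OF h, of x _ a] Sap T(2) unit that by blast
  have p: "a \<in> P_per \<sigma> x (m ^ period \<sigma> x) \<longleftrightarrow> (\<forall>y\<in>orbit \<sigma> x. \<forall>z. fiber_sum \<sigma> a y m z = 0)"
    if "x \<in> Sp" "m \<in> T x" for x m a
    using mem_P_per_iff[OF h, of x m a] Sp unit that by blast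
  show ?thesis
  proof (rule set_eqI)
    fix a
    have "a \<in> vanishing_ideal \<sigma> S \<longleftrightarrow>
        (\<forall>x\<in>Sap. \<forall>l\<in>T x. \<forall>y\<in>orbit \<sigma> x. \<forall>z. fiber_sum \<sigma> a y l z = 0) \<and>
        (\<forall>x\<in>Sp. \<forall>m\<in>T x. \<forall>y\<in>orbit \<sigma> x. \<forall>z. fiber_sum \<sigma> a y m z = 0)"
      unfolding mem_vanishing_ideal_iff[OF cpt h sub] unfolding S by blast
    then show "a \<in> vanishing_ideal \<sigma> S \<longleftrightarrow>
        a \<in> (\<Inter>x\<in>Sap. P_aper \<sigma> x) \<inter> (\<Inter>x\<in>Sp. \<Inter>m\<in>T x. P_per \<sigma> x (m ^ period \<sigma> x))"
      using ap p by auto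
  qed
qed

theorem theorem4p17:
  fixes \<sigma> :: "'a::t2_space \<Rightarrow> 'a"
  assumes "compact (UNIV :: 'a set)"
    and "homeomorphism UNIV UNIV \<sigma> (inv \<sigma>)"
  shows
    "(\<forall>S\<in>zero_sets \<sigma>. S \<subseteq> UNIV \<times> sphere 0 1 \<and> closed S \<and> map_prod \<sigma> id ` S = S) \<and>
     antimono_on (closed_ideals \<sigma>) zero_set \<and>
     vanishing_ideal \<sigma> ` zero_sets \<sigma> \<subseteq> closed_ideals \<sigma> \<and>
     antimono_on (zero_sets \<sigma>) (vanishing_ideal \<sigma>) \<and>
     (\<forall>I\<in>closed_ideals \<sigma>. I \<subseteq> vanishing_ideal \<sigma> (zero_set I)) \<and>
     (\<forall>S\<in>zero_sets \<sigma>. zero_set (vanishing_ideal \<sigma> S) = S) \<and>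
    \<comment> \<open>(1)\<close>
    (bij_betw zero_set (invrep_kernels TYPE('h) \<sigma>) (zero_sets \<sigma>) \<and>
     bij_betw (vanishing_ideal \<sigma>) (zero_sets \<sigma>) (invrep_kernels TYPE('h) \<sigma>) \<and>
     (\<forall>I\<in>invrep_kernels TYPE('h) \<sigma>. vanishing_ideal \<sigma> (zero_set I) = I) \<and>
     (\<forall>S\<in>zero_sets \<sigma>. zero_set (vanishing_ideal \<sigma> S) = S)) \<and>
    \<comment> \<open>(2): (a) iff (b), (a) iff (c), (a) iff (d)\<close>
    ((inj_on zero_set (closed_ideals \<sigma>) \<longleftrightarrow>
        (\<forall>I\<in>closed_ideals \<sigma>. \<exists>S\<in>zero_sets \<sigma>. I = vanishing_ideal \<sigma> S)) \<and>
     (inj_on zero_set (closed_ideals \<sigma>) \<longleftrightarrow>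
        (\<forall>I\<in>closed_ideals \<sigma>. I \<in> invrep_kernels TYPE('h) \<sigma>)) \<and>
     (inj_on zero_set (closed_ideals \<sigma>) \<longleftrightarrow>
        (\<forall>S\<in>zero_sets \<sigma>. \<forall>I'. I' \<in> closed_ideals \<sigma> \<and> zero_set I' = S \<longleftrightarrow> I' = vanishing_ideal \<sigma> S))) \<and>
    \<comment> \<open>(3)\<close>
    (\<forall>I\<in>invrep_kernels TYPE('h) \<sigma>.
       \<forall>S. S \<in> zero_sets \<sigma> \<and> vanishing_ideal \<sigma> S = I \<longleftrightarrow> S = zero_set I) \<and>
    \<comment> \<open>(4)\<close>
    (\<forall>I\<in>closed_ideals \<sigma>.
       (vanishing_ideal \<sigma> (zero_set I) \<in> invrep_kernels TYPE('h) \<sigma> \<and>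
        I \<subseteq> vanishing_ideal \<sigma> (zero_set I) \<and>
        (\<forall>K\<in>invrep_kernels TYPE('h) \<sigma>. I \<subseteq> K \<longrightarrow> vanishing_ideal \<sigma> (zero_set I) \<subseteq> K)) \<and>
       (vanishing_ideal \<sigma> (zero_set I) \<in> closed_ideals \<sigma> \<and>
        zero_set (vanishing_ideal \<sigma> (zero_set I)) = zero_set I \<and>
        (\<forall>I'\<in>closed_ideals \<sigma>. zero_set I' = zero_set I \<longrightarrow>
           I' \<subseteq> vanishing_ideal \<sigma> (zero_set I))) \<and>
       ell1_star \<sigma> ` vanishing_ideal \<sigma> (zero_set I) = vanishing_ideal \<sigma> (zero_set I) \<and>
       (\<forall>Sap Sp T.
          Sap \<subseteq> Aper \<sigma> \<longrightarrow> Sp \<subseteq> Per \<sigma> \<longrightarrow>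
          (\<forall>x\<in>Sap \<union> Sp. T x \<subseteq> sphere 0 1) \<longrightarrow>
          (\<forall>x\<in>Sap. T x \<noteq> {}) \<longrightarrow>
          zero_set I = (\<Union>x\<in>Sap. \<Union>l\<in>T x. orbit \<sigma> x \<times> {l}) \<union>
                       (\<Union>x\<in>Sp. \<Union>m\<in>T x. orbit \<sigma> x \<times> {m}) \<longrightarrow>
          vanishing_ideal \<sigma> (zero_set I) =
            (\<Inter>x\<in>Sap. P_aper \<sigma> x) \<inter> (\<Inter>x\<in>Sp. \<Inter>m\<in>T x. P_per \<sigma> x (m ^ period \<sigma> x))))"
proof -
  note cpt = assms(1) and h = assms(2)
  let ?Z = "zero_set :: 'a ell1 set \<Rightarrow> ('a \<times> complex) set" and ?I = "vanishing_ideal \<sigma>"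
    and ?A = "closed_ideals \<sigma>" and ?B = "zero_sets \<sigma>" and ?R = "invrep_kernels TYPE('h) \<sigma>"
  have B: "S \<subseteq> UNIV \<times> sphere 0 1 \<and> closed S \<and> map_prod \<sigma> id ` S = S" if "S \<in> ?B" for S
    using that zero_set_subset closed_zero_set zero_set_invariant[OF h] unfolding zero_sets_def by blast
  have ZB: "?Z I \<in> ?B" if "I \<in> ?A" for I using that by (simp add: zero_sets_def)
  have IA: "?I S \<in> ?A" "?I S \<in> ?R" "\<And>a. a \<in> ?I S \<Longrightarrow> ell1_star \<sigma> a \<in> ?I S" if "S \<in> ?B" for S
    using vanishing_ideal_closed_ideal[OF cpt h, of S] vanishing_ideal_in_invrep_kernels[OF cpt h, of S]
      B[OF that] by blast+
  have ZI: "?Z (?I S) = S" if "S \<in> ?B" for S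
    using that zero_set_vanishing_ideal[OF h] by (auto simp: zero_sets_def)
  have sub: "I \<subseteq> ?I (?Z I)" if "I \<in> ?A" for I by (rule subset_vanishing_ideal_zero_set[OF that])
  have RA: "K \<in> ?A" "?I (?Z K) = K" if "K \<in> ?R" for K
    by (rule invrep_kernels_properties[OF cpt h that])+
  have Zanti: "?Z J \<subseteq> ?Z I" if "I \<subseteq> J" for I J using that by (auto simp: zero_set_def)
  have Ianti: "?I T \<subseteq> ?I S" if "S \<subseteq> T" for S T using that by (auto simp: vanishing_ideal_def)
  have bij1: "bij_betw ?Z ?R ?B"
    by (rule bij_betw_byWitness[where f' = ?I]) (use RA ZI ZB IA in auto)
  have bij2: "bij_betw ?I ?B ?R"
    by (rule bij_betw_byWitness[where f' = ?Z]) (use RA ZI ZB IA in auto)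
  \<comment> \<open>All conditions of (2) are compared with this one. It follows from injectivity
    because \<open>I\<close> and \<open>?I (?Z I)\<close> are closed ideals with the same zero
    set.\<close>
  have inj: "inj_on ?Z ?A \<longleftrightarrow> (\<forall>I\<in>?A. I = ?I (?Z I))"
  proof
    assume "inj_on ?Z ?A"
    then show "\<forall>I\<in>?A. I = ?I (?Z I)" using ZI ZB IA(1) by (metis inj_onD)
  next
    assume "\<forall>I\<in>?A. I = ?I (?Z I)"
    then show "inj_on ?Z ?A" by (metis inj_onI)
  qed
  have b: "inj_on ?Z ?A \<longleftrightarrow> (\<forall>I\<in>?A. \<exists>S\<in>?B. I = ?I S)"
    unfolding inj using ZI ZB by metis
  have c: "inj_on ?Z ?A \<longleftrightarrow> (\<forall>I\<in>?A. I \<in> ?R)"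
    unfolding inj using RA(2) ZB IA(2) by metis
  have d: "inj_on ?Z ?A \<longleftrightarrow> (\<forall>S\<in>?B. \<forall>I'. I' \<in> ?A \<and> ?Z I' = S \<longleftrightarrow> I' = ?I S)"
    unfolding inj using ZI ZB IA(1) by metis
  have p3: "\<forall>K\<in>?R. \<forall>S. S \<in> ?B \<and> ?I S = K \<longleftrightarrow> S = ?Z K"
    using RA ZB ZI by metis
  have star: "ell1_star \<sigma> ` ?I S = ?I S" if "S \<in> ?B" for S
  proof
    show "ell1_star \<sigma> ` ?I S \<subseteq> ?I S" using IA(3)[OF that] by blast
    show "?I S \<subseteq> ell1_star \<sigma> ` ?I S"
    proof
      fix a assume "a \<in> ?I S"
      then show "a \<in> ell1_star \<sigma> ` ?I S"
        using IA(3)[OF that] ell1_star_star[OF h, of a] by (metis imageI)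
    qed
  qed
  have least: "?I (?Z I) \<subseteq> K" if "I \<subseteq> K" "K \<in> ?R" for I K
    using Ianti[OF Zanti[OF that(1)]] RA(2)[OF that(2)] by simp
  have largest: "I' \<subseteq> ?I (?Z I)" if "I' \<in> ?A" "?Z I' = ?Z I" for I I'
    using sub[OF that(1)] that(2) by simp
  have anti: "antimono_on ?A ?Z" "antimono_on ?B ?I"
    using Zanti Ianti by (auto simp: monotone_on_def)
  show ?thesis
  proof (intro conjI ballI, goal_cases)
    case (1 S) then show ?case using B by blast
  next
    case (2 S) then show ?case using B by blast
  next
    case (3 S) then show ?case using B by blast
  next
    case 5 show ?case using IA(1) by blast
  next
    case (7 I) then show ?case by (rule sub)
  next
    case (8 S) then show ?case by (rule ZI)
  next
    case (11 K) then show ?case by (rule RA(2))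
  next
    case (12 S) then show ?case by (rule ZI)
  next
    case (16 K) then show ?case using p3 by blast
  next
    case (17 I) then show ?case by (intro IA(2) ZB)
  next
    case (18 I) then show ?case by (rule sub)
  next
    case (19 I K) then show ?case using least by blast
  next
    case (20 I) then show ?case by (intro IA(1) ZB)
  next
    case (21 I) then show ?case by (intro ZI ZB)
  next
    case (22 I I') then show ?case using largest by blast
  next
    case (23 I) then show ?case by (intro star ZB)
  next
    case (24 I) show ?case by (intro allI impI, rule vanishing_ideal_zero_set_eq_Inter[OF cpt h])
  qed (fact anti bij1 bij2 b c d)+
qed

end
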